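(* Let $f:[0,1]\times\mathbb R^d\to\mathbb R$ be a bounded continuous function and let $p\in[1,\infty)$. Assume that wherever $f(t,x)>0$, the function $f$ is twice differentiable in $x$, differentiable in $t$, and $$ f_t\le a_{ij}(t,x)\,\partial_{ij}f+C\,\|f(t,\cdot)\|_{L^\infty}^{1+\alpha}. $$ Here $\alpha\in[0,2p/d)$ and $C>0$ are constants, the coefficients $a_{ij}$ are locally uniformly elliptic and, for some constants $\delta>0$, $\Lambda>0$, $N$, $\kappa\in\mathbb R$ and $\beta\ge-\kappa/d$, for all $t\in[0,1]$ and $x\in\mathbb R^d$, $$ \det(a_{ij}(t,x))\ge\delta(1+|x|)^{\beta d-\kappa},\qquad (a_{ij}(t,x))\le\Lambda(1+|x|)^{\min(2\beta,2)}\,\mathrm I,\qquad \int_{\mathbb R^d}(1+|x|)^\kappa f(t,x)^p\,dx\le N . $$ Let $K$ be the number such that $$ K^p=C_1\,\frac{(1+\Lambda)^{d+1}N}{\delta}. $$ Then, for all $(t,x)\in[0,T]\times\mathbb R^d$ (with $t\le1$), $$ f(t,x)<K\,t^{-\frac d{2p}},\qquad\text{where}\qquad T=\Big(\frac{1+\Lambda}{C\,K^\alpha}\Big)^{1/\left(1-\frac{\alpha d}{2p}\right)} . $$ The constant $C_1$ depends on the dimension $d$ only.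
   Context: Repeated indices are summed. Matrix inequalities are in the sense of symmetric matrices, and $\mathrm I$ is the identity matrix. At $t=0$ the right-hand side $K\,t^{-d/(2p)}$ is read as $+\infty$.
   Formalization: C_1 may depend on d and p (with d only the claim fails: f=(1-|x|^2/(2d))_+, a=I, p→∞); f is replaced by its positive part in the L^∞ norm and the integral (the same for f≥0; false for sign-changing f otherwise); K>0 is assumed (N=0, f=0 would give 0<0). *)

theory Defs
  imports "HOL-Analysis.Analysis" "HOL-Probability.Essential_Supremum"
begin

text \<open>For a real exponent \<open>p\<close> the power \<open>f^p\<close> and, with it, the role of \<open>f\<close> in the source term
  only make sense through the nonnegative part of \<open>f\<close>; for \<open>f \<ge> 0\<close> this is \<open>f\<close> itself.\<close>

definition pos_part :: "('a \<Rightarrow> real) \<Rightarrow> 'a \<Rightarrow> real" where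
  "pos_part g x = max (g x) 0"

text \<open>The coercion sends an infinite essential supremum to \<open>0\<close>, so this is the \<open>L^\<infinity>\<close> norm only for
  essentially bounded Borel functions.\<close>

definition Linf_norm :: "('a::euclidean_space \<Rightarrow> real) \<Rightarrow> real" where
  "Linf_norm g = real_of_ereal (esssup lborel (\<lambda>x. ereal \<bar>g x\<bar>))"

definition partial_deriv :: "'n \<Rightarrow> (real^'n \<Rightarrow> real) \<Rightarrow> real^'n \<Rightarrow> real" where
  "partial_deriv i g x = frechet_derivative g (at x) (axis i 1)"

definition twice_differentiable_at :: "(real^'n \<Rightarrow> real) \<Rightarrow> real^'n \<Rightarrow> bool" where
  "twice_differentiable_at g x \<longleftrightarrow>
     (\<forall>\<^sub>F y in nhds x. g differentiable (at y)) \<and>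
     (\<forall>j. partial_deriv j g differentiable (at x))"

text \<open>The order on symmetric matrices; symmetry of both sides is part of the relation.\<close>

definition mat_le :: "real^'n^'n \<Rightarrow> real^'n^'n \<Rightarrow> bool" where
  "mat_le A B \<longleftrightarrow> transpose A = A \<and> transpose B = B \<and>
     (\<forall>\<xi>. \<xi> \<bullet> (A *v \<xi>) \<le> \<xi> \<bullet> (B *v \<xi>))"

definition locally_uniformly_elliptic_on ::
  "(real \<times> (real^'n)) set \<Rightarrow> (real \<Rightarrow> real^'n \<Rightarrow> real^'n^'n) \<Rightarrow> bool" where
  "locally_uniformly_elliptic_on D a \<longleftrightarrow>
     (\<forall>S. compact S \<and> S \<subseteq> D \<longrightarrow>
        (\<exists>l>0. \<exists>L. \<forall>(t, x)\<in>S. mat_le (l *\<^sub>R mat 1) (a t x) \<and> mat_le (a t x) (L *\<^sub>R mat 1)))"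

end

theory Submission
  imports Defs
begin

text \<open>
  The bound \<open>m t = K t^(-d/2p)\<close> holds for small \<open>t\<close> since \<open>f\<close> is bounded, and it is continued in time. As long as
  it holds and \<open>t \<le> T\<close>, the source is at most \<open>(1 + \<Lambda>) m / t\<close>, so \<open>f\<close> is a subsolution of a linear equation. If
  \<open>f\<close> came close to \<open>m\<close> at \<open>(t0, x0)\<close>, a barrier built from a paraboloid of the natural parabolic size could be slid
  with all slopes in a ball of radius of order \<open>m / l\<close>. The parabolic Aleksandrov--Bakelman--Pucci argument bounds the volume of
  these slopes by the integral of \<open>1 / det a\<close> over the contact set, on which \<open>f\<close> is of order \<open>m\<close>, hence by the
  weighted \<open>L^p\<close> bound; for a large constant \<open>C1\<close> this is a contradiction.

  As \<open>f\<close> has no joint regularity in \<open>(t, x)\<close>, the argument uses the area formula on time slices only: it bounds the left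
  Dini derivative of the integral over the slopes \<open>\<xi>\<close> of \<open>max_x (g(t, x) - \<xi> \<bullet> (x - x0))^+\<close>.

  The constant must not depend on \<open>\<beta>\<close>. For very negative \<open>\<beta>\<close> the weights vary, near the origin, on a scale much smaller than
  the natural parabolic ball. There \<open>f\<close> is compared with \<open>m (1 - c z^\<sigma>)\<close>, where \<open>z\<close> is of order
  \<open>(1 + |x|)^(-\<beta>) / (-\<beta> sqrt t)\<close>: its concavity allows paraboloids that are narrower in the radial direction, and
  \<open>\<sigma> = 2/(d + 1)\<close> is the exponent at which the volume of the slopes remains the natural one.
\<close>

section \<open>Determinant and trace of positive definite matrices\<close>

text \<open>Every paraboloid enters through \<open>touching\<close>, which takes a background
  \<open>V\<close>, a height \<theta> that is also the fraction of time used, and a matrix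
  \<open>P\<close> whose ellipsoid is the base. If w is the size of (1 + |x|)^(-\<beta>), all other
  quantities cancel, and large \<open>C1\<close> gives a contradiction once (w / sqrt t)^d \<le> A
  \<theta>^d |det P|, provided the convexity of the barrier, weighted by the bound on a, is at most
  A / t. In the rapidly varying case let z = w / (-\<beta> sqrt t) < 1. The concavity of the
  profile, of order \<beta>^2 z^\<sigma>, absorbs a paraboloid of radial width 1 / |\<beta>| if
  \<theta> is a small multiple of z^\<sigma>; across, \<open>P\<close> may have size |\<beta>| z /
  sqrt \<theta>. The volume condition then reads z \<le> A \<theta>^((d + 1)/2), which dictates
  \<sigma>. The profile bound at earlier times and nearby points is a hypothesis of the touching
  step, so it is proved at a first violation, which exists because the rapidly varying region is
  bounded and away from t = 0. The outer continuation needs a gap uniform in x; the positive lower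
  bound of the profile supplies it.\<close>

lemma conjugate_orthonormal_family:
  fixes A :: "real^'n^'n"
  assumes sym: "transpose A = A" and pos: "\<And>x. x \<noteq> 0 \<Longrightarrow> 0 < x \<bullet> (A *v x)"
  shows "\<exists>v :: 'n \<Rightarrow> real^'n. \<forall>i j. v i \<bullet> (A *v v j) = (if i = j then 1 else 0)"
proof -
  have "\<exists>v :: 'n \<Rightarrow> real^'n. \<forall>i\<in>I. \<forall>j\<in>I. v i \<bullet> (A *v v j) = (if i = j then 1 else 0)"
    if "finite I" for I :: "'n set"
    using that
  proof (induction I rule: finite_induct)
    case empty
    then show ?case by simp
  next
    case (insert k I)
    then obtain v :: "'n \<Rightarrow> real^'n"
      where v: "\<And>i j. i \<in> I \<Longrightarrow> j \<in> I \<Longrightarrow> v i \<bullet> (A *v v j) = (if i = j then 1 else 0)"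
      by blast
    \<comment> \<open>There are fewer vectors than dimensions, so some nonzero \<open>x\<close> is
      orthogonal to all \<open>A *v v i\<close>. Normalising it continues Gram-Schmidt for the form
      of \<open>A\<close>.\<close>
    have "card I < CARD('n)"
      using insert.hyps by (intro psubset_card_mono) auto
    moreover have "dim ((\<lambda>i. A *v v i) ` I) \<le> card ((\<lambda>i. A *v v i) ` I)"
      using insert.hyps by (intro dim_le_card') auto
    moreover have "card ((\<lambda>i. A *v v i) ` I) \<le> card I"
      using insert.hyps by (intro card_image_le)
    ultimately have "dim ((\<lambda>i. A *v v i) ` I) < DIM(real^'n)"
      by simp
    then obtain x where x: "x \<noteq> 0" "\<And>y. y \<in> span ((\<lambda>i. A *v v i) ` I) \<Longrightarrow> orthogonal x y"
      using orthogonal_to_subspace_exists[of "(\<lambda>i. A *v v i) ` I"] by metis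
    have orth: "x \<bullet> (A *v v i) = 0" if "i \<in> I" for i
      using x(2)[of "A *v v i"] that by (auto simp: orthogonal_def span_base)
    have orth': "v i \<bullet> (A *v x) = 0" if "i \<in> I" for i
      using orth[OF that] sym
      by (metis dot_lmul_matrix inner_commute transpose_matrix_vector)
    define r where "r = x \<bullet> (A *v x)"
    have r: "r > 0" using pos[OF x(1)] by (simp add: r_def)
    define w where "w = (1 / sqrt r) *\<^sub>R x"
    have ww: "w \<bullet> (A *v w) = 1"
      using r by (simp add: w_def matrix_vector_mult_scaleR r_def[symmetric])
    have "\<forall>i\<in>insert k I. \<forall>j\<in>insert k I. (v(k := w)) i \<bullet> (A *v (v(k := w)) j) = (if i = j then 1 else 0)"
      using v ww orth orth' insert.hyps(2)
      by (auto simp: w_def matrix_vector_mult_scaleR)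
    then show ?case by blast
  qed
  from this[of UNIV] show ?thesis by auto
qed

lemma pos_def_factorization:
  fixes A :: "real^'n^'n"
  assumes sym: "transpose A = A" and pos: "\<And>x. x \<noteq> 0 \<Longrightarrow> 0 < x \<bullet> (A *v x)"
  obtains W :: "real^'n^'n" where "A = transpose W ** W"
proof -
  obtain v :: "'n \<Rightarrow> real^'n" where v: "\<And>i j. v i \<bullet> (A *v v j) = (if i = j then 1 else 0)"
    using conjugate_orthonormal_family[OF assms] by blast
  define V where "V = transpose (\<chi> i. v i)"
  have "transpose V ** (A ** V) = mat 1"
  proof -
    have "(transpose V ** (A ** V)) $ i $ j = v i \<bullet> (A *v v j)" for i j
      unfolding V_def
      by (simp add: matrix_matrix_mult_def transpose_def matrix_vector_mult_def inner_vec_def)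
    then show ?thesis by (simp add: vec_eq_iff mat_def v)
  qed
  then have VV: "(A ** V) ** transpose V = mat 1"
    by (simp add: matrix_left_right_inverse)
  then have "A ** (V ** transpose V) = mat 1"
    by (simp add: matrix_mul_assoc)
  have tv: "transpose V ** (A ** V) = mat 1" by fact
  have "V ** (transpose V ** A) = mat 1"
    by (metis tv matrix_left_right_inverse matrix_mul_assoc)
  \<comment> \<open>The inverse of \<open>V\<close> is \<open>transpose V ** A\<close>; it serves as
    \<open>W\<close>.\<close>
  have "A = (A ** V) ** (transpose V ** A)"
    using \<open>V ** (transpose V ** A) = mat 1\<close> by (metis matrix_mul_assoc matrix_mul_rid)
  moreover have "A ** V = transpose (transpose V ** A)"
    by (simp add: matrix_transpose_mul sym)
  ultimately have "A = transpose (transpose V ** A) ** (transpose V ** A)" by simp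
  then show ?thesis using that by blast
qed

text \<open>Testing the form on e_i + e_j and e_i - e_j bounds an off-diagonal entry by diagonal
  ones, which are nonnegative.\<close>

lemma psd_entry_le_trace:
  fixes M :: "real^'n^'n"
  assumes sym: "transpose M = M" and psd: "\<And>x. 0 \<le> x \<bullet> (M *v x)"
  shows "\<bar>M $ i $ j\<bar> \<le> trace M"
proof -
  have e: "axis i 1 \<bullet> (M *v axis j 1) = M $ i $ j" for i j
    by (simp add: inner_axis' matrix_vector_mult_basis column_def)
  have s: "M $ j $ i = M $ i $ j" for i j
    using arg_cong[OF sym, of "\<lambda>A. A $ i $ j"] by (simp add: transpose_def)
  have d: "0 \<le> M $ i $ i" for i using psd[of "axis i 1"] e by simp
  show ?thesis
  proof (cases "i = j")
    case True
    then show ?thesis using d member_le_sum[of j UNIV "\<lambda>k. M $ k $ k"]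
      by (simp add: trace_def)
  next
    case False
    have "0 \<le> M $ i $ i + M $ j $ j + 2 * M $ i $ j"
      using psd[of "axis i 1 + axis j 1"] e s
      by (simp add: matrix_vector_right_distrib inner_simps)
    moreover have "0 \<le> M $ i $ i + M $ j $ j - 2 * M $ i $ j"
      using psd[of "axis i 1 - axis j 1"] e s
      by (simp add: matrix_vector_mult_diff_distrib inner_simps)
    moreover have "M $ i $ i + M $ j $ j = (\<Sum>k\<in>{i,j}. M $ k $ k)" using False by simp
    moreover have "(\<Sum>k\<in>{i,j}. M $ k $ k) \<le> trace M"
      unfolding trace_def by (intro sum_mono2) (auto intro: d)
    moreover have "0 \<le> M $ i $ i + M $ j $ j" using d[of i] d[of j] by simp
    ultimately show ?thesis by linarith
  qed
qed

text \<open>The Leibniz expansion with every entry bounded by the trace. The factor d! is cruder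
  than the one from the arithmetic-geometric mean inequality, but diagonalisation is
  avoided.\<close>

lemma psd_det_le_trace_power:
  fixes M :: "real^'n^'n"
  assumes sym: "transpose M = M" and psd: "\<And>x. 0 \<le> x \<bullet> (M *v x)"
  shows "\<bar>det M\<bar> \<le> fact CARD('n) * trace M ^ CARD('n)"
proof -
  have "\<bar>det M\<bar> \<le> (\<Sum>p | p permutes (UNIV :: 'n set). \<bar>of_int (sign p) * (\<Prod>i\<in>UNIV. M $ i $ p i)\<bar>)"
    unfolding det_def by (rule sum_abs)
  also have "\<dots> \<le> (\<Sum>p | p permutes (UNIV :: 'n set). trace M ^ CARD('n))"
  proof (rule sum_mono)
    fix p assume "p \<in> {p. p permutes (UNIV :: 'n set)}"
    have "\<bar>of_int (sign p) * (\<Prod>i\<in>UNIV. M $ i $ p i)\<bar> = (\<Prod>i\<in>UNIV. \<bar>M $ i $ p i\<bar>)"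
      by (simp add: abs_mult abs_prod sign_def)
    also have "\<dots> \<le> (\<Prod>i\<in>(UNIV::'n set). trace M)"
      by (rule prod_mono) (use psd_entry_le_trace[OF assms] in auto)
    finally show "\<bar>of_int (sign p) * (\<Prod>i\<in>UNIV. M $ i $ p i)\<bar> \<le> trace M ^ CARD('n)" by simp
  qed
  also have "\<dots> = fact CARD('n) * trace M ^ CARD('n)"
    by (simp add: card_permutations)
  finally show ?thesis .
qed

lemma trace_psd_nonneg:
  fixes M :: "real^'n^'n"
  assumes "\<And>x. 0 \<le> x \<bullet> (M *v x)"
  shows "0 \<le> trace M"
  unfolding trace_def
proof (rule sum_nonneg)
  fix i
  show "0 \<le> M $ i $ i" using assms[of "axis i 1"]
    by (simp add: inner_axis' matrix_vector_mult_basis column_def)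
qed

lemma congruence_quadratic_form:
  fixes W B :: "real^'n^'n"
  shows "x \<bullet> ((W ** B ** transpose W) *v x) = (transpose W *v x) \<bullet> (B *v (transpose W *v x))"
  by (metis dot_lmul_matrix matrix_vector_mul_assoc transpose_matrix_vector)

lemma trace_congruence:
  fixes W B :: "real^'n^'n"
  shows "trace ((transpose W ** W) ** B) = trace (W ** B ** transpose W)"
  by (metis matrix_mul_assoc trace_mul_sym)

lemma trace_pos_def_mult_nonneg:
  fixes A B :: "real^'n^'n"
  assumes "transpose A = A" "\<And>x. x \<noteq> 0 \<Longrightarrow> 0 < x \<bullet> (A *v x)" and B: "\<And>x. 0 \<le> x \<bullet> (B *v x)"
  shows "0 \<le> trace (A ** B)"
proof -
  obtain W :: "real^'n^'n" where W: "A = transpose W ** W"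
    using pos_def_factorization[OF assms(1,2)] by blast
  show ?thesis unfolding W trace_congruence
    by (rule trace_psd_nonneg) (simp only: congruence_quadratic_form B)
qed

text \<open>With \<open>A = transpose W ** W\<close>, both \<open>det A * det B\<close> and
  \<open>trace (A ** B)\<close> belong to the single semidefinite matrix
  \<open>W ** B ** transpose W\<close>.\<close>

lemma det_mult_le_trace_power:
  fixes A B :: "real^'n^'n"
  assumes "transpose A = A" "\<And>x. x \<noteq> 0 \<Longrightarrow> 0 < x \<bullet> (A *v x)"
    and symB: "transpose B = B" and B: "\<And>x. 0 \<le> x \<bullet> (B *v x)"
  shows "\<bar>det A * det B\<bar> \<le> fact CARD('n) * trace (A ** B) ^ CARD('n)"
proof -
  obtain W :: "real^'n^'n" where W: "A = transpose W ** W"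
    using pos_def_factorization[OF assms(1,2)] by blast
  have "det A * det B = det (W ** B ** transpose W)"
    by (simp add: W det_mul det_transpose)
  moreover have "\<bar>det (W ** B ** transpose W)\<bar> \<le> fact CARD('n) * trace (W ** B ** transpose W) ^ CARD('n)"
  proof (rule psd_det_le_trace_power)
    show "transpose (W ** B ** transpose W) = W ** B ** transpose W"
      by (simp add: matrix_transpose_mul symB matrix_mul_assoc)
    show "\<And>x. 0 \<le> x \<bullet> ((W ** B ** transpose W) *v x)"
      by (simp only: congruence_quadratic_form B)
  qed
  ultimately show ?thesis by (simp add: W trace_congruence)
qed

section \<open>The area formula on sublevel sets of the Jacobian\<close>

text \<open>On the sublevel set the Jacobian is dominated by the integrable \<open>k\<close>, which
  supplies the integrability that the area formula asks for. The derivative of \<open>f\<close> is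
  required pointwise on \<open>S\<close> only.\<close>

lemma measure_image_sublevel_jacobian_wellorder:
  fixes f :: "real^'n::{finite,wellorder} \<Rightarrow> real^'n::_" and k :: "real^'n::_ \<Rightarrow> real"
  assumes S: "S \<in> sets lebesgue"
    and f: "\<And>x. x \<in> S \<Longrightarrow> (f has_derivative f' x) (at x within S)"
    and k: "k \<in> borel_measurable borel" "\<And>x. 0 \<le> k x" "(\<integral>\<^sup>+x. k x \<partial>lborel) \<le> ennreal J" "0 \<le> J"
  defines "A \<equiv> {x \<in> S. \<bar>det (matrix (f' x))\<bar> \<le> k x}"
  shows "f ` A \<in> lmeasurable \<and> measure lebesgue (f ` A) \<le> J"
proof -
  have kL: "k \<in> borel_measurable lebesgue"
    using k(1) by (intro measurable_completion) simp
  have "integrable lborel k"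
    using k by (intro integrableI_nonneg) (auto simp: less_top[symmetric] top_unique dest: neq_top_trans[OF ennreal_neq_top])
  then have int_k: "integrable lebesgue k" and Ik: "integral\<^sup>L lebesgue k = integral\<^sup>L lborel k"
    using k(1) by (auto simp: integrable_completion integral_completion)
  have "integral\<^sup>L lborel k \<le> J"
    using k by (intro integral_real_bounded) auto
  have kint: "(k has_integral integral\<^sup>L lebesgue k) UNIV"
    using has_integral_integral_lebesgue[OF int_k] by simp
  define D where "D = (\<lambda>x. \<bar>det (matrix (f' x))\<bar>)"
  have D: "(\<lambda>x. D x) \<in> borel_measurable (lebesgue_on S)"
    unfolding D_def using borel_measurable_det_Jacobian[OF S f] by measurable
  have "A = {x \<in> space (lebesgue_on S). D x \<le> k x}"
    by (auto simp: A_def D_def space_restrict_space)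
  also have "\<dots> \<in> sets (lebesgue_on S)"
    using D measurable_restrict_space1[OF kL, of S] by (rule borel_measurable_le)
  finally have AS: "A \<in> sets (lebesgue_on S)" .
  then have A: "A \<in> sets lebesgue"
    using S by (metis sets_restrict_space_iff Int_iff sets.Int_space_eq2 sets_completionI_sets space_completion space_lborel)
  have subA: "A \<subseteq> S" by (auto simp: A_def)
  have "k absolutely_integrable_on UNIV"
    using kint k(2) by (intro nonnegative_absolutely_integrable_1) (auto simp: has_integral_integrable)
  then have "k absolutely_integrable_on A"
    by (rule set_integrable_subset) (use A in auto)
  then have intA: "k integrable_on A"
    by (rule set_lebesgue_integral_eq_integral(1))
  have DA: "D \<in> borel_measurable (lebesgue_on A)"
    using D subA by (meson measurable_restrict_mono)
  have "D integrable_on A"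
    by (rule measurable_bounded_by_integrable_imp_integrable_real[OF DA intA _ A])
       (auto simp: A_def D_def)
  then have *: "f ` A \<in> lmeasurable" "measure lebesgue (f ` A) \<le> integral A D"
    unfolding D_def using f subA
    by (auto intro!: measurable_differentiable_image[OF A] measure_differentiable_image[OF A] has_derivative_subset[OF f])
  note *(2)
  also have "integral A D \<le> integral A k"
    by (rule integral_le[OF \<open>D integrable_on A\<close> intA]) (auto simp: A_def D_def)
  also have "\<dots> \<le> integral UNIV k"
    using kint k(2) intA by (intro integral_subset_le) (auto simp: has_integral_integrable)
  also have "\<dots> = integral\<^sup>L lebesgue k" using kint by (simp add: integral_unique)
  also have "\<dots> \<le> J" using Ik \<open>integral\<^sup>L lborel k \<le> J\<close> by simp
  finally show ?thesis using * by simp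
qed

text \<open>The area formula of the library is stated for index types of sort \<open>wellorder\<close> only;
  a copy of the index type with an arbitrary linear order carries it over to all finite index types.\<close>

typedef 'a ordered_copy = "UNIV :: 'a set" by simp

instance ordered_copy :: (finite) finite
proof
  have "(UNIV :: 'a ordered_copy set) = Abs_ordered_copy ` UNIV"
    by (metis Abs_ordered_copy_cases UNIV_eq_I image_iff)
  then show "finite (UNIV :: 'a ordered_copy set)" by (metis finite finite_imageI)
qed

instantiation ordered_copy :: (finite) wellorder
begin

definition less_eq_ordered_copy :: "'a ordered_copy \<Rightarrow> 'a ordered_copy \<Rightarrow> bool" where
  "x \<le> y \<longleftrightarrow> to_nat (Rep_ordered_copy x) \<le> to_nat (Rep_ordered_copy y)"

definition less_ordered_copy :: "'a ordered_copy \<Rightarrow> 'a ordered_copy \<Rightarrow> bool" where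
  "x < y \<longleftrightarrow> to_nat (Rep_ordered_copy x) < to_nat (Rep_ordered_copy y)"

instance
proof
  fix P :: "'a ordered_copy \<Rightarrow> bool" and a
  assume *: "\<And>x. (\<And>y. y < x \<Longrightarrow> P y) \<Longrightarrow> P x"
  show "P a"
    by (induction a rule: measure_induct_rule[of "\<lambda>x. to_nat (Rep_ordered_copy x)"])
       (rule *, simp add: less_ordered_copy_def)
qed (auto simp: less_eq_ordered_copy_def less_ordered_copy_def Rep_ordered_copy_inject)

end

section \<open>Renaming of coordinates along a bijection of index types\<close>

definition reindex :: "('m \<Rightarrow> 'n) \<Rightarrow> real^'n \<Rightarrow> real^'m" where
  "reindex r x = (\<chi> i. x $ r i)"

lemma reindex_nth [simp]: "reindex r x $ i = x $ r i"
  by (simp add: reindex_def)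

lemma linear_reindex: "linear (reindex r)"
  by (intro linearI) (simp_all add: vec_eq_iff)

lemma bounded_linear_reindex: "bounded_linear (reindex r :: real^'n \<Rightarrow> real^'m)"
  using linear_reindex by (simp add: linear_conv_bounded_linear)

lemma continuous_reindex: "continuous_on A (reindex r :: real^'n \<Rightarrow> real^'m)"
  using bounded_linear_reindex by (rule bounded_linear.continuous_on) simp

lemma borel_measurable_reindex [measurable]: "(reindex r :: real^'n \<Rightarrow> real^'m) \<in> borel_measurable borel"
  by (intro borel_measurable_continuous_onI continuous_reindex)

lemma reindex_inverse: "bij r \<Longrightarrow> reindex r (reindex (inv r) x) = x"
  by (simp add: vec_eq_iff bij_def)

lemma prod_Basis_cart: "(\<Prod>b\<in>Basis. x \<bullet> b) = (\<Prod>i\<in>UNIV. (x :: real^'n) $ i)"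
  by (simp add: Basis_vec_def cart_eq_inner_axis axis_eq_axis prod.UNION_disjoint)

text \<open>Boxes go to boxes with the same side lengths in another order, and the values on boxes
  characterise Lebesgue measure.\<close>

lemma distr_lborel_reindex:
  fixes r :: "'m::finite \<Rightarrow> 'n::finite"
  assumes r: "bij r"
  shows "distr lborel borel (reindex r :: real^'n \<Rightarrow> real^'m) = lborel"
proof (rule lborel_eqI[symmetric])
  fix l u :: "real^'m"
  assume lu: "\<And>b. b \<in> Basis \<Longrightarrow> l \<bullet> b \<le> u \<bullet> b"
  have ir: "bij (inv r)" using r by (rule bij_imp_bij_inv)
  have all: "(\<forall>i. P (r i) i) \<longleftrightarrow> (\<forall>j. P j (inv r j))" for P
    using r by (metis bij_inv_eq_iff)
  have "(reindex r :: real^'n \<Rightarrow> real^'m) -` box l u = box (reindex (inv r) l) (reindex (inv r) u)"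
  proof (rule set_eqI)
    fix x
    show "x \<in> (reindex r :: real^'n \<Rightarrow> real^'m) -` box l u \<longleftrightarrow> x \<in> box (reindex (inv r) l) (reindex (inv r) u)"
      using all[of "\<lambda>j i. l $ i < x $ j \<and> x $ j < u $ i"] by (simp add: mem_box_cart)
  qed
  then have "emeasure (distr lborel borel (reindex r :: real^'n \<Rightarrow> real^'m)) (box l u)
      = emeasure lborel (box (reindex (inv r) l) (reindex (inv r) u))"
    by (subst emeasure_distr) auto
  also have "\<dots> = (\<Prod>b\<in>Basis. (reindex (inv r) u - reindex (inv r) l) \<bullet> b)"
  proof (rule emeasure_lborel_box)
    fix b :: "real^'n" assume "b \<in> Basis"
    then obtain j where "b = axis j 1" by (auto simp: Basis_vec_def)
    then show "reindex (inv r) l \<bullet> b \<le> reindex (inv r) u \<bullet> b"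
      using lu[of "axis (inv r j) 1"] by (simp add: inner_axis axis_in_Basis_iff)
  qed
  also have "(\<Prod>b\<in>Basis. (reindex (inv r) u - reindex (inv r) l) \<bullet> b) = (\<Prod>b\<in>Basis. (u - l) \<bullet> b)"
    unfolding prod_Basis_cart
    using prod.reindex_bij_betw[OF ir, of "\<lambda>i. u $ i - l $ i"] by simp
  finally show "emeasure (distr lborel borel (reindex r :: real^'n \<Rightarrow> real^'m)) (box l u)
      = (\<Prod>b\<in>Basis. (u - l) \<bullet> b)" .
qed simp

lemma sets_lebesgue_reindex:
  fixes r :: "'m::finite \<Rightarrow> 'n::finite"
  assumes "bij r" "S \<in> sets lebesgue"
  shows "(reindex r :: real^'n \<Rightarrow> real^'m) ` S \<in> sets lebesgue"
proof (rule differentiable_image_in_sets_lebesgue)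
  show "DIM(real^'n) \<le> DIM(real^'m)"
    using bij_betw_same_card[OF assms(1)] by simp
qed (use assms bounded_linear_reindex in \<open>auto intro: bounded_linear_imp_differentiable_on\<close>)

text \<open>The image is contained in the preimage of an open superset under the inverse renaming,
  where the Borel statement applies; outer regularity then reaches all Lebesgue measurable
  sets.\<close>

lemma emeasure_lebesgue_reindex_le:
  fixes r :: "'m::finite \<Rightarrow> 'n::finite" and S :: "(real^'n) set"
  assumes r: "bij r" and S: "S \<in> sets lebesgue"
  shows "emeasure lebesgue ((reindex r :: real^'n \<Rightarrow> real^'m) ` S) \<le> emeasure lebesgue S"
proof (rule ennreal_le_epsilon)
  fix e :: real assume "e > 0"
  obtain T where T: "open T" "S \<subseteq> T" "T - S \<in> lmeasurable" "emeasure lebesgue (T - S) < ennreal e"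
    using sets_lebesgue_outer_open[OF S \<open>e > 0\<close>] by metis
  have sub: "reindex r ` T \<subseteq> (reindex (inv r) :: real^'m \<Rightarrow> real^'n) -` T"
    using r by (auto simp: reindex_def surj_f_inv_f[OF bij_is_surj] vec_eq_iff)
  have "emeasure lebesgue ((reindex r :: real^'n \<Rightarrow> real^'m) ` S)
      \<le> emeasure lebesgue ((reindex (inv r) :: real^'m \<Rightarrow> real^'n) -` T)"
    using sub T(1,2) continuous_reindex[of UNIV "inv r"]
    by (intro emeasure_mono) (auto intro!: borel_open sets_completionI_sets simp: open_vimage)
  also have "\<dots> = emeasure (distr lborel borel (reindex (inv r) :: real^'m \<Rightarrow> real^'n)) T"
    using T(1) continuous_reindex[of UNIV "inv r"]
    by (subst emeasure_distr) (auto simp: open_vimage)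
  also have "\<dots> = emeasure lebesgue T"
    using distr_lborel_reindex[OF bij_imp_bij_inv[OF r]] T(1) by simp
  also have "\<dots> \<le> emeasure lebesgue S + emeasure lebesgue (T - S)"
    using T S by (metis Diff_partition emeasure_subadditive fmeasurableD)
  also have "\<dots> \<le> emeasure lebesgue S + ennreal e"
    using T(4) by (intro add_left_mono) auto
  finally show "emeasure lebesgue ((reindex r :: real^'n \<Rightarrow> real^'m) ` S) \<le> emeasure lebesgue S + ennreal e" .
qed

text \<open>Conjugation by \<open>r\<close> is a sign-preserving bijection between the permutations
  of the two index types.\<close>

lemma det_reindex:
  fixes A :: "real^'n^'n" and r :: "'m::finite \<Rightarrow> 'n"
  assumes r: "bij r"
  shows "det (\<chi> i j. A $ r i $ r j) = det A"
proof -
  let ?c = "map_permutation UNIV r"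
  have inj: "inj r" using r by (simp add: bij_def)
  have bij: "bij_betw ?c {p. p permutes UNIV} {p. p permutes UNIV}"
  proof -
    have "?c = (\<lambda>\<pi> x. if x \<in> UNIV then r (\<pi> (inv_into UNIV r x)) else x)"
      using r by (auto simp: fun_eq_iff map_permutation_def restrict_id_def bij_def)
    then show ?thesis using bij_betw_permutations[of r UNIV UNIV] r by simp
  qed
  have "det A = (\<Sum>p\<in>{p. p permutes UNIV}. of_int (sign (?c p)) * (\<Prod>i\<in>UNIV. A $ i $ (?c p) i))"
    unfolding det_def by (rule sum.reindex_bij_betw[OF bij, symmetric])
  also have "\<dots> = (\<Sum>p\<in>{p. p permutes UNIV}. of_int (sign p) * (\<Prod>i\<in>UNIV. A $ r i $ r (p i)))"
  proof (rule sum.cong[OF refl])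
    fix p :: "'m \<Rightarrow> 'm" assume "p \<in> {p. p permutes UNIV}"
    have "(\<Prod>i\<in>UNIV. A $ i $ (?c p) i) = (\<Prod>i\<in>UNIV. A $ r i $ (?c p) (r i))"
      by (rule prod.reindex_bij_betw[OF r, symmetric])
    also have "\<dots> = (\<Prod>i\<in>UNIV. A $ r i $ r (p i))"
      using inj by (simp add: map_permutation_apply)
    finally show "of_int (sign (?c p)) * (\<Prod>i\<in>UNIV. A $ i $ (?c p) i)
        = of_int (sign p) * (\<Prod>i\<in>UNIV. A $ r i $ r (p i))"
      using inj \<open>p \<in> _\<close> by (simp add: sign_map_permutation)
  qed
  finally show ?thesis by (simp add: det_def)
qed

lemma measure_image_sublevel_jacobian:
  fixes f :: "real^'n \<Rightarrow> real^'n" and k :: "real^'n \<Rightarrow> real"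
  assumes S: "S \<in> sets lebesgue"
    and f: "\<And>x. x \<in> S \<Longrightarrow> (f has_derivative f' x) (at x within S)"
    and k: "k \<in> borel_measurable borel" "\<And>x. 0 \<le> k x" "(\<integral>\<^sup>+x. k x \<partial>lborel) \<le> ennreal J" "0 \<le> J"
  defines "A \<equiv> {x \<in> S. \<bar>det (matrix (f' x))\<bar> \<le> k x}"
  shows "f ` A \<in> lmeasurable \<and> measure lebesgue (f ` A) \<le> J"
proof -
  let ?r = "Rep_ordered_copy :: 'n ordered_copy \<Rightarrow> 'n"
  let ?\<phi> = "reindex ?r :: real^'n \<Rightarrow> real^('n ordered_copy)"
  let ?\<psi> = "reindex (inv ?r) :: real^('n ordered_copy) \<Rightarrow> real^'n"
  have r: "bij ?r"
    by (rule bijI'[of ?r]) (auto simp: Rep_ordered_copy_inject intro: Abs_ordered_copy_inverse[symmetric])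
  have ir: "bij (inv ?r)" using r by (rule bij_imp_bij_inv)
  have [simp]: "?\<psi> (?\<phi> x) = x" for x
    using reindex_inverse[OF ir, of x] r by (simp add: inv_inv_eq)
  have [simp]: "?\<phi> (?\<psi> y) = y" for y
    using reindex_inverse[OF r, of y] .
  define F where "F = (\<lambda>y. ?\<phi> (f (?\<psi> y)))"
  define F' where "F' = (\<lambda>y v. ?\<phi> (f' (?\<psi> y) (?\<psi> v)))"
  define B where "B = {y \<in> ?\<phi> ` S. \<bar>det (matrix (F' y))\<bar> \<le> k (?\<psi> y)}"
  have lin: "linear (f' x)" if "x \<in> S" for x
    using f[OF that] by (rule has_derivative_linear)
  have det: "det (matrix (F' y)) = det (matrix (f' (?\<psi> y)))" for y
  proof -
    have ax: "?\<psi> (axis j 1) = axis (?r j) 1" for j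
      unfolding vec_eq_iff reindex_nth axis_def using r by (simp add: bij_inv_eq_iff) (metis bij_inv_eq_iff)
    have "matrix (F' y) = (\<chi> i j. matrix (f' (?\<psi> y)) $ ?r i $ ?r j)"
      by (simp add: vec_eq_iff matrix_def F'_def ax)
    then show ?thesis using det_reindex[OF r] by metis
  qed
  have "F ` B \<in> lmeasurable \<and> measure lebesgue (F ` B) \<le> J"
    unfolding B_def
  proof (rule measure_image_sublevel_jacobian_wellorder)
    show "?\<phi> ` S \<in> sets lebesgue" using sets_lebesgue_reindex[OF r S] .
    show "(F has_derivative F' y) (at y within ?\<phi> ` S)" if "y \<in> ?\<phi> ` S" for y
    proof -
      have "?\<psi> y \<in> S" "?\<psi> ` ?\<phi> ` S = S" using that by (auto simp: image_image)
      then have 1: "(f has_derivative f' (?\<psi> y)) (at (?\<psi> y) within ?\<psi> ` ?\<phi> ` S)" using f by simp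
      have 2: "(?\<psi> has_derivative ?\<psi>) (at y within ?\<phi> ` S)"
        by (intro bounded_linear_imp_has_derivative bounded_linear_reindex)
      have "((\<lambda>y. f (?\<psi> y)) has_derivative (\<lambda>v. f' (?\<psi> y) (?\<psi> v))) (at y within ?\<phi> ` S)"
        using has_derivative_in_compose[OF 2 1] .
      then show ?thesis unfolding F_def F'_def
        by (rule bounded_linear.has_derivative[OF bounded_linear_reindex])
    qed
    show "(\<lambda>y. k (?\<psi> y)) \<in> borel_measurable borel" using k(1) by measurable
    have "(\<integral>\<^sup>+y. k (?\<psi> y) \<partial>lborel) = (\<integral>\<^sup>+x. k x \<partial>distr lborel borel ?\<psi>)"
      using k(1) by (subst nn_integral_distr) auto
    then show "(\<integral>\<^sup>+y. k (?\<psi> y) \<partial>lborel) \<le> ennreal J"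
      using k(3) by (simp add: distr_lborel_reindex[OF ir])
  qed (use k in auto)
  moreover have "B = ?\<phi> ` A"
    unfolding A_def B_def det by auto
  then have FB: "f ` A = ?\<psi> ` F ` B"
    by (simp add: F_def image_image)
  ultimately have FB': "F ` B \<in> lmeasurable" "measure lebesgue (F ` B) \<le> J" by auto
  have 1: "f ` A \<in> sets lebesgue"
    unfolding FB by (rule sets_lebesgue_reindex[OF ir fmeasurableD[OF FB'(1)]])
  have "emeasure lebesgue (f ` A) \<le> emeasure lebesgue (F ` B)"
    unfolding FB by (rule emeasure_lebesgue_reindex_le[OF ir fmeasurableD[OF FB'(1)]])
  also have "\<dots> \<le> ennreal J"
    using FB' by (simp add: emeasure_eq_measure2 ennreal_leI)
  finally have 4: "emeasure lebesgue (f ` A) \<le> ennreal J" .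
  then have "f ` A \<in> lmeasurable"
    using 1 by (intro fmeasurableI) (auto simp: le_less_trans[OF _ ennreal_less_top])
  then show ?thesis using 4 k(4)
    by (simp add: emeasure_eq_measure2)
qed

section \<open>Second-order calculus at a point\<close>

lemma gradient_expansion:
  fixes \<phi> :: "real^'n \<Rightarrow> real"
  assumes D: "\<forall>\<^sub>F y in nhds x. (\<phi> has_derivative (\<lambda>v. D y \<bullet> v)) (at y)"
    and H: "(D has_derivative (\<lambda>v. H *v v)) (at x)" and e: "0 < e"
  obtains d where "0 < d" "\<And>y. norm (y - x) < d \<Longrightarrow> (\<phi> has_derivative (\<lambda>v. D y \<bullet> v)) (at y)"
    "\<And>y. norm (y - x) < d \<Longrightarrow> norm (D y - D x - H *v (y - x)) \<le> e * norm (y - x)"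
proof -
  obtain d1 where d1: "0 < d1" "\<And>y. dist y x < d1 \<Longrightarrow> (\<phi> has_derivative (\<lambda>v. D y \<bullet> v)) (at y)"
    using D unfolding eventually_nhds_metric by blast
  obtain d2 where d2: "0 < d2" "\<And>y. norm (y - x) < d2 \<Longrightarrow> norm (D y - D x - H *v (y - x)) \<le> e * norm (y - x)"
    using H e unfolding has_derivative_at_alt by blast
  show ?thesis using d1 d2 by (intro that[of "min d1 d2"]) (auto simp: dist_norm)
qed

lemma line_derivative:
  fixes \<phi> :: "real^'n \<Rightarrow> real"
  assumes "(\<phi> has_derivative (\<lambda>v. D (y + r *\<^sub>R w) \<bullet> v)) (at (y + r *\<^sub>R w))"
  shows "((\<lambda>r. \<phi> (y + r *\<^sub>R w)) has_real_derivative D (y + r *\<^sub>R w) \<bullet> w) (at r)"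
proof -
  have "((\<lambda>r. y + r *\<^sub>R w) has_derivative (\<lambda>h. h *\<^sub>R w)) (at r)"
    by (auto intro!: derivative_eq_intros)
  from has_derivative_compose[OF this assms]
  moreover have "(\<lambda>h. D (y + r *\<^sub>R w) \<bullet> (h *\<^sub>R w)) = (*) (D (y + r *\<^sub>R w) \<bullet> w)"
    by (simp add: fun_eq_iff mult.commute)
  ultimately show ?thesis by (simp only: has_field_derivative_def)
qed

text \<open>The mean value theorem along \<open>w\<close> leaves a difference of two gradients,
  which the expansion of \<open>D\<close> around \<open>x\<close> turns into the Hessian term. For
  the second order, differentiability of \<open>D\<close> at the single point \<open>x\<close> is
  enough.\<close>

lemma second_difference_estimate:
  fixes \<phi> :: "real^'n \<Rightarrow> real"
  assumes D: "\<And>y. norm (y - x) < d \<Longrightarrow> (\<phi> has_derivative (\<lambda>v. D y \<bullet> v)) (at y)"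
    and H: "\<And>y. norm (y - x) < d \<Longrightarrow> norm (D y - D x - H *v (y - x)) \<le> e * norm (y - x)"
    and s: "0 < s" "s * (norm v + norm w) < d" and e: "0 < e"
  shows "\<bar>\<phi> (x + s *\<^sub>R v + s *\<^sub>R w) - \<phi> (x + s *\<^sub>R v) - \<phi> (x + s *\<^sub>R w) + \<phi> x - s\<^sup>2 * (w \<bullet> (H *v v))\<bar>
    \<le> 2 * e * s\<^sup>2 * (norm v + norm w)\<^sup>2"
proof -
  have small: "norm (t *\<^sub>R v + r *\<^sub>R w) \<le> s * (norm v + norm w)"
    if "0 \<le> t" "t \<le> s" "0 \<le> r" "r \<le> s" for t r
  proof -
    have "norm (t *\<^sub>R v + r *\<^sub>R w) \<le> t * norm v + r * norm w"
      using that by (metis norm_triangle_le order_refl norm_scaleR abs_of_nonneg)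
    also have "\<dots> \<le> s * norm v + s * norm w"
      using that by (intro add_mono mult_right_mono) auto
    finally show ?thesis by (simp add: algebra_simps)
  qed
  let ?k = "\<lambda>r. \<phi> ((x + s *\<^sub>R v) + r *\<^sub>R w) - \<phi> (x + r *\<^sub>R w)"
  let ?k' = "\<lambda>r. D ((x + s *\<^sub>R v) + r *\<^sub>R w) \<bullet> w - D (x + r *\<^sub>R w) \<bullet> w"
  have "\<exists>r. 0 < r \<and> r < s \<and> ?k s - ?k 0 = (s - 0) * ?k' r"
  proof (rule MVT2[OF s(1)])
    fix r assume r: "0 \<le> r" "r \<le> s"
    show "(?k has_real_derivative ?k' r) (at r)"
      by (intro DERIV_diff line_derivative D)
         (use small[of s r] small[of 0 r] r s in \<open>auto simp: algebra_simps\<close>)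
  qed
  then obtain r where r: "0 < r" "r < s" "?k s - ?k 0 = s * ?k' r" by auto
  let ?a = "s *\<^sub>R v + r *\<^sub>R w" and ?b = "r *\<^sub>R w"
  have na: "norm ?a \<le> s * (norm v + norm w)" and nb: "norm ?b \<le> s * (norm v + norm w)"
    using small[of s r] small[of 0 r] r by auto
  define A where "A = D (x + ?a) - D x - H *v ?a"
  define B where "B = D (x + ?b) - D x - H *v ?b"
  have A: "norm A \<le> e * (s * (norm v + norm w))"
    using H[of "x + ?a"] na s e unfolding A_def
    by (auto intro: order_trans[OF _ mult_left_mono[OF na]])
  have B: "norm B \<le> e * (s * (norm v + norm w))"
    using H[of "x + ?b"] nb s e unfolding B_def
    by (auto intro: order_trans[OF _ mult_left_mono[OF nb]])
  have "?k' r = s * (w \<bullet> (H *v v)) + (A - B) \<bullet> w"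
    by (simp add: A_def B_def inner_simps matrix_vector_right_distrib matrix_vector_mult_scaleR
        inner_commute algebra_simps)
  then have "?k s - ?k 0 - s\<^sup>2 * (w \<bullet> (H *v v)) = s * ((A - B) \<bullet> w)"
    using r(3) by (simp add: right_diff_distrib distrib_left power2_eq_square)
  moreover have "\<bar>(A - B) \<bullet> w\<bar> \<le> 2 * e * (s * (norm v + norm w)) * (norm v + norm w)"
  proof -
    have "\<bar>(A - B) \<bullet> w\<bar> \<le> norm (A - B) * norm w" by (rule Cauchy_Schwarz_ineq2)
    also have "\<dots> \<le> (norm A + norm B) * (norm v + norm w)"
      by (intro mult_mono norm_triangle_ineq4) auto
    also have "\<dots> \<le> (2 * e * (s * (norm v + norm w))) * (norm v + norm w)"
      using A B by (intro mult_right_mono) auto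
    finally show ?thesis .
  qed
  ultimately have "\<bar>?k s - ?k 0 - s\<^sup>2 * (w \<bullet> (H *v v))\<bar> \<le> s * (2 * e * (s * (norm v + norm w)) * (norm v + norm w))"
    using s by (simp add: abs_mult mult_left_mono)
  then show ?thesis by (simp add: algebra_simps power2_eq_square)
qed

text \<open>The second difference is symmetric in \<open>v\<close> and \<open>w\<close>, so both
  mixed terms approximate the same number. No continuity of second derivatives is available here,
  only their existence at \<open>x\<close>.\<close>

lemma hessian_symmetric:
  fixes \<phi> :: "real^'n \<Rightarrow> real"
  assumes D: "\<forall>\<^sub>F y in nhds x. (\<phi> has_derivative (\<lambda>v. D y \<bullet> v)) (at y)"
    and H: "(D has_derivative (\<lambda>v. H *v v)) (at x)"
  shows "transpose H = H"
proof -
  have sym: "w \<bullet> (H *v v) = v \<bullet> (H *v w)" for v w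
  proof -
    let ?c = "4 * (norm v + norm w)\<^sup>2"
    have le: "\<bar>w \<bullet> (H *v v) - v \<bullet> (H *v w)\<bar> \<le> e * ?c" if e: "e > 0" for e
    proof -
      obtain d where d: "0 < d" "\<And>y. norm (y - x) < d \<Longrightarrow> (\<phi> has_derivative (\<lambda>v. D y \<bullet> v)) (at y)"
        "\<And>y. norm (y - x) < d \<Longrightarrow> norm (D y - D x - H *v (y - x)) \<le> e * norm (y - x)"
        using gradient_expansion[OF D H e] by blast
      define s where "s = d / (2 * (norm v + norm w + 1))"
      have nn: "0 < 2 * (norm v + norm w + 1)"
 by (simp add: add_nonneg_pos)
      have s: "s > 0" using d(1) nn by (simp add: s_def)
      have "s * (2 * (norm v + norm w + 1)) = d" using nn by (simp add: s_def)
      moreover have "s * (norm v + norm w) < s * (2 * (norm v + norm w + 1))"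
        using s by (intro mult_strict_left_mono) (simp_all add: add_nonneg_pos)
      ultimately have sd: "s * (norm v + norm w) < d" by simp
      then have sd': "s * (norm w + norm v) < d" by (subst add.commute)
      let ?Q = "\<phi> (x + s *\<^sub>R v + s *\<^sub>R w) - \<phi> (x + s *\<^sub>R v) - \<phi> (x + s *\<^sub>R w) + \<phi> x"
      have 1: "\<bar>?Q - s\<^sup>2 * (w \<bullet> (H *v v))\<bar> \<le> 2 * e * s\<^sup>2 * (norm v + norm w)\<^sup>2"
        by (rule second_difference_estimate[OF d(2,3) s sd e])
      have "\<bar>\<phi> (x + s *\<^sub>R w + s *\<^sub>R v) - \<phi> (x + s *\<^sub>R w) - \<phi> (x + s *\<^sub>R v) + \<phi> x - s\<^sup>2 * (v \<bullet> (H *v w))\<bar>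
          \<le> 2 * e * s\<^sup>2 * (norm w + norm v)\<^sup>2"
        by (rule second_difference_estimate[OF d(2,3) s sd' e])
      then have 2: "\<bar>?Q - s\<^sup>2 * (v \<bullet> (H *v w))\<bar> \<le> 2 * e * s\<^sup>2 * (norm v + norm w)\<^sup>2"
        by (simp add: algebra_simps)
      have "s\<^sup>2 * \<bar>w \<bullet> (H *v v) - v \<bullet> (H *v w)\<bar> = \<bar>s\<^sup>2 * (w \<bullet> (H *v v)) - s\<^sup>2 * (v \<bullet> (H *v w))\<bar>"
        by (simp add: abs_mult right_diff_distrib[symmetric])
      also have "\<dots> \<le> 2 * (2 * e * s\<^sup>2 * (norm v + norm w)\<^sup>2)" using 1 2 by linarith
      also have "\<dots> = s\<^sup>2 * (e * ?c)" by simp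
      finally show ?thesis using s by simp
    qed
    have "\<bar>w \<bullet> (H *v v) - v \<bullet> (H *v w)\<bar> \<le> 0"
    proof (rule field_le_epsilon)
      fix e :: real assume "e > 0"
      have "\<bar>w \<bullet> (H *v v) - v \<bullet> (H *v w)\<bar> \<le> (e / (?c + 1)) * ?c"
        using \<open>e > 0\<close> by (intro le) (simp add: add_nonneg_pos)
      also have "\<dots> \<le> (e / (?c + 1)) * (?c + 1)"
        using \<open>e > 0\<close> by (intro mult_left_mono) (simp_all add: add_nonneg_nonneg)
      also have "\<dots> = e" by (simp add: add_nonneg_eq_0_iff)
      finally show "\<bar>w \<bullet> (H *v v) - v \<bullet> (H *v w)\<bar> \<le> 0 + e" by simp
    qed
    then show ?thesis by simp
  qed
  have "H $ i $ j = H $ j $ i" for i j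
    using sym[of "axis i 1" "axis j 1"]
    by (simp add: inner_axis' matrix_vector_mult_basis column_def)
  then show ?thesis by (simp add: vec_eq_iff transpose_def)
qed

lemma second_order_local_max:
  fixes \<phi> :: "real^'n \<Rightarrow> real"
  assumes D: "\<forall>\<^sub>F y in nhds x. (\<phi> has_derivative (\<lambda>v. D y \<bullet> v)) (at y)"
    and H: "(D has_derivative (\<lambda>v. H *v v)) (at x)"
    and max: "\<forall>\<^sub>F y in nhds x. \<phi> y \<le> \<phi> x"
  shows "D x = 0" and "v \<bullet> (H *v v) \<le> 0"
proof -
  obtain d0 where d0: "d0 > 0" "\<And>y. dist y x < d0 \<Longrightarrow> \<phi> y \<le> \<phi> x"
    using max unfolding eventually_nhds_metric by blast
  have "(\<phi> has_derivative (\<lambda>v. D x \<bullet> v)) (at x)" using D by (rule eventually_nhds_x_imp_x)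
  then have "(\<lambda>v. D x \<bullet> v) = (\<lambda>v. 0)"
    using d0 by (intro differential_zero_maxmin[of x "ball x d0" \<phi>]) (auto simp: dist_commute)
  then show D0: "D x = 0" by (metis inner_eq_zero_iff)
  show "v \<bullet> (H *v v) \<le> 0"
  proof (rule ccontr)
    assume "\<not> ?thesis"
    then have c: "0 < v \<bullet> (H *v v)" (is "0 < ?c") by simp
    then have v0: "norm v > 0" by auto
    \<comment> \<open>With this \<open>e\<close> the error of the gradient expansion along
      \<open>v\<close> is at most half of the main term \<open>r * ?c\<close>, so
      \<open>\<phi>\<close> would increase along \<open>v\<close>.\<close>
    define e where "e = ?c / (2 * (norm v)\<^sup>2)"
    have e: "e > 0" using c v0 by (simp add: e_def)
    obtain d where d: "0 < d" "\<And>y. norm (y - x) < d \<Longrightarrow> (\<phi> has_derivative (\<lambda>v. D y \<bullet> v)) (at y)"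
      "\<And>y. norm (y - x) < d \<Longrightarrow> norm (D y - D x - H *v (y - x)) \<le> e * norm (y - x)"
      using gradient_expansion[OF D H e] by blast
    define s where "s = min d d0 / (2 * norm v)"
    have s: "s > 0" using d d0 v0 by (simp add: s_def)
    have "s * norm v = min d d0 / 2" using v0 by (simp add: s_def)
    moreover have "0 < min d d0" using d d0 by simp
    ultimately have snv: "s * norm v < min d d0" by linarith
    have near: "norm ((x + r *\<^sub>R v) - x) < min d d0" if "0 \<le> r" "r \<le> s" for r
    proof -
      have "r * norm v \<le> s * norm v" using that by (intro mult_right_mono) auto
      then show ?thesis using snv that by simp
    qed
    have "\<exists>r. 0 < r \<and> r < s \<and> \<phi> (x + s *\<^sub>R v) - \<phi> (x + 0 *\<^sub>R v) = (s - 0) * (D (x + r *\<^sub>R v) \<bullet> v)"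
      by (rule MVT2[OF s]) (use near in \<open>auto intro!: line_derivative d(2)\<close>)
    then obtain r where r: "0 < r" "r < s" "\<phi> (x + s *\<^sub>R v) - \<phi> x = s * (D (x + r *\<^sub>R v) \<bullet> v)" by auto
    let ?E = "D (x + r *\<^sub>R v) - D x - H *v (r *\<^sub>R v)"
    have E: "norm ?E \<le> e * (r * norm v)"
      using d(3)[of "x + r *\<^sub>R v"] near[of r] r by auto
    have "\<bar>?E \<bullet> v\<bar> \<le> norm ?E * norm v" by (rule Cauchy_Schwarz_ineq2)
    also have "\<dots> \<le> e * (r * norm v) * norm v" using E by (rule mult_right_mono) simp
    also have "\<dots> = r * ?c / 2" using v0 by (simp add: e_def power2_eq_square field_simps)
    finally have "\<bar>D (x + r *\<^sub>R v) \<bullet> v - r * ?c\<bar> \<le> r * ?c / 2"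
      by (simp add: D0 inner_simps matrix_vector_mult_scaleR inner_commute)
    then have "D (x + r *\<^sub>R v) \<bullet> v \<ge> r * ?c / 2" by linarith
    then have "D (x + r *\<^sub>R v) \<bullet> v > 0" using r c by (smt (verit) mult_pos_pos half_gt_zero_iff)
    then have "\<phi> (x + s *\<^sub>R v) > \<phi> x" using r s by (smt (verit) mult_pos_pos)
    moreover have "\<phi> (x + s *\<^sub>R v) \<le> \<phi> x" using near[of s] s by (intro d0(2)) (auto simp: dist_norm)
    ultimately show False by simp
  qed
qed

lemma twice_differentiable_at_gradient:
  fixes g :: "real^'n \<Rightarrow> real"
  assumes "twice_differentiable_at g x"
  defines "D \<equiv> \<lambda>y. \<chi> i. partial_deriv i g y"
  shows "\<forall>\<^sub>F y in nhds x. (g has_derivative (\<lambda>v. D y \<bullet> v)) (at y)"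
    and "(D has_derivative (\<lambda>v. (\<chi> j i. partial_deriv i (partial_deriv j g) x) *v v)) (at x)"
proof -
  have expand: "frechet_derivative h (at y) v = (\<chi> i. partial_deriv i h y) \<bullet> v"
    if "h differentiable (at y)" for h :: "real^'n \<Rightarrow> real" and y v
  proof -
    have lin: "linear (frechet_derivative h (at y))"
      using that by (rule linear_frechet_derivative)
    have "v = (\<Sum>i\<in>UNIV. v $ i *\<^sub>R axis i 1)"
      by (simp add: basis_expansion scalar_mult_eq_scaleR[symmetric])
    then have "frechet_derivative h (at y) v = frechet_derivative h (at y) (\<Sum>i\<in>UNIV. v $ i *\<^sub>R axis i 1)"
      by simp
    also have "\<dots> = (\<Sum>i\<in>UNIV. v $ i * frechet_derivative h (at y) (axis i 1))"
      using lin by (simp add: linear_sum linear_scale)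
    finally show ?thesis by (simp add: inner_vec_def partial_deriv_def mult.commute)
  qed
  show "\<forall>\<^sub>F y in nhds x. (g has_derivative (\<lambda>v. D y \<bullet> v)) (at y)"
    using assms(1) unfolding twice_differentiable_at_def
  proof (elim conjE eventually_mono)
    fix y assume "g differentiable at y"
    then show "(g has_derivative (\<lambda>v. D y \<bullet> v)) (at y)"
      using frechet_derivative_works[of g "at y"] ext[of "frechet_derivative g (at y)", OF expand[of g y]]
      by (simp add: D_def)
  qed
  have "((\<lambda>y. D y $ j) has_derivative (\<lambda>v. ((\<chi> j i. partial_deriv i (partial_deriv j g) x) *v v) $ j)) (at x)" for j
  proof -
    have d: "partial_deriv j g differentiable (at x)"
      using assms(1) by (simp add: twice_differentiable_at_def)
    then have "(partial_deriv j g has_derivative (\<lambda>v. (\<chi> i. partial_deriv i (partial_deriv j g) x) \<bullet> v)) (at x)"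
      using frechet_derivative_works[of "partial_deriv j g" "at x"]
        ext[of "frechet_derivative (partial_deriv j g) (at x)", OF expand[of "partial_deriv j g" x]]
      by simp
    then show ?thesis
      by (simp add: D_def matrix_vector_mult_def inner_vec_def)
  qed
  then show "(D has_derivative (\<lambda>v. (\<chi> j i. partial_deriv i (partial_deriv j g) x) *v v)) (at x)"
    unfolding has_derivative_componentwise_within[of D] by (auto simp: Basis_vec_def inner_axis)
qed

text \<open>A maximum point of \<open>\<Phi> t - Q' t\<close> with \<open>Q' > Q\<close> can only be the left end point.\<close>

lemma le_of_left_dini_bound:
  fixes \<Phi> :: "real \<Rightarrow> real"
  assumes ab: "a \<le> b" and cont: "continuous_on {a..b} \<Phi>"
    and dini: "\<And>t Q'. a < t \<Longrightarrow> t \<le> b \<Longrightarrow> Q < Q' \<Longrightarrow> \<exists>s\<in>{a..<t}. \<Phi> t - \<Phi> s < Q' * (t - s)"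
  shows "\<Phi> b - \<Phi> a \<le> Q * (b - a)"
proof (rule ccontr)
  assume "\<not> ?thesis"
  then have big: "\<Phi> b - \<Phi> a > Q * (b - a)" by simp
  then have "a < b" using ab by (cases "a = b") auto
  have "Q < (\<Phi> b - \<Phi> a) / (b - a)" using big \<open>a < b\<close> by (simp add: pos_less_divide_eq)
  then obtain Q' where "Q < Q'" "Q' < (\<Phi> b - \<Phi> a) / (b - a)" using dense by blast
  then have Q': "Q < Q'" "Q' * (b - a) < \<Phi> b - \<Phi> a"
    using \<open>a < b\<close> by (auto simp: pos_less_divide_eq)
  obtain t where t: "t \<in> {a..b}" "\<And>s. s \<in> {a..b} \<Longrightarrow> \<Phi> s - Q' * s \<le> \<Phi> t - Q' * t"
    using continuous_attains_sup[of "{a..b}" "\<lambda>t. \<Phi> t - Q' * t"]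
      continuous_on_diff[OF cont continuous_on_mult_left[OF continuous_on_id, of "{a..b}" Q']] ab
    by auto
  show False
  proof (cases "t = a")
    case True
    then show False using t(2)[of b] Q' ab by (simp add: algebra_simps)
  next
    case False
    then obtain s where "s \<in> {a..<t}" "\<Phi> t - \<Phi> s < Q' * (t - s)" using dini[of t Q'] t(1) Q' by force
    then show False using t(2)[of s] t(1) by (simp add: algebra_simps)
  qed
qed

section \<open>Growth of suprema in time\<close>

text \<open>Uniform continuity on the compact product makes the supremum continuous in the
  parameter. The maximiser is the point at which derivatives are compared later.\<close>

lemma continuous_on_sup_envelope:
  fixes G :: "'a::metric_space \<Rightarrow> 'b::metric_space \<Rightarrow> real"
  assumes K: "compact K" "K \<noteq> {}" and Y: "compact Y"
    and G: "continuous_on (Y \<times> K) (\<lambda>(y, x). G y x)"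
  shows "continuous_on Y (\<lambda>y. SUP x\<in>K. G y x)"
    and "y \<in> Y \<Longrightarrow> x \<in> K \<Longrightarrow> G y x \<le> (SUP x\<in>K. G y x)"
    and "y \<in> Y \<Longrightarrow> \<exists>x\<in>K. G y x = (SUP x\<in>K. G y x) \<and> (\<forall>z\<in>K. G y z \<le> G y x)"
proof -
  have slice: "continuous_on K (G y)" if "y \<in> Y" for y
  proof -
    have "continuous_on K (\<lambda>x. (y, x))" by (intro continuous_intros)
    from continuous_on_compose2[OF G this] show ?thesis using that by auto
  qed
  have att: "\<exists>x\<in>K. \<forall>z\<in>K. G y z \<le> G y x" if "y \<in> Y" for y
    using continuous_attains_sup[OF K slice[OF that]] .
  then have bdd: "bdd_above (G y ` K)" if "y \<in> Y" for y
    using that by (meson bdd_aboveI2)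
  show up: "G y x \<le> (SUP x\<in>K. G y x)" if "y \<in> Y" "x \<in> K" for y x
    using that bdd by (intro cSUP_upper)
  show "\<exists>x\<in>K. G y x = (SUP x\<in>K. G y x) \<and> (\<forall>z\<in>K. G y z \<le> G y x)" if y: "y \<in> Y" for y
  proof -
    obtain x where x: "x \<in> K" "\<forall>z\<in>K. G y z \<le> G y x" using att[OF y] by blast
    have "(SUP x\<in>K. G y x) \<le> G y x" using x K by (intro cSUP_least) auto
    then show ?thesis using x up[OF y x(1)] by force
  qed
  have unif: "uniformly_continuous_on (Y \<times> K) (\<lambda>(y, x). G y x)"
    using K Y G by (intro compact_uniformly_continuous compact_Times)
  show "continuous_on Y (\<lambda>y. SUP x\<in>K. G y x)"
    unfolding continuous_on_iff
  proof (intro ballI allI impI)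
    fix y and e :: real assume y: "y \<in> Y" and e: "0 < e"
    obtain d where d: "d > 0" "\<And>p q. p \<in> Y \<times> K \<Longrightarrow> q \<in> Y \<times> K \<Longrightarrow> dist q p < d \<Longrightarrow>
        dist (case q of (y, x) \<Rightarrow> G y x) (case p of (y, x) \<Rightarrow> G y x) < e / 2"
      using unif e unfolding uniformly_continuous_on_def by (meson half_gt_zero)
    have le: "(SUP x\<in>K. G p x) \<le> (SUP x\<in>K. G q x) + e / 2"
      if "p \<in> Y" "q \<in> Y" "dist q p < d" for p q
    proof (rule cSUP_least[OF K(2)])
      fix x assume x: "x \<in> K"
      have "dist (G q x) (G p x) < e / 2" using d(2)[of "(p, x)" "(q, x)"] that x by (simp add: dist_Pair_Pair)
      then show "G p x \<le> (SUP x\<in>K. G q x) + e / 2"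
        using up[OF that(2) x] unfolding dist_real_def by linarith
    qed
    show "\<exists>d>0. \<forall>y'\<in>Y. dist y' y < d \<longrightarrow> dist (SUP x\<in>K. G y' x) (SUP x\<in>K. G y x) < e"
    proof (intro exI[of _ d] conjI ballI impI d(1))
      fix y' assume y': "y' \<in> Y" "dist y' y < d"
      show "dist (SUP x\<in>K. G y' x) (SUP x\<in>K. G y x) < e"
        using le[of y y'] le[of y' y] y y' e by (auto simp: dist_commute dist_real_def)
    qed
  qed
qed

lemma left_derivative_eventually:
  fixes f :: "real \<Rightarrow> real"
  assumes f: "(f has_real_derivative w) (at t within {a..t})" and w: "w < Q" and at: "a < t"
  shows "\<forall>\<^sub>F s in at_left t. f t - f s < Q * (t - s)"
proof -
  have lim: "((\<lambda>s. (f s - f t) / (s - t)) \<longlongrightarrow> w) (at_left t)"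
    using f at unfolding has_field_derivative_iff by (simp add: at_within_Icc_at_left)
  have "\<forall>\<^sub>F s in at_left t. (f s - f t) / (s - t) < Q"
    using order_tendstoD(2)[OF lim w] .
  moreover have "\<forall>\<^sub>F s in at_left t. s < t" by (simp add: eventually_at_filter)
  ultimately show ?thesis
    by eventually_elim (simp add: neg_divide_less_eq algebra_simps)
qed

lemma left_derivative_step:
  fixes f :: "real \<Rightarrow> real"
  assumes "(f has_real_derivative w) (at t within {a..t})" "w < Q" "a < t"
  shows "\<exists>s\<in>{a..<t}. f t - f s < Q * (t - s)"
proof -
  have "\<forall>\<^sub>F s in at_left t. s \<in> {a<..<t}"
    by (rule eventually_at_leftI[of a]) (use assms(3) in auto)
  then have "\<forall>\<^sub>F s in at_left t. s \<in> {a<..<t} \<and> f t - f s < Q * (t - s)"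
    using left_derivative_eventually[OF assms] by eventually_elim auto
  from eventually_happens[OF this] show ?thesis by (auto simp: trivial_limit_at_left_real)
qed

text \<open>The supremum over \<open>K\<close> grows no faster than \<open>u\<close> does at a
  maximiser: keeping that point fixed and going back in time gives a lower bound for the earlier
  supremum, so a left derivative suffices. Cutting off at 0 confines the hypothesis to positive
  maxima.\<close>

lemma parabolic_sup_growth:
  fixes u :: "real \<Rightarrow> 'a::metric_space \<Rightarrow> real"
  assumes K: "compact K" and ab: "a \<le> b"
    and cont: "continuous_on ({a..b} \<times> K) (\<lambda>(t, x). u t x)"
    and S: "0 \<le> S"
    and step: "\<And>t x. a < t \<Longrightarrow> t \<le> b \<Longrightarrow> x \<in> K \<Longrightarrow> 0 < u t x \<Longrightarrow> (\<forall>y\<in>K. u t y \<le> u t x) \<Longrightarrow>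
        \<exists>w\<le>S. ((\<lambda>s. u s x) has_real_derivative w) (at t within {a..t})"
    and init: "\<And>x. x \<in> K \<Longrightarrow> u a x \<le> c" "0 \<le> c" and x: "x \<in> K"
  shows "u b x \<le> c + S * (b - a)"
proof -
  have Kne: "K \<noteq> {}" using x by auto
  note env = continuous_on_sup_envelope[OF K Kne compact_Icc[of a b] cont]
  define \<Phi> where "\<Phi> t = max 0 (SUP x\<in>K. u t x)" for t
  have "\<Phi> b - \<Phi> a \<le> S * (b - a)"
  proof (rule le_of_left_dini_bound[OF ab])
    show "continuous_on {a..b} \<Phi>"
      unfolding \<Phi>_def by (intro continuous_intros env(1))
    fix t Q' assume t: "a < t" "t \<le> b" and Q': "S < Q'"
    show "\<exists>s\<in>{a..<t}. \<Phi> t - \<Phi> s < Q' * (t - s)"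
    proof (cases "\<Phi> t = 0")
      case True
      moreover have "0 \<le> \<Phi> a" "0 < Q' * (t - a)" using t Q' S by (auto simp: \<Phi>_def)
      ultimately show ?thesis using t by (intro bexI[of _ a]) auto
    next
      case False
      obtain x where x: "x \<in> K" "u t x = (SUP x\<in>K. u t x)" "\<forall>z\<in>K. u t z \<le> u t x"
        using env(3)[of t] t by auto
      then have pos: "0 < u t x" "\<Phi> t = u t x" using False by (auto simp: \<Phi>_def max_def split: if_splits)
      obtain w where w: "w \<le> S" "((\<lambda>s. u s x) has_real_derivative w) (at t within {a..t})"
        using step[OF t x(1) pos(1) x(3)] by blast
      obtain s where s: "s \<in> {a..<t}" "u t x - u s x < Q' * (t - s)"
        using left_derivative_step[OF w(2), of Q'] w(1) Q' t by auto
      have "u s x \<le> \<Phi> s" using env(2)[of s x] s t x by (auto simp: \<Phi>_def)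
      then show ?thesis using s pos by (intro bexI[of _ s]) auto
    qed
  qed
  moreover have "\<Phi> a \<le> c"
    unfolding \<Phi>_def using init cSUP_least[OF Kne, of "u a" c] by auto
  moreover have "u b x \<le> \<Phi> b"
    using env(2)[of b x] x ab by (auto simp: \<Phi>_def)
  ultimately show ?thesis by linarith
qed

section \<open>The Aleksandrov--Bakelman--Pucci--Krylov estimate\<close>

text \<open>Let h be the largest positive part of g(t, x) - \<xi> \<bullet> (x - x0). Its integral
  over \<Xi> is 0 at time \<open>a\<close> and at least \<eta> |\<Xi>| at time \<open>b\<close>, so
  its growth rate has to be bounded. At a fixed time, a slope with h > 0 is the gradient at a
  contact point. Either the Hessian determinant there is at most d! S^d k; such slopes have measure
  at most d! S^d J by the area formula, and h grows at rate at most S for each of them. Or the trace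
  term outweighs S and g is decreasing in time at the contact point, so such slopes contribute no
  growth.\<close>

lemma abp_slice:
  fixes g :: "real \<Rightarrow> real^'n \<Rightarrow> real" and D :: "real \<Rightarrow> real^'n \<Rightarrow> real^'n"
    and H A :: "real \<Rightarrow> real^'n \<Rightarrow> real^'n^'n" and k :: "real \<Rightarrow> real^'n \<Rightarrow> real"
  assumes K: "compact K" "x0 \<in> K" and U: "open U" "U \<subseteq> K" and \<Xi>: "compact \<Xi>" and ab: "a < b"
    and cont: "continuous_on ({a..b} \<times> K) (\<lambda>(t, x). g t x)"
    and init: "\<And>\<xi> x. \<xi> \<in> \<Xi> \<Longrightarrow> x \<in> K \<Longrightarrow> g a x \<le> \<xi> \<bullet> (x - x0)"
    and bdry: "\<And>t \<xi> x. a < t \<Longrightarrow> t \<le> b \<Longrightarrow> \<xi> \<in> \<Xi> \<Longrightarrow> x \<in> K - U \<Longrightarrow> g t x \<le> \<xi> \<bullet> (x - x0)"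
    and fin: "\<eta> \<le> g b x0" "0 \<le> \<eta>"
    and D: "\<And>t \<xi> x. a < t \<Longrightarrow> t \<le> b \<Longrightarrow> x \<in> U \<Longrightarrow> \<xi> \<in> \<Xi> \<Longrightarrow> \<xi> \<bullet> (x - x0) < g t x \<Longrightarrow>
        \<forall>\<^sub>F y in nhds x. (g t has_derivative (\<lambda>v. D t y \<bullet> v)) (at y)"
    and H: "\<And>t \<xi> x. a < t \<Longrightarrow> t \<le> b \<Longrightarrow> x \<in> U \<Longrightarrow> \<xi> \<in> \<Xi> \<Longrightarrow> \<xi> \<bullet> (x - x0) < g t x \<Longrightarrow>
        (D t has_derivative (\<lambda>v. H t x *v v)) (at x)"
    and A: "\<And>t x. a < t \<Longrightarrow> t \<le> b \<Longrightarrow> x \<in> U \<Longrightarrow> transpose (A t x) = A t x"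
      "\<And>t x v. a < t \<Longrightarrow> t \<le> b \<Longrightarrow> x \<in> U \<Longrightarrow> v \<noteq> 0 \<Longrightarrow> 0 < v \<bullet> (A t x *v v)"
    and eqn: "\<And>t \<xi> x. a < t \<Longrightarrow> t \<le> b \<Longrightarrow> x \<in> U \<Longrightarrow> \<xi> \<in> \<Xi> \<Longrightarrow> \<xi> \<bullet> (x - x0) < g t x \<Longrightarrow>
        \<exists>w\<le>trace (A t x ** H t x) + S. ((\<lambda>s. g s x) has_real_derivative w) (at t within {a..t})"
    and k: "\<And>t \<xi> x. a < t \<Longrightarrow> t \<le> b \<Longrightarrow> x \<in> U \<Longrightarrow> \<xi> \<in> \<Xi> \<Longrightarrow> \<xi> \<bullet> (x - x0) < g t x \<Longrightarrow>
        1 \<le> k t x * det (A t x)"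
      "\<And>t. a < t \<Longrightarrow> t \<le> b \<Longrightarrow> k t \<in> borel_measurable borel" "\<And>t x. 0 \<le> k t x"
      "\<And>t. a < t \<Longrightarrow> t \<le> b \<Longrightarrow> (\<integral>\<^sup>+x. k t x \<partial>lborel) \<le> ennreal J"
    and S: "0 < S" and J: "0 \<le> J"
  shows "\<eta> * measure lebesgue \<Xi> \<le> (b - a) * (fact CARD('n) * S ^ (CARD('n) + 1) * J)"
proof -
  let ?d = "CARD('n)"
  define u where "u \<xi> t x = g t x - \<xi> \<bullet> (x - x0)" for \<xi> t x
  define h where "h t \<xi> = max 0 (SUP x\<in>K. u \<xi> t x)" for t \<xi>
  define V where "V = measure lebesgue \<Xi>"
  have Kne: "K \<noteq> {}" using K by auto
  have cont3: "continuous_on (({a..b} \<times> \<Xi>) \<times> K) (\<lambda>(p, x). u (snd p) (fst p) x)"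
  proof -
    have "continuous_on (({a..b} \<times> \<Xi>) \<times> K) (\<lambda>q. (fst (fst q), snd q))"
      by (intro continuous_intros)
    then have "continuous_on (({a..b} \<times> \<Xi>) \<times> K) (\<lambda>q. g (fst (fst q)) (snd q))"
      by (rule continuous_on_compose2[OF cont, where f = "\<lambda>q. (fst (fst q), snd q)", simplified case_prod_conv]) auto
    then show ?thesis unfolding u_def case_prod_unfold by (intro continuous_intros)
  qed
  note env = continuous_on_sup_envelope[OF K(1) Kne compact_Times[OF compact_Icc[of a b] \<Xi>] cont3]
  have h_cont: "continuous_on ({a..b} \<times> \<Xi>) (\<lambda>p. h (fst p) (snd p))"
    unfolding h_def by (intro continuous_intros env(1))
  have h_ge: "u \<xi> t x \<le> h t \<xi>" if "t \<in> {a..b}" "\<xi> \<in> \<Xi>" "x \<in> K" for t \<xi> x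
    using env(2)[of "(t, \<xi>)" x] that by (auto simp: h_def)
  have h_att: "\<exists>x\<in>U. u \<xi> t x = h t \<xi> \<and> (\<forall>y\<in>K. u \<xi> t y \<le> u \<xi> t x)"
    if t: "a < t" "t \<le> b" "\<xi> \<in> \<Xi>" "0 < h t \<xi>" for t \<xi>
  proof -
    obtain x where x: "x \<in> K" "u \<xi> t x = (SUP x\<in>K. u \<xi> t x)" "\<forall>y\<in>K. u \<xi> t y \<le> u \<xi> t x"
      using env(3)[of "(t, \<xi>)"] t by auto
    then have eq: "u \<xi> t x = h t \<xi>" using t(4) by (auto simp: h_def max_def split: if_splits)
    moreover have "x \<in> U" using bdry[OF t(1-3), of x] x(1) eq t(4) by (auto simp: u_def)
    ultimately show ?thesis using x(3) by blast
  qed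
  have crit: "D t x = \<xi>" "transpose (H t x) = H t x" "\<And>v. v \<bullet> (H t x *v v) \<le> 0"
    "trace (A t x ** H t x) \<le> 0"
    "S < trace (A t x ** - H t x) \<or> \<bar>det (H t x)\<bar> \<le> fact ?d * S ^ ?d * k t x"
    if t: "a < t" "t \<le> b" "\<xi> \<in> \<Xi>" "x \<in> U" "0 < u \<xi> t x" "\<forall>y\<in>K. u \<xi> t y \<le> u \<xi> t x" for t \<xi> x
  proof -
    have pos: "\<xi> \<bullet> (x - x0) < g t x" using t(5) by (simp add: u_def)
    have D1: "\<forall>\<^sub>F y in nhds x. (u \<xi> t has_derivative (\<lambda>v. (D t y - \<xi>) \<bullet> v)) (at y)"
      using D[OF t(1,2,4,3) pos]
    proof eventually_elim
      case (elim y)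
      have "((\<lambda>x. \<xi> \<bullet> (x - x0)) has_derivative (\<lambda>v. \<xi> \<bullet> v)) (at y)"
        by (auto intro!: derivative_eq_intros)
      from has_derivative_diff[OF elim this] show ?case
        by (simp add: u_def[abs_def] inner_diff_left)
    qed
    have H1: "((\<lambda>y. D t y - \<xi>) has_derivative (\<lambda>v. H t x *v v)) (at x)"
      using has_derivative_diff[OF H[OF t(1,2,4,3) pos] has_derivative_const] by simp
    have mx: "\<forall>\<^sub>F y in nhds x. u \<xi> t y \<le> u \<xi> t x"
      using eventually_nhds_in_open[OF U(1) t(4)] by eventually_elim (use t(6) U(2) in auto)
    show "D t x = \<xi>" using second_order_local_max(1)[OF D1 H1 mx] by simp
    show sym: "transpose (H t x) = H t x" by (rule hessian_symmetric[OF D1 H1])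
    show neg: "\<And>v. v \<bullet> (H t x *v v) \<le> 0" by (rule second_order_local_max(2)[OF D1 H1 mx])
    have psd: "0 \<le> v \<bullet> ((- H t x) *v v)" for v
      using neg[of v] by (simp add: matrix_vector_mult_def inner_vec_def sum_negf)
    have negtr: "trace (A t x ** - H t x) = - trace (A t x ** H t x)"
      by (simp add: trace_def matrix_matrix_mult_def sum_negf)
    have tr: "0 \<le> trace (A t x ** - H t x)"
      by (rule trace_pos_def_mult_nonneg[OF A[OF t(1,2,4)] psd])
    then show "trace (A t x ** H t x) \<le> 0" using negtr by simp
    \<comment> \<open>If the trace is at most \<open>S\<close>, the determinant-trace inequality
      bounds \<open>det A * det H\<close>, and \<open>1 \<le> k * det A\<close> removes the factor
      \<open>det A\<close>.\<close>
    show "S < trace (A t x ** - H t x) \<or> \<bar>det (H t x)\<bar> \<le> fact ?d * S ^ ?d * k t x"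
    proof (rule disjCI)
      assume "\<not> \<bar>det (H t x)\<bar> \<le> fact ?d * S ^ ?d * k t x"
      show "S < trace (A t x ** - H t x)"
      proof (rule ccontr)
        assume "\<not> S < trace (A t x ** - H t x)"
        then have le: "trace (A t x ** - H t x) ^ ?d \<le> S ^ ?d" using tr by (intro power_mono) auto
        have "transpose (- H t x) = - H t x"
          using sym by (simp add: transpose_def vec_eq_iff)
        then have "\<bar>det (A t x) * det (- H t x)\<bar> \<le> fact ?d * trace (A t x ** - H t x) ^ ?d"
          by (intro det_mult_le_trace_power A[OF t(1,2,4)] psd)
        also have "\<dots> \<le> fact ?d * S ^ ?d" using le by simp
        finally have 1: "\<bar>det (A t x)\<bar> * \<bar>det (- H t x)\<bar> \<le> fact ?d * S ^ ?d" by (simp add: abs_mult)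
        have "det (- H t x) = (- 1) ^ ?d * det (H t x)"
          by (simp add: det_def prod_uminus sum_distrib_left mult_ac)
        then have 2: "\<bar>det (- H t x)\<bar> = \<bar>det (H t x)\<bar>" by (simp add: abs_mult power_abs)
        have "1 \<le> k t x * \<bar>det (A t x)\<bar>"
          using k(1)[OF t(1,2,4,3) pos] k(3)[of t x] by (smt (verit) mult_left_mono abs_ge_self)
        then have "\<bar>det (H t x)\<bar> \<le> (k t x * \<bar>det (A t x)\<bar>) * \<bar>det (H t x)\<bar>"
          using mult_right_mono[of 1 _ "\<bar>det (H t x)\<bar>"] by simp
        also have "\<dots> = k t x * (\<bar>det (A t x)\<bar> * \<bar>det (H t x)\<bar>)" by simp
        also have "\<dots> \<le> k t x * (fact ?d * S ^ ?d)"
          using 1 2 k(3) by (intro mult_left_mono) auto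
        finally show False using \<open>\<not> \<bar>det (H t x)\<bar> \<le> fact ?d * S ^ ?d * k t x\<close> by (simp add: mult_ac)
      qed
    qed
  qed
  \<comment> \<open>This one-sided Lipschitz bound makes the functions \<open>q\<close> below
    nonnegative, as Fatou's lemma requires.\<close>
  have lip: "h t \<xi> \<le> h s \<xi> + S * (t - s)" if st: "a \<le> s" "s \<le> t" "t \<le> b" "\<xi> \<in> \<Xi>" for s t \<xi>
  proof -
    have "u \<xi> t x \<le> h s \<xi> + S * (t - s)" if "x \<in> K" for x
    proof (rule parabolic_sup_growth[OF K(1) st(2), where u = "u \<xi>"])
      have "continuous_on ({s..t} \<times> K) (\<lambda>q. g (fst q) (snd q))"
        using cont st by (auto simp: case_prod_unfold intro: continuous_on_subset)
      then show "continuous_on ({s..t} \<times> K) (\<lambda>(t, x). u \<xi> t x)"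
        unfolding u_def case_prod_unfold by (intro continuous_intros)
      fix r x assume r: "s < r" "r \<le> t" and x: "x \<in> K" "0 < u \<xi> r x" "\<forall>y\<in>K. u \<xi> r y \<le> u \<xi> r x"
      have ar: "a < r" "r \<le> b" using r st by auto
      have "x \<in> U" using bdry[OF ar st(4), of x] x by (auto simp: u_def)
      note x = this x(2,3)
      obtain w where w: "w \<le> trace (A r x ** H r x) + S"
        "((\<lambda>s. g s x) has_real_derivative w) (at r within {a..r})"
        using eqn[OF ar x(1) st(4)] x(2) by (auto simp: u_def)
      have "((\<lambda>s. u \<xi> s x) has_real_derivative w) (at r within {s..r})"
        unfolding u_def using DERIV_subset[OF w(2), of "{s..r}"] st by (auto intro!: derivative_eq_intros)
      then show "\<exists>w\<le>S. ((\<lambda>s. u \<xi> s x) has_real_derivative w) (at r within {s..r})"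
        using w(1) crit(4)[OF ar st(4) x] by (intro exI[of _ w]) auto
    qed (use S that st h_ge[of s \<xi>] in \<open>auto simp: h_def\<close>)
    then have "(SUP x\<in>K. u \<xi> t x) \<le> h s \<xi> + S * (t - s)" by (intro cSUP_least Kne)
    moreover have "0 \<le> h s \<xi> + S * (t - s)" using S st by (simp add: h_def)
    ultimately show ?thesis by (simp add: h_def)
  qed
  have \<Xi>L: "\<Xi> \<in> lmeasurable" using \<Xi> by (rule lmeasurable_compact)
  define I where "I t = (LINT \<xi>|lborel. indicat_real \<Xi> \<xi> *\<^sub>R h t \<xi>)" for t
  have slice: "continuous_on \<Xi> (h t)" if "t \<in> {a..b}" for t
  proof -
    have "continuous_on \<Xi> (\<lambda>\<xi>. (t, \<xi>))" by (intro continuous_intros)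
    moreover have "(\<lambda>\<xi>. (t, \<xi>)) ` \<Xi> \<subseteq> {a..b} \<times> \<Xi>" using that by auto
    ultimately show ?thesis using continuous_on_compose2[OF h_cont] by fastforce
  qed
  have int: "integrable lborel (\<lambda>\<xi>. indicat_real \<Xi> \<xi> *\<^sub>R f \<xi>)" if "continuous_on \<Xi> f" for f :: "_ \<Rightarrow> real"
    using that by (rule borel_integrable_compact[OF \<Xi>])
  have int_const: "(LINT \<xi>|lborel. indicat_real \<Xi> \<xi> *\<^sub>R c) = c * V" for c :: real
    using \<Xi> by (simp add: V_def borel_compact)
  have I_cont: "continuous_on {a..b} I"
    unfolding continuous_on_iff
  proof (intro ballI allI impI)
    fix t and e :: real assume t: "t \<in> {a..b}" and e: "0 < e"
    have V0: "0 \<le> V" by (simp add: V_def)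
    define e' where "e' = e / (V + 1)"
    have e': "0 < e'" using e V0 by (simp add: e'_def)
    have "uniformly_continuous_on ({a..b} \<times> \<Xi>) (\<lambda>p. h (fst p) (snd p))"
      by (intro compact_uniformly_continuous h_cont compact_Times \<Xi> compact_Icc)
    then obtain d where d: "d > 0" "\<And>p q. p \<in> {a..b} \<times> \<Xi> \<Longrightarrow> q \<in> {a..b} \<times> \<Xi> \<Longrightarrow> dist q p < d \<Longrightarrow>
        dist (h (fst q) (snd q)) (h (fst p) (snd p)) < e'"
      using e' unfolding uniformly_continuous_on_def by meson
    show "\<exists>d>0. \<forall>s\<in>{a..b}. dist s t < d \<longrightarrow> dist (I s) (I t) < e"
    proof (intro exI[of _ d] conjI ballI impI d(1))
      fix s assume s: "s \<in> {a..b}" "dist s t < d"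
      have close: "\<bar>h s \<xi> - h t \<xi>\<bar> \<le> e'" if "\<xi> \<in> \<Xi>" for \<xi>
        using d(2)[of "(t, \<xi>)" "(s, \<xi>)"] s t that by (simp add: dist_Pair_Pair dist_real_def less_imp_le)
      have "I s - I t = (LINT \<xi>|lborel. indicat_real \<Xi> \<xi> *\<^sub>R h s \<xi> - indicat_real \<Xi> \<xi> *\<^sub>R h t \<xi>)"
        unfolding I_def using s t by (intro Bochner_Integration.integral_diff[symmetric] int slice)
      also have "\<dots> = (LINT \<xi>|lborel. indicat_real \<Xi> \<xi> *\<^sub>R (h s \<xi> - h t \<xi>))"
        by (simp add: algebra_simps)
      finally have "\<bar>I s - I t\<bar> \<le> (LINT \<xi>|lborel. \<bar>indicat_real \<Xi> \<xi> *\<^sub>R (h s \<xi> - h t \<xi>)\<bar>)"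
        by (simp add: integral_abs_bound)
      also have "\<dots> \<le> (LINT \<xi>|lborel. indicat_real \<Xi> \<xi> *\<^sub>R e')"
        using close s t
        by (intro integral_mono integrable_abs int continuous_intros slice) (auto simp: indicator_def)
      also have "\<dots> = e' * V" by (rule int_const)
      also have "\<dots> < e" using e V0 by (simp add: e'_def field_simps)
      finally show "dist (I s) (I t) < e" by (simp add: dist_real_def)
    qed
  qed
  define J0 where "J0 = fact ?d * S ^ ?d * J"
  have J0: "0 \<le> J0" using S J by (simp add: J0_def)
  have "I b - I a \<le> (S * J0) * (b - a)"
  proof (rule le_of_left_dini_bound[OF less_imp_le[OF ab] I_cont], rule ccontr)
    fix t Q assume t: "a < t" "t \<le> b" and Q: "S * J0 < Q"
    assume "\<not> (\<exists>s\<in>{a..<t}. I t - I s < Q * (t - s))"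
    then have contra: "Q * (t - s) \<le> I t - I s" if "a \<le> s" "s < t" for s using that by force
    define s where "s n = t - (t - a) / real (Suc n)" for n
    have s: "a \<le> s n" "s n < t" "s n \<in> {a..b}" for n
    proof -
      have "(t - a) / real (Suc n) \<le> t - a"
        using frac_le[of "t - a" "t - a" 1 "real (Suc n)"] t by simp
      then show "a \<le> s n" by (simp add: s_def)
      show "s n < t" using t by (simp add: s_def)
      then show "s n \<in> {a..b}" using \<open>a \<le> s n\<close> t by simp
    qed
    have s_lim: "filterlim s (at_left t) sequentially"
    proof -
      have "s \<longlonglongrightarrow> t - (t - a) * 0"
        unfolding s_def divide_inverse by (intro tendsto_intros LIMSEQ_inverse_real_of_nat)
      then show ?thesis by (simp add: filterlim_at less_imp_neq[OF s(2)] s(2))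
    qed
    have tab: "t \<in> {a..b}" using t by simp
    define C where "C = {x \<in> K. \<exists>\<xi>\<in>\<Xi>. (\<forall>y\<in>K. u \<xi> t y \<le> u \<xi> t x) \<and> 0 < u \<xi> t x}"
    have C: "C \<in> sets lebesgue"
    proof -
      \<comment> \<open>The strict condition \<open>0 < u\<close> is not closed. Requiring height at
        least 1 / (n + 1) gives compact sets, so \<open>C\<close> is a countable union of compact
        projections and hence Borel.\<close>
      define Cn where "Cn n = {p \<in> K \<times> \<Xi>. max (h t (snd p)) (1 / real (Suc n)) \<le> u (snd p) t (fst p)}" for n
      have "continuous_on (K \<times> \<Xi>) (\<lambda>p. g t (fst p))"
      proof -
        have "continuous_on (K \<times> \<Xi>) (\<lambda>p. (t, fst p))" by (intro continuous_intros)
        moreover have "(\<lambda>p. (t, fst p)) ` (K \<times> \<Xi>) \<subseteq> {a..b} \<times> K" using tab by auto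
        ultimately show ?thesis using continuous_on_compose2[OF cont] by fastforce
      qed
      then have 1: "continuous_on (K \<times> \<Xi>) (\<lambda>p. u (snd p) t (fst p))"
        unfolding u_def by (intro continuous_intros)
      have 2: "continuous_on (K \<times> \<Xi>) (\<lambda>p. max (h t (snd p)) (1 / real (Suc n)))" for n
        by (intro continuous_on_max continuous_on_const continuous_on_compose2[OF slice[OF tab]])
           (auto intro!: continuous_intros)
      have "compact (Cn n)" for n
      proof -
        have "closed (Cn n)" unfolding Cn_def
          by (rule continuous_on_closed_Collect_le[OF 2 1]) (intro compact_imp_closed compact_Times K(1) \<Xi>)
        moreover have "Cn n \<subseteq> K \<times> \<Xi>" by (auto simp: Cn_def)
        ultimately show ?thesis using compact_Times[OF K(1) \<Xi>]
          by (metis compact_Int_closed inf.absorb_iff2)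
      qed
      then have "compact (fst ` Cn n)" for n
        by (intro compact_continuous_image) (auto intro!: continuous_intros)
      then have "(\<Union>n. fst ` Cn n) \<in> sets borel"
        by (intro sets.countable_UN) (auto intro!: borel_compact)
      moreover have "C = (\<Union>n. fst ` Cn n)"
      proof (intro equalityI subsetI)
        fix x assume "x \<in> C"
        then obtain \<xi> where x: "x \<in> K" "\<xi> \<in> \<Xi>" "\<forall>y\<in>K. u \<xi> t y \<le> u \<xi> t x" "0 < u \<xi> t x"
          by (auto simp: C_def)
        obtain n where "inverse (real (Suc n)) < u \<xi> t x" using reals_Archimedean[OF x(4)] by blast
        moreover have "h t \<xi> \<le> u \<xi> t x"
          unfolding h_def using x cSUP_least[OF Kne, of "u \<xi> t" "u \<xi> t x"] by auto
        ultimately have "(x, \<xi>) \<in> Cn n" using x by (auto simp: Cn_def inverse_eq_divide)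
        then show "x \<in> (\<Union>n. fst ` Cn n)" by force
      next
        fix x assume "x \<in> (\<Union>n. fst ` Cn n)"
        then obtain n \<xi> where x: "x \<in> K" "\<xi> \<in> \<Xi>" "h t \<xi> \<le> u \<xi> t x" "1 / real (Suc n) \<le> u \<xi> t x"
          by (auto simp: Cn_def)
        have "0 < 1 / real (Suc n)" by simp
        then have "0 < u \<xi> t x" using x(4) by linarith
        moreover have "\<forall>y\<in>K. u \<xi> t y \<le> u \<xi> t x" using h_ge[OF tab x(2)] x(3) by force
        ultimately show "x \<in> C" using x by (auto simp: C_def)
      qed
      ultimately show ?thesis by simp
    qed
    have CU: "x \<in> U \<and> 0 < u \<xi> t x \<and> (\<forall>y\<in>K. u \<xi> t y \<le> u \<xi> t x)"
      if "x \<in> K" "\<xi> \<in> \<Xi>" "\<forall>y\<in>K. u \<xi> t y \<le> u \<xi> t x" "0 < u \<xi> t x" for x \<xi>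
      using bdry[OF t that(2), of x] that by (auto simp: u_def)
    define B where "B = {x \<in> C. \<bar>det (matrix (\<lambda>v. H t x *v v))\<bar> \<le> fact ?d * S ^ ?d * k t x}"
    have N: "D t ` B \<in> lmeasurable \<and> measure lebesgue (D t ` B) \<le> J0"
      unfolding B_def
    proof (rule measure_image_sublevel_jacobian[OF C])
      fix x assume "x \<in> C"
      then obtain \<xi> where x: "x \<in> U" "\<xi> \<in> \<Xi>" "0 < u \<xi> t x" using CU by (auto simp: C_def)
      then have "(D t has_derivative (\<lambda>v. H t x *v v)) (at x)"
        by (intro H[OF t x(1,2)]) (simp add: u_def)
      then show "(D t has_derivative (\<lambda>v. H t x *v v)) (at x within C)"
        by (rule has_derivative_at_withinI)
    next
      show "(\<lambda>x. fact ?d * S ^ ?d * k t x) \<in> borel_measurable borel" using k(2)[OF t] by measurable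
      have c0: "(0::real) \<le> fact ?d * S ^ ?d" using S by simp
      have "(\<integral>\<^sup>+x. ennreal (fact ?d * S ^ ?d * k t x) \<partial>lborel) = ennreal (fact ?d * S ^ ?d) * (\<integral>\<^sup>+x. k t x \<partial>lborel)"
        using k(2)[OF t] k(3) c0 by (simp add: ennreal_mult nn_integral_cmult)
      also have "\<dots> \<le> ennreal (fact ?d * S ^ ?d) * ennreal J" by (intro mult_left_mono k(4)[OF t]) simp
      also have "\<dots> = ennreal J0" using c0 J by (simp add: J0_def ennreal_mult)
      finally show "(\<integral>\<^sup>+x. ennreal (fact ?d * S ^ ?d * k t x) \<partial>lborel) \<le> ennreal J0" .
    qed (use S k(3) J0 in auto)
    \<comment> \<open>\<open>S\<close> minus the difference quotient of h. The lower limit of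
      \<open>q\<close> is at least \<open>S\<close> off the image of \<open>B\<close>, while
      \<open>contra\<close> bounds the integrals of \<open>q\<close> by \<open>S * V - Q\<close>; as
      the image has measure at most \<open>J0\<close>, this is incompatible with
      \<open>S * J0 < Q\<close>.\<close>
    define q where "q n \<xi> = indicat_real \<Xi> \<xi> *\<^sub>R (S - (h t \<xi> - h (s n) \<xi>) / (t - s n))" for n \<xi>
    have q0: "0 \<le> q n \<xi>" for n \<xi>
      using lip[OF s(1) less_imp_le[OF s(2)] t(2), of \<xi> n] s(2)[of n]
      by (auto simp: q_def indicator_def field_simps)
    have q_cont: "continuous_on \<Xi> (\<lambda>\<xi>. S - (h t \<xi> - h (s n) \<xi>) / (t - s n))" for n
      using s(2)[of n] by (intro continuous_intros slice[OF tab] slice[OF s(3)]) auto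
    have q_int: "integrable lborel (q n)" for n
      unfolding q_def by (rule int[OF q_cont])
    have q_le: "(LINT \<xi>|lborel. q n \<xi>) \<le> S * V - Q" for n
    proof -
      note i1 = int[OF slice[OF tab]] and i2 = int[OF slice[OF s(3)[of n]]]
      have "(LINT \<xi>|lborel. q n \<xi>) = (LINT \<xi>|lborel. indicat_real \<Xi> \<xi> *\<^sub>R S
          - (indicat_real \<Xi> \<xi> *\<^sub>R h t \<xi> - indicat_real \<Xi> \<xi> *\<^sub>R h (s n) \<xi>) / (t - s n))"
        by (intro Bochner_Integration.integral_cong) (auto simp: q_def indicator_def)
      also have "\<dots> = (LINT \<xi>|lborel. indicat_real \<Xi> \<xi> *\<^sub>R S)
          - (LINT \<xi>|lborel. (indicat_real \<Xi> \<xi> *\<^sub>R h t \<xi> - indicat_real \<Xi> \<xi> *\<^sub>R h (s n) \<xi>) / (t - s n))"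
        by (rule Bochner_Integration.integral_diff[OF int[OF continuous_on_const]
              integrable_divide[OF Bochner_Integration.integrable_diff[OF i1 i2]]])
      also have "\<dots> = S * V - (I t - I (s n)) / (t - s n)"
        unfolding I_def int_const integral_divide_zero Bochner_Integration.integral_diff[OF i1 i2] ..
      also have "\<dots> \<le> S * V - Q"
        using contra[OF s(1,2), of n] s(2)[of n] by (simp add: pos_le_divide_eq)
      finally show ?thesis .
    qed
    have SVQ: "0 \<le> S * V - Q"
      using q_le[of 0] Bochner_Integration.integral_nonneg[of lborel "q 0"] q0 by fastforce
    have lower: "ennreal S * indicator (\<Xi> - D t ` B) \<xi> \<le> liminf (\<lambda>n. ennreal (q n \<xi>))" for \<xi>
    proof (cases "\<xi> \<in> \<Xi> - D t ` B")
      case True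
      have "\<forall>\<^sub>F n in sequentially. S \<le> q n \<xi>"
      proof (cases "0 < h t \<xi>")
        case False
        then have "h t \<xi> = 0" by (simp add: h_def)
        moreover have "0 \<le> h (s n) \<xi>" for n by (simp add: h_def)
        ultimately show ?thesis using True s(2) by (simp add: q_def divide_nonneg_pos)
      next
        case pos: True
        have \<xi>: "\<xi> \<in> \<Xi>" using True by simp
        obtain x where x: "x \<in> U" "u \<xi> t x = h t \<xi>" "\<forall>y\<in>K. u \<xi> t y \<le> u \<xi> t x"
          using h_att[OF t \<xi> pos] by blast
        have ux: "0 < u \<xi> t x" using x pos by simp
        note cr = crit[OF t \<xi> x(1) ux x(3)]
        have "x \<in> C" using x(1,3) ux \<xi> U by (auto simp: C_def)
        moreover have "x \<notin> B" using True cr(1) by auto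
        ultimately have "\<not> \<bar>det (H t x)\<bar> \<le> fact ?d * S ^ ?d * k t x" by (simp add: B_def)
        then have "S < trace (A t x ** - H t x)" using cr(5) by simp
        moreover have "trace (A t x ** - H t x) = - trace (A t x ** H t x)"
          by (simp add: trace_def matrix_matrix_mult_def sum_negf)
        moreover obtain w where w: "w \<le> trace (A t x ** H t x) + S"
          "((\<lambda>s. g s x) has_real_derivative w) (at t within {a..t})"
          using eqn[OF t x(1) \<xi>] ux by (auto simp: u_def)
        ultimately have "w < 0" by linarith
        have "\<forall>\<^sub>F r in at_left t. g t x - g r x < 0 * (t - r)"
          by (rule left_derivative_eventually[OF w(2) \<open>w < 0\<close> t(1)])
        then have "\<forall>\<^sub>F n in sequentially. g t x - g (s n) x < 0 * (t - s n)"
          using s_lim by (rule eventually_compose_filterlim)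
        then show ?thesis
        proof eventually_elim
          case (elim n)
          have "u \<xi> (s n) x \<le> h (s n) \<xi>" using h_ge[OF s(3) \<xi>] x(1) U by auto
          then have "h t \<xi> - h (s n) \<xi> \<le> 0" using elim x(2) by (simp add: u_def)
          then have "(h t \<xi> - h (s n) \<xi>) / (t - s n) \<le> 0" using s(2)[of n] by (simp add: divide_nonpos_pos)
          then show ?case using \<xi> by (simp add: q_def)
        qed
      qed
      then have "\<forall>\<^sub>F n in sequentially. ennreal S \<le> ennreal (q n \<xi>)"
        by eventually_elim (rule ennreal_leI)
      then have "ennreal S \<le> liminf (\<lambda>n. ennreal (q n \<xi>))" by (rule Liminf_bounded)
      then show ?thesis using True by simp
    qed simp
    have XN: "\<Xi> - D t ` B \<in> lmeasurable" using \<Xi>L N by (intro fmeasurable.Diff) auto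
    have "ennreal (S * measure lebesgue (\<Xi> - D t ` B)) = ennreal S * emeasure lebesgue (\<Xi> - D t ` B)"
      using XN S by (simp add: emeasure_eq_measure2 ennreal_mult)
    also have "\<dots> = (\<integral>\<^sup>+\<xi>. ennreal S * indicator (\<Xi> - D t ` B) \<xi> \<partial>lebesgue)"
      using XN by (simp add: nn_integral_cmult_indicator fmeasurableD)
    also have "\<dots> \<le> (\<integral>\<^sup>+\<xi>. liminf (\<lambda>n. ennreal (q n \<xi>)) \<partial>lebesgue)"
      by (intro nn_integral_mono lower)
    also have "\<dots> = (\<integral>\<^sup>+\<xi>. liminf (\<lambda>n. ennreal (q n \<xi>)) \<partial>lborel)"
      by (rule nn_integral_completion)
    also have "\<dots> \<le> liminf (\<lambda>n. \<integral>\<^sup>+\<xi>. ennreal (q n \<xi>) \<partial>lborel)"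
      using q_int by (intro nn_integral_liminf) (auto dest: borel_measurable_integrable)
    also have "\<dots> \<le> ennreal (S * V - Q)"
    proof (rule Liminf_le)
      show "\<forall>\<^sub>F n in sequentially. (\<integral>\<^sup>+\<xi>. ennreal (q n \<xi>) \<partial>lborel) \<le> ennreal (S * V - Q)"
        using q_le by (intro always_eventually allI) (simp add: nn_integral_eq_integral[OF q_int] q0 ennreal_leI)
    qed simp
    finally have "S * measure lebesgue (\<Xi> - D t ` B) \<le> S * V - Q" using SVQ by simp
    moreover have "V \<le> measure lebesgue (\<Xi> - D t ` B) + J0"
    proof -
      have "V \<le> measure lebesgue ((\<Xi> - D t ` B) \<union> D t ` B)"
        unfolding V_def using \<Xi>L N XN by (intro measure_mono_fmeasurable) (auto simp: fmeasurableD)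
      also have "\<dots> \<le> measure lebesgue (\<Xi> - D t ` B) + measure lebesgue (D t ` B)"
        using N XN by (intro measure_Un_le) (auto simp: fmeasurableD)
      finally show ?thesis using N by simp
    qed
    then have "S * V \<le> S * measure lebesgue (\<Xi> - D t ` B) + S * J0"
      using S by (simp flip: distrib_left)
    ultimately show False using Q by linarith
  qed
  moreover have "I a = 0"
  proof -
    have "h a \<xi> = 0" if "\<xi> \<in> \<Xi>" for \<xi>
      unfolding h_def using cSUP_least[OF Kne, of "u \<xi> a" 0] init[OF that] by (auto simp: u_def)
    then have "I a = (LINT \<xi>|(lborel :: (real^'n) measure). 0)"
      unfolding I_def by (intro Bochner_Integration.integral_cong) (auto simp: indicator_def)
    then show ?thesis by simp
  qed
  moreover have "\<eta> * V \<le> I b"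
  proof -
    have "\<eta> * V = (LINT \<xi>|lborel. indicat_real \<Xi> \<xi> *\<^sub>R \<eta>)" by (rule int_const[symmetric])
    also have "\<dots> \<le> I b" unfolding I_def
    proof (intro integral_mono int slice continuous_intros)
      fix \<xi>
      show "indicat_real \<Xi> \<xi> *\<^sub>R \<eta> \<le> indicat_real \<Xi> \<xi> *\<^sub>R h b \<xi>"
        using h_ge[of b \<xi> x0] fin K(2) ab by (auto simp: indicator_def u_def)
    qed (use ab in auto)
    finally show ?thesis .
  qed
  ultimately have "\<eta> * V \<le> (S * J0) * (b - a)" by simp
  then show ?thesis by (simp add: V_def J0_def mult_ac)
qed

section \<open>The equation\<close>

text \<open>The area formula bounds images from above only, so it is applied to the inverse map,
  which carries the image back onto the ball.\<close>

lemma measure_transpose_image_ge: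
  fixes P :: "real^'n^'n"
  assumes P: "det P \<noteq> 0" and r: "0 \<le> r"
  shows "unit_ball_vol (real CARD('n)) * r ^ CARD('n) * \<bar>det P\<bar>
    \<le> measure lebesgue ((\<lambda>v. transpose P *v v) ` cball 0 r)"
proof -
  define \<Xi> where "\<Xi> = (\<lambda>v. transpose P *v v) ` cball 0 r"
  have comp: "compact \<Xi>" unfolding \<Xi>_def
    by (intro compact_continuous_image matrix_vector_mult_linear_continuous_on) simp
  have "invertible (transpose P)" using P by (simp add: invertible_det_nz det_transpose)
  then obtain Q where Q: "Q ** transpose P = mat 1" by (auto simp: invertible_def)
  have detQ: "\<bar>det Q\<bar> * \<bar>det P\<bar> = 1"
  proof -
    have "det Q * det P = 1" using arg_cong[OF Q, of det] by (simp add: det_mul det_transpose)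
    then show ?thesis by (metis abs_mult abs_one)
  qed
  define k where "k x = \<bar>det Q\<bar> * indicat_real \<Xi> x" for x
  have "(\<lambda>v. Q *v v) ` {x \<in> \<Xi>. \<bar>det (matrix (\<lambda>v. Q *v v))\<bar> \<le> k x} \<in> lmeasurable \<and>
      measure lebesgue ((\<lambda>v. Q *v v) ` {x \<in> \<Xi>. \<bar>det (matrix (\<lambda>v. Q *v v))\<bar> \<le> k x})
        \<le> \<bar>det Q\<bar> * measure lebesgue \<Xi>"
  proof (rule measure_image_sublevel_jacobian)
    show "\<Xi> \<in> sets lebesgue" using comp by (simp add: borel_compact)
    show "((\<lambda>v. Q *v v) has_derivative (\<lambda>v. Q *v v)) (at x within \<Xi>)" for x
      by (intro bounded_linear_imp_has_derivative matrix_vector_mul_bounded_linear)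
    show "k \<in> borel_measurable borel" unfolding k_def using borel_compact[OF comp]
      by (intro borel_measurable_times borel_measurable_const borel_measurable_indicator)
    have "(\<integral>\<^sup>+x. k x \<partial>lborel) = ennreal \<bar>det Q\<bar> * emeasure lborel \<Xi>"
      unfolding k_def using borel_compact[OF comp]
      by (simp add: ennreal_mult ennreal_indicator nn_integral_cmult)
    also have "emeasure lborel \<Xi> = ennreal (measure lebesgue \<Xi>)"
    proof -
      have "emeasure lborel \<Xi> \<noteq> top"
        using emeasure_bounded_finite[OF compact_imp_bounded[OF comp]] by auto
      from emeasure_eq_ennreal_measure[OF this] show ?thesis using borel_compact[OF comp] by simp
    qed
    finally show "(\<integral>\<^sup>+x. k x \<partial>lborel) \<le> ennreal (\<bar>det Q\<bar> * measure lebesgue \<Xi>)"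
      by (simp add: ennreal_mult)
  qed (auto simp: k_def)
  moreover have "(\<lambda>v. Q *v v) ` {x \<in> \<Xi>. \<bar>det (matrix (\<lambda>v. Q *v v))\<bar> \<le> k x} = cball 0 r"
  proof -
    have "{x \<in> \<Xi>. \<bar>det (matrix (\<lambda>v. Q *v v))\<bar> \<le> k x} = \<Xi>" by (auto simp: k_def)
    then show ?thesis by (simp only: \<Xi>_def image_image matrix_vector_mul_assoc Q) simp
  qed
  ultimately have "measure lebesgue (cball (0::real^'n) r) \<le> \<bar>det Q\<bar> * measure lebesgue \<Xi>" by simp
  moreover have "measure lebesgue (cball (0::real^'n) r) = unit_ball_vol (real CARD('n)) * r ^ CARD('n)"
    using content_cball[OF r, of "0::real^'n"] by simp
  ultimately have "unit_ball_vol (real CARD('n)) * r ^ CARD('n) * \<bar>det P\<bar>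
      \<le> (\<bar>det Q\<bar> * measure lebesgue \<Xi>) * \<bar>det P\<bar>"
    by (intro mult_right_mono) auto
  also have "\<dots> = measure lebesgue \<Xi>" 
    using detQ by (metis mult.assoc mult.commute mult_1)
  finally show ?thesis by (simp only: \<Xi>_def)
qed

lemma mat_le_quadratic_form: "mat_le A B \<Longrightarrow> v \<bullet> (A *v v) \<le> v \<bullet> (B *v v)"
  unfolding mat_le_def by blast

text \<open>Both bounds confine the essential supremum to a finite interval, so the coercion in
  \<open>Linf_norm\<close> returns its actual value.\<close>

lemma Linf_norm_pos_part_bounds:
  fixes g :: "'a::euclidean_space \<Rightarrow> real"
  assumes g: "g \<in> borel_measurable borel" and le: "\<And>x. g x \<le> B" and B: "0 \<le> B"
  shows "0 \<le> Linf_norm (pos_part g)" "Linf_norm (pos_part g) \<le> B"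
proof -
  let ?e = "esssup (lborel :: 'a measure) (\<lambda>x. ereal \<bar>pos_part g x\<bar>)"
  have meas: "(\<lambda>x. ereal \<bar>pos_part g x\<bar>) \<in> borel_measurable (lborel :: 'a measure)"
    using g unfolding pos_part_def by measurable
  have "?e \<le> ereal B"
    using le B by (intro esssup_I[OF meas]) (auto simp: pos_part_def)
  moreover have "ereal 0 \<le> ?e"
  proof -
    have "ereal 0 = esssup (lborel :: 'a measure) (\<lambda>x. ereal 0)"
      by (rule esssup_const[symmetric]) simp
    also have "\<dots> \<le> ?e" by (intro esssup_mono) auto
    finally show ?thesis .
  qed
  ultimately show "0 \<le> Linf_norm (pos_part g)" "Linf_norm (pos_part g) \<le> B"
    unfolding Linf_norm_def by (cases ?e; simp)+
qed

text \<open>The two entries of the sum in \<open>slope_const\<close> beyond \<open>d A\<close> come from the source term on the last half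
  \<open>[t/2, t]\<close> of the time interval and from the time derivative of the barrier.\<close>

definition slope_const :: "nat \<Rightarrow> real \<Rightarrow> real \<Rightarrow> real \<Rightarrow> real" where
  "slope_const d p M A = real d * A + 2 * 2 powr (real d / (2 * p)) + 2 * M"

text \<open>What remains of the inequality of \<open>abp_slice\<close> once the data cancel: d!
  comes from determinant versus trace, 4^p from f > m / 4 at contact points, 8^(d + 1) from the
  height and the radius of the slopes (before applying \<open>P\<close>), both m \<theta> / 8, and
  the 2 from the window of length \<theta> t0 / 2. Of the explicit powers of \<open>A\<close>, d
  come from the weight and one from the volume condition.\<close>

definition touching_const :: "nat \<Rightarrow> real \<Rightarrow> real \<Rightarrow> real \<Rightarrow> real" where
  "touching_const d p M A = fact d * slope_const d p M A ^ (d + 1) * A ^ (d + 1) * 4 powr p * 8 ^ (d + 1)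
     / (2 * unit_ball_vol (real d))"

text \<open>\<open>C1\<close> is a parameter tied to \<open>K\<close>, so that the lemmas can state
  how large it has to be.\<close>

locale degenerate_parabolic =
  fixes f :: "real \<Rightarrow> real^'n \<Rightarrow> real" and a :: "real \<Rightarrow> real^'n \<Rightarrow> real^'n^'n"
    and p C1 \<alpha> C \<delta> \<Lambda> N \<kappa> \<beta> K T :: real
  assumes p: "1 \<le> p"
    and f_bounded: "bounded ((\<lambda>(t, x). f t x) ` ({0..1} \<times> UNIV))"
    and f_cont: "continuous_on ({0..1} \<times> UNIV) (\<lambda>(t, x). f t x)"
    and \<alpha>: "0 \<le> \<alpha>" "\<alpha> < 2 * p / real CARD('n)"
    and C: "0 < C" and \<delta>: "0 < \<delta>" and \<Lambda>: "0 < \<Lambda>"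
    and ell: "locally_uniformly_elliptic_on ({0..1} \<times> UNIV) a"
    and pde: "\<forall>t\<in>{0..1}. \<forall>x. 0 < f t x \<longrightarrow>
       twice_differentiable_at (f t) x \<and>
       (\<lambda>s. f s x) differentiable (at t within {0..1}) \<and>
       vector_derivative (\<lambda>s. f s x) (at t within {0..1})
         \<le> (\<Sum>i\<in>UNIV. \<Sum>j\<in>UNIV. a t x $ i $ j * partial_deriv i (partial_deriv j (f t)) x)
           + C * Linf_norm (pos_part (f t)) powr (1 + \<alpha>)"
    and det_ge: "\<forall>t\<in>{0..1}. \<forall>x. \<delta> * (1 + norm x) powr (\<beta> * real CARD('n) - \<kappa>) \<le> det (a t x)"
    and a_le: "\<forall>t\<in>{0..1}. \<forall>x. mat_le (a t x) ((\<Lambda> * (1 + norm x) powr (min (2 * \<beta>) 2)) *\<^sub>R mat 1)"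
    and mass: "\<forall>t\<in>{0..1}. (\<integral>\<^sup>+x. ennreal ((1 + norm x) powr \<kappa> * pos_part (f t) x powr p) \<partial>lborel) \<le> ennreal N"
    and K: "0 < K" and C1: "0 < C1"
    and K_eq: "K powr p = C1 * ((1 + \<Lambda>) ^ (CARD('n) + 1) * N / \<delta>)"
    and T_eq: "T = ((1 + \<Lambda>) / (C * K powr \<alpha>)) powr (1 / (1 - \<alpha> * real CARD('n) / (2 * p)))"
begin

definition m :: "real \<Rightarrow> real" where
  "m t = K * t powr (- real CARD('n) / (2 * p))"

lemma m_pos: "0 < t \<Longrightarrow> 0 < m t"
  using K by (simp add: m_def)

lemma N_pos: "0 < N"
proof -
  have "0 < C1 * ((1 + \<Lambda>) ^ (CARD('n) + 1) * N / \<delta>)" unfolding K_eq[symmetric] using K by simp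
  moreover have "0 < (1 + \<Lambda>) ^ (CARD('n) + 1)" using \<Lambda> by (intro zero_less_power) simp
  ultimately show ?thesis using C1 \<delta> by (metis zero_less_mult_pos zero_less_divide_iff less_asym)
qed

lemma m_powr_p: "0 < t \<Longrightarrow> m t powr p = K powr p * t powr (- real CARD('n) / 2)"
  using K p by (simp add: m_def powr_mult powr_powr)

lemma f_slice_measurable: "t \<in> {0..1} \<Longrightarrow> f t \<in> borel_measurable borel"
proof (rule borel_measurable_continuous_onI)
  assume t: "t \<in> {0..1}"
  have 1: "continuous_on UNIV (\<lambda>x. (t, x))" by (intro continuous_intros)
  have 2: "range (\<lambda>x. (t, x)) \<subseteq> {0..1} \<times> UNIV" using t by auto
  show "continuous_on UNIV (f t)" using continuous_on_compose2[OF f_cont 1 2] by simp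
qed

lemma a_sym: "t \<in> {0..1} \<Longrightarrow> transpose (a t x) = a t x"
  using bspec[OF a_le, of t] unfolding mat_le_def by metis

text \<open>A singleton is compact, so local uniform ellipticity gives definiteness at each
  point.\<close>

lemma a_pos_def:
  assumes t: "t \<in> {0..1}" and v: "v \<noteq> 0"
  shows "0 < v \<bullet> (a t x *v v)"
proof -
  have "compact {(t, x)} \<and> {(t, x)} \<subseteq> {0..1} \<times> UNIV" using t by simp
  then obtain l where l: "l > 0" "mat_le (l *\<^sub>R mat 1) (a t x)"
    using ell unfolding locally_uniformly_elliptic_on_def by (metis (no_types, lifting) case_prodD singletonI)
  from l(2) have "v \<bullet> ((l *\<^sub>R mat 1) *v v) \<le> v \<bullet> (a t x *v v)"
    by (rule mat_le_quadratic_form)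
  moreover have "v \<bullet> ((l *\<^sub>R mat 1) *v v) = l * (v \<bullet> v)"
    by (simp add: scaleR_matrix_vector_assoc[symmetric])
  moreover have "0 < l * (v \<bullet> v)" using l v by simp
  ultimately show ?thesis by linarith
qed

lemma trace_a_le:
  assumes t: "t \<in> {0..1}"
  shows "trace (a t x) \<le> real CARD('n) * (\<Lambda> * (1 + norm x) powr (min (2 * \<beta>) 2))"
proof -
  have "a t x $ i $ i \<le> \<Lambda> * (1 + norm x) powr (min (2 * \<beta>) 2)" for i
  proof -
    show ?thesis
      using mat_le_quadratic_form[OF a_le[rule_format, OF t, of x], of "axis i 1"]
      by (simp add: inner_axis' matrix_vector_mult_basis column_def mat_def)
  qed
  then have "trace (a t x) \<le> (\<Sum>i\<in>(UNIV :: 'n set). \<Lambda> * (1 + norm x) powr (min (2 * \<beta>) 2))"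
    unfolding trace_def by (intro sum_mono)
  then show ?thesis by simp
qed

text \<open>The trace of \<open>a\<close> times the semidefinite
  \<open>c *\<^sub>R mat 1 - X\<close> is nonnegative, which reduces the claim to the trace of
  \<open>a\<close>.\<close>

lemma trace_a_mult_le:
  assumes t: "t \<in> {0..1}" and X: "\<And>\<xi>. \<xi> \<bullet> (X *v \<xi>) \<le> c * (norm \<xi>)\<^sup>2" and c: "0 \<le> c"
  shows "trace (a t x ** X) \<le> c * (real CARD('n) * (\<Lambda> * (1 + norm x) powr (min (2 * \<beta>) 2)))"
proof -
  have "0 \<le> trace (a t x ** (c *\<^sub>R mat 1 - X))"
  proof (rule trace_pos_def_mult_nonneg[OF a_sym[OF t] a_pos_def[OF t]])
    fix v
    have "(c *\<^sub>R mat 1 - X) *v v = c *\<^sub>R v - X *v v"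
      by (simp add: matrix_vector_mult_diff_rdistrib scaleR_matrix_vector_assoc[symmetric])
    then show "0 \<le> v \<bullet> ((c *\<^sub>R mat 1 - X) *v v)"
      using X[of v] by (simp add: inner_diff_right power2_norm_eq_inner)
  qed
  also have "trace (a t x ** (c *\<^sub>R mat 1 - X)) = c * trace (a t x) - trace (a t x ** X)"
    by (simp add: trace_def matrix_matrix_mult_def mat_def right_diff_distrib sum_subtractf sum_distrib_left
        if_distrib[of "\<lambda>x. _ * x"] cong: if_cong) (simp add: mult_ac)
  finally have "trace (a t x ** X) \<le> c * trace (a t x)" by simp
  also have "\<dots> \<le> c * (real CARD('n) * (\<Lambda> * (1 + norm x) powr (min (2 * \<beta>) 2)))"
    by (intro mult_left_mono trace_a_le t c)
  finally show ?thesis .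
qed

lemma f_time_derivative:
  assumes t: "t \<in> {0..1}" and pos: "0 < f t x" and bound: "\<And>x. f t x \<le> B" and B: "0 \<le> B"
  defines "Hf \<equiv> (\<chi> j i. partial_deriv i (partial_deriv j (f t)) x) :: real^'n^'n"
  shows "\<exists>w\<le>trace (a t x ** Hf) + C * B powr (1 + \<alpha>).
    ((\<lambda>s. f s x) has_real_derivative w) (at t within {0..1})"
proof (intro exI conjI)
  have d: "(\<lambda>s. f s x) differentiable (at t within {0..1})" using pde t pos by blast
  then show "((\<lambda>s. f s x) has_real_derivative vector_derivative (\<lambda>s. f s x) (at t within {0..1})) (at t within {0..1})"
    by (simp add: has_real_derivative_iff_has_vector_derivative vector_derivative_works[symmetric])
  have "vector_derivative (\<lambda>s. f s x) (at t within {0..1})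
      \<le> trace (a t x ** Hf) + C * Linf_norm (pos_part (f t)) powr (1 + \<alpha>)"
    using pde t pos by (simp add: Hf_def trace_def matrix_matrix_mult_def)
  also have "\<dots> \<le> trace (a t x ** Hf) + C * B powr (1 + \<alpha>)"
    using Linf_norm_pos_part_bounds[OF f_slice_measurable[OF t] bound B] C \<alpha>
    by (intro add_left_mono mult_left_mono powr_mono2) auto
  finally show "vector_derivative (\<lambda>s. f s x) (at t within {0..1}) \<le> trace (a t x ** Hf) + C * B powr (1 + \<alpha>)" .
qed

text \<open>The time \<open>T\<close> is chosen to make this hold.\<close>

lemma source_le:
  assumes t: "0 < t" "t \<le> T"
  shows "C * m t powr (1 + \<alpha>) \<le> (1 + \<Lambda>) * m t / t"
proof -
  define s where "s = 1 - \<alpha> * real CARD('n) / (2 * p)"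
  have s: "0 < s" using \<alpha> p by (simp add: s_def field_simps)
  define B where "B = (1 + \<Lambda>) / (C * K powr \<alpha>)"
  have B: "0 < B" using \<Lambda> C K by (simp add: B_def)
  have "t powr s \<le> T powr s" using t s by (intro powr_mono2) auto
  also have "T powr s = B" using s B by (simp add: T_eq s_def[symmetric] B_def[symmetric] powr_powr)
  finally have ts: "t powr s \<le> B" .
  have "m t powr \<alpha> = K powr \<alpha> * t powr (s - 1)"
    using K by (simp add: m_def powr_mult powr_powr s_def mult_ac)
  also have "t powr (s - 1) = t powr s / t" using t by (simp add: powr_diff)
  finally have "C * m t powr \<alpha> = (C * K powr \<alpha>) * t powr s / t" by simp
  also have "\<dots> \<le> (C * K powr \<alpha>) * B / t"
    using ts t C by (intro divide_right_mono mult_left_mono) auto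
  also have "\<dots> = (1 + \<Lambda>) / t" using C K by (simp add: B_def)
  finally have "C * m t powr \<alpha> * m t \<le> (1 + \<Lambda>) / t * m t"
    using m_pos[OF t(1)] by (intro mult_right_mono) auto
  then show ?thesis using m_pos[OF t(1)] by (simp add: powr_add mult_ac)
qed

end

section \<open>Touching by paraboloids\<close>

context degenerate_parabolic
begin

lemma m_half_le:
  assumes "0 < t0" "t0 / 2 \<le> t"
  shows "m t \<le> 2 powr (real CARD('n) / (2 * p)) * m t0"
proof -
  have "t powr (- real CARD('n) / (2 * p)) \<le> (t0 / 2) powr (- real CARD('n) / (2 * p))"
    using assms p by (intro powr_mono2') (simp_all add: divide_nonpos_pos)
  also have "\<dots> = 2 powr (real CARD('n) / (2 * p)) * t0 powr (- real CARD('n) / (2 * p))"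
    using assms by (simp add: powr_divide powr_minus_divide)
  finally show ?thesis using K by (simp add: m_def)
qed

text \<open>The factor \<open>(A * \<omega>) ^ CARD('n)\<close> compensates (1 + |x|)^(\<beta> d) in
  the determinant bound, and (4 f / m0)^p \<ge> 1 brings in the quantity whose integral is
  controlled. The bracket is thus an admissible density \<open>k\<close> for
  \<open>abp_slice\<close>, with integral bounded through \<open>N\<close>.\<close>

lemma weight_det_ge_1:
  assumes t: "t \<in> {0..1}" and w: "(1 + norm x) powr (- \<beta>) \<le> A * \<omega>"
    and m0: "0 < m0" and f: "m0 / 4 \<le> f t x"
  shows "1 \<le> (1 / \<delta> * (A * \<omega>) ^ CARD('n) * (4 / m0) powr p * ((1 + norm x) powr \<kappa> * pos_part (f t) x powr p))
     * det (a t x)"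
proof -
  define W where "W = 1 + norm x"
  have W: "0 < W" by (simp add: W_def add_pos_nonneg)
  have fpos: "0 < f t x" using m0 f by linarith
  then have pp: "pos_part (f t) x = f t x" by (simp add: pos_part_def)
  have "1 \<le> 4 / m0 * f t x" using f m0 by (simp add: field_simps)
  then have "1 powr p \<le> (4 / m0 * f t x) powr p" using p by (intro powr_mono2) auto
  also have "(4 / m0 * f t x) powr p = (4 / m0) powr p * f t x powr p"
    by (rule powr_mult)
  finally have 1: "1 \<le> (4 / m0) powr p * f t x powr p" by simp
  have "1 \<le> A * \<omega> * W powr \<beta>"
  proof -
    have "W powr (- \<beta>) * W powr \<beta> \<le> A * \<omega> * W powr \<beta>"
      using w by (intro mult_right_mono) (auto simp: W_def)
    then show ?thesis using W by (simp add: powr_add[symmetric])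
  qed
  then have "1 \<le> (A * \<omega> * W powr \<beta>) ^ CARD('n)" by (rule one_le_power)
  also have "\<dots> = (A * \<omega>) ^ CARD('n) * W powr (\<beta> * real CARD('n))"
    using W by (simp add: power_mult_distrib powr_realpow[symmetric] powr_powr)
  finally have 2: "1 \<le> (A * \<omega>) ^ CARD('n) * W powr (\<beta> * real CARD('n))" .
  have "\<delta> * W powr (\<beta> * real CARD('n) - \<kappa>) \<le> det (a t x)"
    using det_ge t by (simp add: W_def)
  then have 3: "W powr (\<beta> * real CARD('n)) \<le> 1 / \<delta> * W powr \<kappa> * det (a t x)"
    using mult_left_mono[of "\<delta> * W powr (\<beta> * real CARD('n) - \<kappa>)" "det (a t x)" "1 / \<delta> * W powr \<kappa>"] \<delta> W
    by (simp add: powr_add[symmetric] mult_ac)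
  have A\<omega>: "0 \<le> A * \<omega>" using w powr_ge_zero[of "1 + norm x" "- \<beta>"] by linarith
  have "1 \<le> (A * \<omega>) ^ CARD('n) * (1 / \<delta> * W powr \<kappa> * det (a t x))"
    using 2 mult_left_mono[OF 3, of "(A * \<omega>) ^ CARD('n)"] A\<omega> by simp
  then have "1 * 1 \<le> ((4 / m0) powr p * f t x powr p) * ((A * \<omega>) ^ CARD('n) * (1 / \<delta> * W powr \<kappa> * det (a t x)))"
    using 1 by (intro mult_mono) auto
  then show ?thesis by (simp add: pp W_def mult_ac)
qed

text \<open>If the conclusion failed, subtract from f the background, a paraboloid of height M
  \<theta> over the section, and a term linear in time that is larger by M \<theta> at the start of
  the window than at \<open>t0\<close> (all in units of m(t0)). The difference lies below every
  plane with slope in \<Xi> at the start and on the lateral boundary, by \<open>window\<close>, yet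
  is at least m \<theta> / 8 at (t0, x0). Then \<open>abp_slice\<close> contradicts the size of
  \<open>C1\<close>; \<open>hess\<close> and \<open>vol\<close> keep its right side small and its
  left side large.\<close>

lemma touching:
  fixes P :: "real^'n^'n" and V :: "real^'n \<Rightarrow> real" and DV :: "real^'n \<Rightarrow> real^'n"
    and HV :: "real^'n \<Rightarrow> real^'n^'n"
  assumes t0: "0 < t0" "t0 \<le> 1" "t0 \<le> T" and \<theta>: "0 < \<theta>" "\<theta> \<le> 1" and M: "0 \<le> M"
    and A: "0 < A" and \<omega>: "0 < \<omega>"
    and big: "touching_const CARD('n) p M A < C1"
    and bound: "\<And>t x. 0 < t \<Longrightarrow> t \<le> t0 \<Longrightarrow> f t x \<le> m t"
    and window: "\<And>t x. t0 - \<theta> * t0 / 2 \<le> t \<Longrightarrow> t \<le> t0 \<Longrightarrow> norm (P *v (x - x0)) \<le> 1 \<Longrightarrow>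
        f t x \<le> m t0 * (V x + M * \<theta>)"
    and V: "\<And>x. norm (P *v (x - x0)) \<le> 1 \<Longrightarrow> 1 / 4 \<le> V x"
      "\<And>x. (V has_derivative (\<lambda>v. DV x \<bullet> v)) (at x)"
      "\<And>x. norm (P *v (x - x0)) \<le> 1 \<Longrightarrow> (DV has_derivative (\<lambda>v. HV x *v v)) (at x)"
    and weight: "\<And>x. norm (P *v (x - x0)) \<le> 1 \<Longrightarrow> (1 + norm x) powr (- \<beta>) \<le> A * \<omega>"
    and vol: "(\<omega> / sqrt t0) ^ CARD('n) \<le> A * \<theta> ^ CARD('n) * \<bar>det P\<bar>"
    and hess: "\<And>x. norm (P *v (x - x0)) \<le> 1 \<Longrightarrow>
        \<exists>c\<ge>0. (\<forall>\<xi>. \<xi> \<bullet> (HV x *v \<xi>) + 2 * M * \<theta> * (norm (P *v \<xi>))\<^sup>2 \<le> c * (norm \<xi>)\<^sup>2)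
          \<and> c * (1 + norm x) powr (min (2 * \<beta>) 2) \<le> A / t0"
  shows "f t0 x0 < m t0 * (V x0 + \<theta> / 4)"
proof (rule ccontr)
  let ?d = "CARD('n)"
  assume "\<not> f t0 x0 < m t0 * (V x0 + \<theta> / 4)"
  then have f0: "m t0 * (V x0 + \<theta> / 4) \<le> f t0 x0" by simp
  define m0 where "m0 = m t0"
  have m0: "0 < m0" using m_pos t0 by (simp add: m0_def)
  define t1 where "t1 = t0 - \<theta> * t0 / 2"
  have \<theta>t: "0 < \<theta> * t0" "\<theta> * t0 \<le> t0" using \<theta> t0 by (auto simp: mult_left_le_one_le)
  have t1: "t0 / 2 \<le> t1" "t1 < t0" "0 < t1" using \<theta>t t0 by (auto simp: t1_def field_simps)
  have ran: "t0 / 2 \<le> t" "0 < t" "t \<in> {0..1}" "t \<le> T" if "t1 \<le> t" "t \<le> t0" for t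
    using that t0 t1 by auto
  define S0 where "S0 = slope_const ?d p M A"
  have S0: "0 < S0" unfolding S0_def slope_const_def using A M
    by (intro add_pos_nonneg add_pos_pos) auto
  define S where "S = S0 * ((1 + \<Lambda>) * m0 / t0)"
  have S: "0 < S" using S0 \<Lambda> m0 t0 by (simp add: S_def)
  have detP: "det P \<noteq> 0"
  proof
    assume "det P = 0"
    then have "(\<omega> / sqrt t0) ^ ?d \<le> 0" using vol by simp
    moreover have "0 < (\<omega> / sqrt t0) ^ ?d" using \<omega> t0 by simp
    ultimately show False by linarith
  qed
  define Q where "Q = transpose P ** P"
  have Qsym: "v \<bullet> (Q *v w) = (Q *v v) \<bullet> w" and Qsq: "v \<bullet> (Q *v v) = (norm (P *v v))\<^sup>2" for v w
    unfolding Q_def power2_norm_eq_inner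
    by (metis dot_lmul_matrix matrix_vector_mul_assoc transpose_matrix_vector inner_commute)+
  define sec where "sec = {x. norm (P *v (x - x0)) \<le> 1}"
  define U where "U = {x. norm (P *v (x - x0)) < 1}"
  have cP: "continuous_on UNIV (\<lambda>x. norm (P *v (x - x0)))"
    by (intro continuous_on_norm bounded_linear.continuous_on[OF matrix_vector_mul_bounded_linear]
        continuous_intros)
  have U: "open U" "U \<subseteq> sec" unfolding U_def sec_def
    by (auto intro!: open_Collect_less cP)
  have sec: "compact sec"
  proof -
    obtain R where R: "R ** P = mat 1" using detP by (auto simp: invertible_det_nz[symmetric] invertible_def)
    have "sec = (\<lambda>v. x0 + R *v v) ` cball 0 1"
    proof (intro equalityI subsetI)
      fix x assume "x \<in> sec"
      moreover have "x = x0 + R *v (P *v (x - x0))" by (simp add: matrix_vector_mul_assoc R)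
      ultimately show "x \<in> (\<lambda>v. x0 + R *v v) ` cball 0 1" by (auto simp: sec_def)
    next
      fix x assume "x \<in> (\<lambda>v. x0 + R *v v) ` cball 0 1"
      moreover have "P ** R = mat 1" using R by (simp add: matrix_left_right_inverse)
      ultimately show "x \<in> sec" by (auto simp: sec_def matrix_vector_mul_assoc)
    qed
    then show ?thesis
      by (simp only:) (intro compact_continuous_image continuous_on_add continuous_on_const
          matrix_vector_mult_linear_continuous_on compact_cball)
  qed
  \<comment> \<open>Written this way, \<xi> \<bullet> (x - x0) is an inner product with
    \<open>P *v (x - x0)\<close>, hence at most m0 \<theta> / 8 in absolute value on the
    section.\<close>
  define \<Xi> where "\<Xi> = (\<lambda>v. transpose P *v v) ` cball 0 (m0 * \<theta> / 8)"
  have \<Xi>: "compact \<Xi>" unfolding \<Xi>_def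
    by (intro compact_continuous_image matrix_vector_mult_linear_continuous_on) simp
  have \<Xi>_le: "\<bar>\<xi> \<bullet> (x - x0)\<bar> \<le> m0 * \<theta> / 8" if \<xi>: "\<xi> \<in> \<Xi>" and x: "x \<in> sec" for \<xi> x
  proof -
    obtain \<eta> where \<eta>: "\<xi> = transpose P *v \<eta>" "norm \<eta> \<le> m0 * \<theta> / 8" using \<xi> by (auto simp: \<Xi>_def)
    have "\<xi> \<bullet> (x - x0) = \<eta> \<bullet> (P *v (x - x0))"
      unfolding \<eta>(1) by (metis dot_lmul_matrix transpose_matrix_vector)
    then have "\<bar>\<xi> \<bullet> (x - x0)\<bar> \<le> norm \<eta> * norm (P *v (x - x0))"
      by (simp add: Cauchy_Schwarz_ineq2)
    also have "\<dots> \<le> norm \<eta> * 1" using x by (intro mult_left_mono) (auto simp: sec_def)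
    finally show ?thesis using \<eta>(2) by simp
  qed
  \<comment> \<open>At \<open>t0\<close> it spends \<theta> / 8 of the excess \<theta> / 4, which
    leaves \<theta> / 8 as height. At the start of the window it is m0 (\<theta> / 8 + M \<theta>):
    the first summand dominates the slopes, the second the surplus in \<open>window\<close>.\<close>
  define bb where "bb t = m0 * (\<theta> / 8 + 2 * M * (t0 - t) / t0)" for t
  define q where "q x = m0 * (V x + M * \<theta> * ((x - x0) \<bullet> (Q *v (x - x0))))" for x
  define g where "g t x = f t x - bb t - q x" for t x
  define D where "D t x = (\<chi> i. partial_deriv i (f t) x) - m0 *\<^sub>R (DV x + (2 * M * \<theta>) *\<^sub>R (Q *v (x - x0)))" for t x
  define HQ where "HQ x = HV x + (2 * M * \<theta>) *\<^sub>R Q" for x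
  define Hf where "Hf t x = ((\<chi> j i. partial_deriv i (partial_deriv j (f t)) x) :: real^'n^'n)" for t x
  define H where "H t x = Hf t x - m0 *\<^sub>R HQ x" for t x
  define k where "k t x = 1 / \<delta> * (A * \<omega>) ^ ?d * (4 / m0) powr p * ((1 + norm x) powr \<kappa> * pos_part (f t) x powr p)" for t x
  define J where "J = 1 / \<delta> * (A * \<omega>) ^ ?d * (4 / m0) powr p * N"
  have J: "0 \<le> J" using \<delta> A \<omega> N_pos by (simp add: J_def)
  have k0: "0 \<le> k t x" for t x using \<delta> A \<omega> by (simp add: k_def)
  have q_lower: "m0 * V x \<le> q x" for x
    unfolding q_def Qsq using m0 M \<theta> by (intro mult_left_mono) auto
  have bb_lower: "m0 * \<theta> / 8 \<le> bb t" if "t \<le> t0" for t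
    unfolding bb_def using that m0 M t0 by (simp add: distrib_left)
  have contact: "m0 / 4 < f t x" "0 < f t x"
    if "t1 < t" "t \<le> t0" "x \<in> U" "\<xi> \<in> \<Xi>" "\<xi> \<bullet> (x - x0) < g t x" for t \<xi> x
  proof -
    have x: "x \<in> sec" using that U by auto
    have "m0 * (1 / 4) \<le> m0 * V x" using V(1)[of x] x m0 by (intro mult_left_mono) (auto simp: sec_def)
    then show "m0 / 4 < f t x"
      using \<Xi>_le[OF that(4) x] that(5) q_lower[of x] bb_lower[OF that(2)] by (simp add: g_def)
    then show "0 < f t x" using m0 by linarith
  qed
  have dq: "(q has_derivative (\<lambda>v. (m0 *\<^sub>R (DV x + (2 * M * \<theta>) *\<^sub>R (Q *v (x - x0)))) \<bullet> v)) (at x)" for x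
  proof -
    have "((\<lambda>x. (x - x0) \<bullet> (Q *v (x - x0))) has_derivative
        (\<lambda>v. (x - x0) \<bullet> (Q *v v) + v \<bullet> (Q *v (x - x0)))) (at x)"
    proof (rule has_derivative_inner)
      show s: "((\<lambda>x. x - x0) has_derivative (\<lambda>v. v)) (at x)" by (auto intro!: derivative_eq_intros)
      show "((\<lambda>x. Q *v (x - x0)) has_derivative (\<lambda>v. Q *v v)) (at x)"
        by (rule bounded_linear.has_derivative[OF matrix_vector_mul_bounded_linear s])
    qed
    then have "((\<lambda>x. (x - x0) \<bullet> (Q *v (x - x0))) has_derivative (\<lambda>v. 2 * ((Q *v (x - x0)) \<bullet> v))) (at x)"
      by (rule has_derivative_eq_rhs) (simp add: fun_eq_iff Qsym inner_commute)
    from has_derivative_mult_right[OF has_derivative_add[OF V(2) has_derivative_mult_right[OF this, of "M * \<theta>"]], of m0]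
    show ?thesis unfolding q_def
      by (rule has_derivative_eq_rhs) (simp add: fun_eq_iff inner_simps algebra_simps)
  qed
  have "m0 * \<theta> / 8 * measure lebesgue \<Xi> \<le> (t0 - t1) * (fact ?d * S ^ (?d + 1) * J)"
  proof (rule abp_slice[where g = g and D = D and H = H and A = a and k = k and K = sec and U = U and \<eta> = "m0 * \<theta> / 8"])
    show "compact sec" "x0 \<in> sec" "open U" "U \<subseteq> sec" "compact \<Xi>" "t1 < t0" "0 < S" "0 \<le> J" "\<And>t x. 0 \<le> k t x"
      using sec U \<Xi> t1 S J k0 by (auto simp: sec_def)
    show "continuous_on ({t1..t0} \<times> sec) (\<lambda>(t, x). g t x)"
    proof -
      have "continuous_on ({t1..t0} \<times> sec) (\<lambda>q. f (fst q) (snd q))"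
        using f_cont ran by (auto simp: case_prod_unfold elim!: continuous_on_subset)
      moreover have "continuous_on UNIV q"
        using dq by (meson continuous_at_imp_continuous_on has_derivative_continuous)
      then have "continuous_on ({t1..t0} \<times> sec) (\<lambda>r. q (snd r))"
        by (rule continuous_on_compose2) (auto intro!: continuous_intros)
      ultimately show ?thesis unfolding g_def bb_def case_prod_unfold
        using t0 by (intro continuous_intros) auto
    qed
    show "g t1 x \<le> \<xi> \<bullet> (x - x0)" if "\<xi> \<in> \<Xi>" "x \<in> sec" for \<xi> x
    proof -
      have "f t1 x \<le> m0 * (V x + M * \<theta>)" using window[of t1 x] that t1 by (auto simp: sec_def m0_def t1_def)
      moreover have "bb t1 = m0 * \<theta> / 8 + m0 * (M * \<theta>)" using t0 by (simp add: bb_def t1_def field_simps)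
      ultimately show ?thesis
        using \<Xi>_le[OF that] q_lower[of x] by (simp add: g_def distrib_left)
    qed
    show "g t x \<le> \<xi> \<bullet> (x - x0)" if "t1 < t" "t \<le> t0" "\<xi> \<in> \<Xi>" "x \<in> sec - U" for t \<xi> x
    proof -
      have x: "x \<in> sec" "norm (P *v (x - x0)) = 1" using that(4) by (auto simp: sec_def U_def)
      have "f t x \<le> m0 * (V x + M * \<theta>)" using window[of t x] that x by (auto simp: m0_def t1_def)
      moreover have "q x = m0 * (V x + M * \<theta>)" using x by (simp add: q_def Qsq)
      ultimately show ?thesis
        using \<Xi>_le[OF that(3) x(1)] bb_lower[OF that(2)] by (simp add: g_def)
    qed
    show "m0 * \<theta> / 8 \<le> g t0 x0"
      using f0 by (simp add: g_def bb_def q_def m0_def[symmetric] algebra_simps)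
    show "0 \<le> m0 * \<theta> / 8" using m0 \<theta> by simp
    fix t assume t: "t1 < t" "t \<le> t0"
    note rt = ran[OF less_imp_le[OF t(1)] t(2)]
    show "\<And>x. transpose (a t x) = a t x" "\<And>x v. v \<noteq> 0 \<Longrightarrow> 0 < v \<bullet> (a t x *v v)"
      using a_sym a_pos_def rt(3) by auto
    have meas: "(\<lambda>x. (1 + norm x) powr \<kappa> * pos_part (f t) x powr p) \<in> borel_measurable borel"
      using f_slice_measurable[OF rt(3)] unfolding pos_part_def by measurable
    then show "k t \<in> borel_measurable borel" unfolding k_def[abs_def] by measurable
    have "k t x = (1 / \<delta> * (A * \<omega>) ^ ?d * (4 / m0) powr p) * ((1 + norm x) powr \<kappa> * pos_part (f t) x powr p)" for x
      by (simp add: k_def)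
    then have "ennreal (k t x) = ennreal (1 / \<delta> * (A * \<omega>) ^ ?d * (4 / m0) powr p)
        * ennreal ((1 + norm x) powr \<kappa> * pos_part (f t) x powr p)" for x
      using \<delta> A \<omega> by (simp only:) (intro ennreal_mult; simp)
    then have "(\<integral>\<^sup>+x. k t x \<partial>lborel) = ennreal (1 / \<delta> * (A * \<omega>) ^ ?d * (4 / m0) powr p) *
        (\<integral>\<^sup>+x. ennreal ((1 + norm x) powr \<kappa> * pos_part (f t) x powr p) \<partial>lborel)"
      using measurable_compose[OF meas measurable_ennreal] by (simp only:) (intro nn_integral_cmult; simp)
    also have "\<dots> \<le> ennreal (1 / \<delta> * (A * \<omega>) ^ ?d * (4 / m0) powr p) * ennreal N"
      using mass rt(3) by (intro mult_left_mono) auto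
    also have "\<dots> = ennreal J" unfolding J_def using \<delta> A \<omega> N_pos by (intro ennreal_mult[symmetric]) auto
    finally show "(\<integral>\<^sup>+x. k t x \<partial>lborel) \<le> ennreal J" .
    fix \<xi> x assume x: "x \<in> U" "\<xi> \<in> \<Xi>" "\<xi> \<bullet> (x - x0) < g t x"
    have xs: "norm (P *v (x - x0)) \<le> 1" using x(1) by (simp add: U_def)
    note ct = contact[OF t x]
    show "1 \<le> k t x * det (a t x)"
      unfolding k_def by (rule weight_det_ge_1[OF rt(3) weight[OF xs] m0 less_imp_le[OF ct(1)]])
    have tw: "twice_differentiable_at (f t) x" using pde rt(3) ct(2) by blast
    note gr = twice_differentiable_at_gradient[OF tw]
    show "\<forall>\<^sub>F y in nhds x. (g t has_derivative (\<lambda>v. D t y \<bullet> v)) (at y)"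
      using gr(1)
    proof eventually_elim
      case (elim y)
      have "(g t has_derivative (\<lambda>v. (\<chi> i. partial_deriv i (f t) y) \<bullet> v - 0
          - (m0 *\<^sub>R (DV y + (2 * M * \<theta>) *\<^sub>R (Q *v (y - x0)))) \<bullet> v)) (at y)"
        unfolding g_def[abs_def] by (intro has_derivative_diff elim has_derivative_const dq)
      then show ?case by (rule has_derivative_eq_rhs) (simp add: fun_eq_iff D_def inner_diff_left)
    qed
    show "(D t has_derivative (\<lambda>v. H t x *v v)) (at x)"
    proof -
      have "((\<lambda>x. x - x0) has_derivative (\<lambda>v. v)) (at x)" by (auto intro!: derivative_eq_intros)
      from bounded_linear.has_derivative[OF matrix_vector_mul_bounded_linear this, of Q]
      have "((\<lambda>x. Q *v (x - x0)) has_derivative (\<lambda>v. Q *v v)) (at x)" .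
      from has_derivative_diff[OF gr(2) has_derivative_scaleR_right[OF has_derivative_add[OF V(3)[OF xs]
          has_derivative_scaleR_right[OF this, of "2 * M * \<theta>"]], of m0]]
      show ?thesis unfolding D_def[abs_def]
        by (rule has_derivative_eq_rhs)
           (simp add: fun_eq_iff H_def Hf_def HQ_def matrix_vector_mult_diff_rdistrib
              matrix_vector_mult_add_rdistrib scaleR_matrix_vector_assoc[symmetric])
    qed
    show "\<exists>w\<le>trace (a t x ** H t x) + S. ((\<lambda>s. g s x) has_real_derivative w) (at t within {t1..t})"
    proof -
      obtain w where w: "w \<le> trace (a t x ** Hf t x) + C * m t powr (1 + \<alpha>)"
        "((\<lambda>s. f s x) has_real_derivative w) (at t within {0..1})"
        using f_time_derivative[OF rt(3) ct(2) bound[OF rt(2) t(2)]] m_pos[OF rt(2)]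
        unfolding Hf_def by (auto intro: less_imp_le)
      have dbb: "(bb has_real_derivative - (m0 * (2 * M / t0))) (at t within {t1..t})"
        unfolding bb_def[abs_def] using t0 by (auto intro!: derivative_eq_intros simp: field_simps)
      have df: "((\<lambda>s. f s x) has_real_derivative w) (at t within {t1..t})"
        using w(2) by (rule DERIV_subset) (use rt t1 in auto)
      have dg: "((\<lambda>s. g s x) has_real_derivative (w + m0 * (2 * M / t0))) (at t within {t1..t})"
        unfolding g_def using DERIV_diff[OF DERIV_diff[OF df dbb] DERIV_const] by simp
      obtain c where c: "0 \<le> c" "\<And>\<xi>. \<xi> \<bullet> (HV x *v \<xi>) + 2 * M * \<theta> * (norm (P *v \<xi>))\<^sup>2 \<le> c * (norm \<xi>)\<^sup>2"
        "c * (1 + norm x) powr (min (2 * \<beta>) 2) \<le> A / t0"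
        using hess[OF xs] by blast
      have "trace (a t x ** HQ x) \<le> c * (real ?d * (\<Lambda> * (1 + norm x) powr (min (2 * \<beta>) 2)))"
      proof (rule trace_a_mult_le[OF rt(3) _ c(1)])
        fix \<xi>
        show "\<xi> \<bullet> (HQ x *v \<xi>) \<le> c * (norm \<xi>)\<^sup>2"
          using c(2)[of \<xi>] by (simp add: HQ_def matrix_vector_mult_add_rdistrib
              scaleR_matrix_vector_assoc[symmetric] inner_add_right Qsq)
      qed
      also have "\<dots> = real ?d * \<Lambda> * (c * (1 + norm x) powr (min (2 * \<beta>) 2))" by simp
      also have "\<dots> \<le> real ?d * \<Lambda> * (A / t0)" using \<Lambda> by (intro mult_left_mono c(3)) auto
      also have "\<dots> \<le> real ?d * (1 + \<Lambda>) * (A / t0)"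
        using \<Lambda> A t0 by (intro mult_right_mono mult_left_mono) auto
      finally have trQ: "m0 * trace (a t x ** HQ x) \<le> m0 * (real ?d * (1 + \<Lambda>) * (A / t0))"
        using m0 by (intro mult_left_mono) auto
      have "C * m t powr (1 + \<alpha>) \<le> (1 + \<Lambda>) * m t / t" by (rule source_le[OF rt(2,4)])
      also have "\<dots> \<le> (1 + \<Lambda>) * (2 powr (real ?d / (2 * p)) * m0) / (t0 / 2)"
        using \<Lambda> t0 rt m_pos[OF rt(2)] m_half_le[OF t0(1) rt(1)] m0
        by (intro frac_le mult_left_mono) (auto simp: m0_def)
      finally have src: "C * m t powr (1 + \<alpha>) \<le> (1 + \<Lambda>) * (2 powr (real ?d / (2 * p)) * m0) / (t0 / 2)" .
      have "trace (a t x ** H t x) = trace (a t x ** Hf t x) - m0 * trace (a t x ** HQ x)"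
        by (simp add: H_def trace_def matrix_matrix_mult_def right_diff_distrib sum_subtractf sum_distrib_left mult_ac)
      moreover have "m0 * (2 * M / t0) \<le> (1 + \<Lambda>) * (m0 * (2 * M / t0))"
      proof -
        have "1 * (m0 * (2 * M / t0)) \<le> (1 + \<Lambda>) * (m0 * (2 * M / t0))"
          using \<Lambda> m0 M t0 by (intro mult_right_mono mult_nonneg_nonneg divide_nonneg_nonneg) auto
        then show ?thesis by (simp only: mult_1)
      qed
      moreover have "m0 * (real ?d * (1 + \<Lambda>) * (A / t0)) + (1 + \<Lambda>) * (2 powr (real ?d / (2 * p)) * m0) / (t0 / 2)
          + (1 + \<Lambda>) * (m0 * (2 * M / t0)) = S"
        unfolding S_def S0_def slope_const_def using t0 by (simp add: field_simps)
      ultimately have "w + m0 * (2 * M / t0) \<le> trace (a t x ** H t x) + S"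
        using w(1) trQ src by linarith
      then show ?thesis using dg by blast
    qed
  qed
  moreover have "unit_ball_vol (real ?d) * (m0 * \<theta> / 8) ^ ?d * \<bar>det P\<bar> \<le> measure lebesgue \<Xi>"
    unfolding \<Xi>_def using m0 \<theta> by (intro measure_transpose_image_ge detP) auto
  then have "m0 * \<theta> / 8 * (unit_ball_vol (real ?d) * (m0 * \<theta> / 8) ^ ?d * \<bar>det P\<bar>) \<le> m0 * \<theta> / 8 * measure lebesgue \<Xi>"
    using m0 \<theta> by (intro mult_left_mono) auto
  ultimately have main: "m0 * \<theta> / 8 * (unit_ball_vol (real ?d) * (m0 * \<theta> / 8) ^ ?d * \<bar>det P\<bar>)
      \<le> (t0 - t1) * (fact ?d * S ^ (?d + 1) * J)" by linarith
  define v where "v = unit_ball_vol (real ?d)"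
  have v: "0 < v" by (simp add: v_def)
  define L where "L = (1 + \<Lambda>) ^ (?d + 1)"
  have L: "0 < L" using \<Lambda> by (simp add: L_def)
  define r where "r = sqrt t0 ^ ?d"
  have r: "0 < r" using t0 by (simp add: r_def)
  have rr: "r * r = t0 ^ ?d" using t0 by (simp add: r_def power_mult_distrib[symmetric])
  have "t0 powr (- real ?d / 2) = 1 / r"
    using t0 by (simp add: r_def powr_half_sqrt[symmetric] powr_realpow[symmetric] powr_powr powr_minus_divide)
  then have mp: "m0 powr p = C1 * L * N / (\<delta> * r)"
    using m_powr_p[OF t0(1)] K_eq by (simp add: m0_def L_def)
  have "(4 / m0) powr p = 4 powr p * \<delta> * r / (C1 * L * N)"
    using m0 mp by (simp add: powr_divide)
  then have Jeq: "J = A ^ ?d * \<omega> ^ ?d * 4 powr p * r / (C1 * L)"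
    using \<delta> N_pos by (simp add: J_def power_mult_distrib field_simps)
  \<comment> \<open>\<open>Y\<close> collects the entire dependence on \<theta>, m0, \<omega> and
    t0; it is a factor of both sides and cancels.\<close>
  define Y where "Y = \<theta> * m0 ^ (?d + 1) * \<omega> ^ ?d / r"
  have Y: "0 < Y" using \<theta> m0 \<omega> r by (simp add: Y_def)
  have "(t0 - t1) * (fact ?d * S ^ (?d + 1) * J)
      = (\<theta> * t0 / 2) * (fact ?d * (S0 ^ (?d + 1) * (L * m0 ^ (?d + 1) / (t0 * (r * r)))) * J)"
    by (simp add: t1_def S_def L_def power_mult_distrib power_divide rr)
  also have "\<dots> = Y * (fact ?d * S0 ^ (?d + 1) * A ^ ?d * 4 powr p / (2 * C1))"
    unfolding Jeq Y_def using t0 r L C1 by (simp add: field_simps del: power_Suc)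
  finally have R: "(t0 - t1) * (fact ?d * S ^ (?d + 1) * J)
      = Y * (fact ?d * S0 ^ (?d + 1) * A ^ ?d * 4 powr p / (2 * C1))" .
  have "Y * (v / (8 ^ (?d + 1) * A)) = (\<theta> * m0 ^ (?d + 1) * v / 8 ^ (?d + 1)) * ((\<omega> / sqrt t0) ^ ?d / A)"
    by (simp add: Y_def r_def power_divide mult_ac)
  also have "\<dots> \<le> (\<theta> * m0 ^ (?d + 1) * v / 8 ^ (?d + 1)) * (\<theta> ^ ?d * \<bar>det P\<bar>)"
  proof (rule mult_left_mono)
    show "(\<omega> / sqrt t0) ^ ?d / A \<le> \<theta> ^ ?d * \<bar>det P\<bar>"
      using vol A by (simp only: pos_divide_le_eq mult_ac)
  qed (use \<theta> m0 v in auto)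
  also have "\<dots> = m0 * \<theta> / 8 * (v * (m0 * \<theta> / 8) ^ ?d * \<bar>det P\<bar>)"
    by (simp add: power_mult_distrib power_divide mult_ac)
  also have "\<dots> \<le> (t0 - t1) * (fact ?d * S ^ (?d + 1) * J)"
    using main by (simp only: v_def)
  also note R
  finally have "Y * (v / (8 ^ (?d + 1) * A)) \<le> Y * (fact ?d * S0 ^ (?d + 1) * A ^ ?d * 4 powr p / (2 * C1))" .
  then have "v / (8 ^ (?d + 1) * A) \<le> fact ?d * S0 ^ (?d + 1) * A ^ ?d * 4 powr p / (2 * C1)"
    using Y by (simp only: mult_le_cancel_left_pos)
  then have "C1 \<le> fact ?d * S0 ^ (?d + 1) * A ^ (?d + 1) * 4 powr p * 8 ^ (?d + 1) / (2 * v)"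
    using v A C1 by (simp add: field_simps)
  then show False using big by (simp add: touching_const_def S0_def v_def)
qed

end

section \<open>Slowly varying weights\<close>

lemma ln_one_plus_ge:
  fixes x :: real
  assumes "0 \<le> x"
  shows "x - x\<^sup>2 / 2 \<le> ln (1 + x)"
proof -
  let ?g = "\<lambda>x::real. ln (1 + x) - x + x\<^sup>2 / 2"
  have "?g 0 \<le> ?g x"
  proof (rule DERIV_nonneg_imp_nondecreasing[OF assms])
    fix y :: real assume y: "0 \<le> y" "y \<le> x"
    have "(?g has_real_derivative (1 / (1 + y) - 1 + y)) (at y)"
      using y by (auto intro!: derivative_eq_intros)
    moreover have "1 / (1 + y) - 1 + y = y\<^sup>2 / (1 + y)" using y by (simp add: field_simps power2_eq_square)
    ultimately show "\<exists>y'. (?g has_real_derivative y') (at y) \<and> 0 \<le> y'" using y by auto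
  qed
  then show ?thesis by simp
qed

lemma ln_le_sqrt:
  fixes b :: real
  assumes "1 \<le> b"
  shows "ln b \<le> 2 * sqrt b - 2"
proof -
  have "ln b = 2 * ln (sqrt b)" using assms by (simp add: ln_sqrt)
  also have "\<dots> \<le> 2 * (sqrt b - 1)" using assms by (intro mult_left_mono ln_le_minus_one) auto
  finally show ?thesis by simp
qed

lemma sqrt_one_plus_square_le: "0 \<le> y \<Longrightarrow> sqrt (1 + y\<^sup>2) \<le> 1 + y" for y :: real
  by (intro real_le_lsqrt) (auto simp: power2_eq_square algebra_simps)

text \<open>That the constant is independent of \<open>b\<close> is what makes \<open>C1\<close> independent of \<open>\<beta>\<close>.\<close>

lemma exp_rho_le_power:
  fixes b r s :: real
  assumes b: "1 \<le> b" and r: "0 \<le> r" and s: "0 < s" "s \<le> b" "s \<le> exp (sqrt (1 + (b * r)\<^sup>2))"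
  shows "s \<le> exp 3 * (1 + r) powr b"
proof -
  have sb: "0 < sqrt b" "sqrt b * sqrt b = b" using b by auto
  have p: "(1 + r) powr b = exp (b * ln (1 + r))" using r by (simp add: powr_def)
  have "ln s \<le> 3 + b * ln (1 + r)"
  \<comment> \<open>The split is at r = 2 / sqrt b. Below it, the quadratic error b r^2 / 2 in the
    expansion of b ln (1 + r) is at most 2. Above it, \<open>s \<le> b\<close> suffices, since b ln
    (1 + r) is already at least 2 sqrt b - 2 \<ge> ln b.\<close>
  proof (cases "b * r \<le> 2 * sqrt b")
    case True
    have "ln s \<le> sqrt (1 + (b * r)\<^sup>2)" using s(1,3) by (metis ln_exp ln_mono exp_gt_zero)
    also have "\<dots> \<le> 1 + b * r" using b r by (intro sqrt_one_plus_square_le) auto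
    finally have 1: "ln s \<le> 1 + b * r" .
    have "b * (r - r\<^sup>2 / 2) \<le> b * ln (1 + r)" using b by (intro mult_left_mono ln_one_plus_ge r) auto
    moreover have "b * r\<^sup>2 / 2 \<le> 2"
    proof -
      have "(b * r)\<^sup>2 \<le> (2 * sqrt b)\<^sup>2" using True b r by (intro power_mono) auto
      also have "\<dots> = b * 4" using b by (simp add: power_mult_distrib)
      also have "(b * r)\<^sup>2 = b * (b * r\<^sup>2)" by (simp add: power2_eq_square)
      finally have "b * r\<^sup>2 \<le> 4" using b by (simp only: mult_le_cancel_left_pos)
      then show ?thesis by simp
    qed
    ultimately show ?thesis using 1 by (simp add: right_diff_distrib)
  next
    case False
    then have r2: "2 / sqrt b \<le> r" using sb b by (simp add: divide_le_eq) (metis sb(2) mult.assoc mult_le_cancel_left_pos not_le less_imp_le mult.commute sb(1))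
    have "ln s \<le> ln b" using s by simp
    also have "\<dots> \<le> 2 * sqrt b - 2" by (rule ln_le_sqrt[OF b])
    also have "\<dots> = b * (2 / sqrt b - (2 / sqrt b)\<^sup>2 / 2)"
      using sb b by (simp add: power2_eq_square right_diff_distrib field_simps)
    also have "\<dots> \<le> b * ln (1 + 2 / sqrt b)" using b by (intro mult_left_mono ln_one_plus_ge) auto
    also have "\<dots> \<le> b * ln (1 + r)" using b r2 by (intro mult_left_mono ln_mono) (auto simp: add_pos_nonneg)
    finally show ?thesis by simp
  qed
  then have "exp (ln s) \<le> exp (3 + b * ln (1 + r))" by simp
  then show ?thesis using s by (simp add: p exp_add)
qed

text \<open>The logarithm of the weight is Lipschitz with constant \<open>b\<close>.\<close>

lemma power_weight_lipschitz:
  fixes x y :: "'a::real_normed_vector" and b :: real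
  assumes b: "0 \<le> b"
  shows "(1 + norm x) powr b \<le> exp (b * norm (x - y)) * (1 + norm y) powr b"
proof -
  have pos: "0 < 1 + norm x" "0 < 1 + norm y" by (simp_all add: add_pos_nonneg)
  have "1 + norm x \<le> (1 + norm y) * (1 + norm (x - y))"
  proof -
    have "norm x \<le> norm y + norm (x - y)" by (metis norm_triangle_sub)
    moreover have "(1 + norm y) * (1 + norm (x - y)) = 1 + norm y + norm (x - y) + norm y * norm (x - y)"
      by (simp add: algebra_simps)
    moreover have "0 \<le> norm y * norm (x - y)" by simp
    ultimately show ?thesis by linarith
  qed
  also have "\<dots> \<le> (1 + norm y) * exp (norm (x - y))" using pos by (intro mult_left_mono exp_ge_add_one_self) auto
  finally have "(1 + norm x) powr b \<le> ((1 + norm y) * exp (norm (x - y))) powr b"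
    using b pos by (intro powr_mono2) auto
  also have "\<dots> = (1 + norm y) powr b * exp (b * norm (x - y))"
    using pos by (simp add: powr_mult exp_powr_real mult.commute)
  finally show ?thesis by (simp add: mult.commute)
qed

text \<open>A substitute for b |x| that is smooth at the origin. Where it is at most ln b + 3 (with
  b \<ge> 1), its exponential is comparable to (1 + |x|)^b with constants independent of b.\<close>

definition japanese_bracket :: "real \<Rightarrow> 'a::real_normed_vector \<Rightarrow> real" where
  "japanese_bracket b x = sqrt (1 + (b * norm x)\<^sup>2)"

text \<open>The 32 serves \<beta> \<ge> 0, where 1 + |x| is at most doubled on a ball of half the
  natural radius. The last factor serves \<beta> < 0, where the weight changes by at most exp (exp
  3) and its square enters the curvature condition.\<close>

definition half_const :: "nat \<Rightarrow> real \<Rightarrow> real" where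
  "half_const d p = 32 * 2 powr (real d / (2 * p)) * exp (2 * exp 3)"

context degenerate_parabolic
begin

text \<open>The instance of \<open>touching\<close> with constant background 1/4, \<theta> = 1 (so
  the window is [t0/2, t0], on which m is at most M m(t0)) and a round section of radius
  \<open>l\<close>.\<close>

lemma half_bound:
  fixes M l \<omega> A :: real
  defines "M \<equiv> 2 powr (real CARD('n) / (2 * p))"
  assumes t0: "0 < t0" "t0 \<le> 1" "t0 \<le> T" and l: "0 < l" and A: "1 \<le> A" and \<omega>: "0 < \<omega>"
    and big: "touching_const CARD('n) p M A < C1"
    and bound: "\<And>t x. 0 < t \<Longrightarrow> t \<le> t0 \<Longrightarrow> f t x \<le> m t"
    and weight: "\<And>x. norm (x - x0) \<le> l \<Longrightarrow> (1 + norm x) powr (- \<beta>) \<le> A * \<omega>"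
    and upper: "\<And>x. norm (x - x0) \<le> l \<Longrightarrow> 2 * M * t0 * (1 + norm x) powr (min (2 * \<beta>) 2) \<le> A * l\<^sup>2"
    and vol: "l * \<omega> \<le> sqrt t0"
  shows "f t0 x0 < m t0 / 2"
proof -
  let ?P = "(1 / l) *\<^sub>R mat 1 :: real^'n^'n"
  have Pv: "?P *v v = (1 / l) *\<^sub>R v" for v by (simp add: scaleR_matrix_vector_assoc[symmetric])
  have Pn: "norm (?P *v v) = norm v / l" for v unfolding Pv using l by simp
  have sec: "norm (?P *v (x - x0)) \<le> 1 \<longleftrightarrow> norm (x - x0) \<le> l" for x
    unfolding Pn using l by (simp add: divide_le_eq)
  have detP: "\<bar>det ?P\<bar> = (1 / l) ^ CARD('n)"
    using l by (subst det_diagonal) (auto simp: mat_def)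
  have M: "0 < M" by (simp add: M_def)
  have "f t0 x0 < m t0 * (1 / 4 + 1 / 4)"
  proof (rule touching[OF t0 zero_less_one order_refl less_imp_le[OF M], where P = ?P and V = "\<lambda>_. 1 / 4" and \<omega> = \<omega> and A = A and DV = "\<lambda>_. 0" and HV = "\<lambda>_. 0"])
    show "0 < A" "0 < \<omega>" "touching_const CARD('n) p M A < C1" using A \<omega> big by auto
    show "\<And>t x. 0 < t \<Longrightarrow> t \<le> t0 \<Longrightarrow> f t x \<le> m t" by (rule bound)
    show "f t x \<le> m t0 * (1 / 4 + M * 1)" if "t0 - 1 * t0 / 2 \<le> t" "t \<le> t0" for t x
    proof -
      have "f t x \<le> m t" using bound that t0 by auto
      also have "\<dots> \<le> M * m t0" unfolding M_def using that t0 by (intro m_half_le) auto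
      also have "\<dots> \<le> m t0 * (1 / 4 + M * 1)" using m_pos[OF t0(1)] by (simp add: algebra_simps)
      finally show ?thesis .
    qed
    show "(1 + norm x) powr (- \<beta>) \<le> A * \<omega>" if "norm (?P *v (x - x0)) \<le> 1" for x
      using weight that sec by blast
    show "(\<omega> / sqrt t0) ^ CARD('n) \<le> A * 1 ^ CARD('n) * \<bar>det ?P\<bar>"
    proof -
      have "\<omega> / sqrt t0 \<le> 1 / l" using vol l t0 by (simp add: field_simps)
      then have "(\<omega> / sqrt t0) ^ CARD('n) \<le> 1 * (1 / l) ^ CARD('n)" using \<omega> t0 by (simp add: power_mono)
      also have "\<dots> \<le> A * (1 / l) ^ CARD('n)" using A l by (intro mult_right_mono) auto
      finally show ?thesis by (simp add: detP)
    qed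
    show "\<exists>c\<ge>0. (\<forall>\<xi>. \<xi> \<bullet> (0 *v \<xi>) + 2 * M * 1 * (norm (?P *v \<xi>))\<^sup>2 \<le> c * (norm \<xi>)\<^sup>2)
        \<and> c * (1 + norm x) powr (min (2 * \<beta>) 2) \<le> A / t0" if "norm (?P *v (x - x0)) \<le> 1" for x
    proof (intro exI[of _ "2 * M / l\<^sup>2"] conjI allI)
      show "2 * M / l\<^sup>2 * (1 + norm x) powr (min (2 * \<beta>) 2) \<le> A / t0"
        using upper[of x] that sec l t0 by (simp add: field_simps)
    qed (use M l in \<open>auto simp: Pn power_divide\<close>)
  qed auto
  then show ?thesis by simp
qed

text \<open>Outside of this region the weights vary rapidly on the scale of the natural parabolic ball.\<close>

definition slowly_varying :: "real \<Rightarrow> real^'n \<Rightarrow> bool" where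
  "slowly_varying t x \<longleftrightarrow> - 1 \<le> \<beta> \<or> - \<beta> * sqrt t \<le> exp (japanese_bracket \<beta> x)"

lemma half_bound_slowly_varying:
  assumes t0: "0 < t0" "t0 \<le> 1" "t0 \<le> T"
    and big: "touching_const CARD('n) p (2 powr (real CARD('n) / (2 * p))) (half_const CARD('n) p) < C1"
    and bound: "\<And>t x. 0 < t \<Longrightarrow> t \<le> t0 \<Longrightarrow> f t x \<le> m t"
    and sv: "slowly_varying t0 x0"
  shows "f t0 x0 < m t0 / 2"
proof -
  define M where "M = (2::real) powr (real CARD('n) / (2 * p))"
  define A where "A = half_const CARD('n) p"
  define R where "R = 1 + norm x0"
  have R: "1 \<le> R" by (simp add: R_def)
  have M: "1 \<le> M" unfolding M_def using p by (intro ge_one_powr_ge_zero) auto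
  have e1: "1 \<le> exp (2 * exp 3 :: real)" by simp
  have AM: "32 * M \<le> A" "2 * M * exp (2 * exp 3) \<le> A"
    using M e1 by (auto simp: A_def half_const_def M_def[symmetric] mult_left_mono)
  have A: "1 \<le> A" "2 \<le> A" using AM M by auto
  have st: "0 < sqrt t0" "sqrt t0 \<le> 1" "sqrt t0 * sqrt t0 = t0" using t0 by auto
  note hb = half_bound[OF t0 _ A(1) _ big[folded A_def] bound, folded M_def]
  show ?thesis
  proof (cases "0 \<le> \<beta>")
    case True
    \<comment> \<open>The cap matches \<open>min (2 * \<beta>) 2\<close> in the ellipticity bound
      and keeps the radius \<open>l\<close> at most R / 2, so that 1 + |x| stays comparable to
      \<open>R\<close> on the ball.\<close>
    define b where "b = min \<beta> 1"
    have b: "0 \<le> b" "b \<le> 1" "b \<le> \<beta>" using True by (auto simp: b_def)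
    define l where "l = sqrt t0 * R powr b / 2"
    have Rb: "R powr b \<le> R" using powr_mono[OF b(2) R] R by simp
    have lR: "l \<le> R / 2"
      using mult_mono[OF st(2) Rb] st R by (simp add: l_def)
    have l: "0 < l" using st R by (simp add: l_def)
    have near: "R / 2 \<le> 1 + norm x" "1 + norm x \<le> 2 * R" if "norm (x - x0) \<le> l" for x
    proof -
      have "norm x0 - norm x \<le> l" "norm x - norm x0 \<le> l"
        using that norm_triangle_ineq2[of x x0] norm_triangle_ineq2[of x0 x] by (auto simp: norm_minus_commute)
      then show "R / 2 \<le> 1 + norm x" "1 + norm x \<le> 2 * R" using lR R by (auto simp: R_def)
    qed
    show ?thesis
    proof (rule hb[OF l, of "R powr (- b)"])
      show "0 < R powr - b" using R by simp
      fix x assume x: "norm (x - x0) \<le> l"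
      have "(1 + norm x) powr (- \<beta>) \<le> (1 + norm x) powr (- b)" using b by (intro powr_mono) auto
      also have "\<dots> \<le> (R / 2) powr (- b)" using near(1)[OF x] b R by (intro powr_mono2') auto
      also have "\<dots> = 2 powr b * R powr (- b)" using R by (simp add: powr_divide powr_minus_divide)
      also have "\<dots> \<le> A * R powr (- b)"
        using powr_mono[OF b(2), of 2] A by (intro mult_right_mono) auto
      finally show "(1 + norm x) powr (- \<beta>) \<le> A * R powr (- b)" .
      have "(1 + norm x) powr (min (2 * \<beta>) 2) = (1 + norm x) powr (2 * b)" by (simp add: b_def min_def)
      also have "\<dots> \<le> (2 * R) powr (2 * b)" using near(2)[OF x] b by (intro powr_mono2) auto
      also have "\<dots> = 2 powr (2 * b) * R powr (2 * b)" by (rule powr_mult)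
      also have "\<dots> \<le> 2 powr 2 * R powr (2 * b)"
        using b by (intro mult_right_mono powr_mono) auto
      also have "\<dots> = 4 * (R powr b)\<^sup>2" using R by (simp add: powr_add[symmetric] power2_eq_square)
      finally have "2 * M * t0 * (1 + norm x) powr (min (2 * \<beta>) 2) \<le> 2 * M * t0 * (4 * (R powr b)\<^sup>2)"
        using M t0 by (intro mult_left_mono) auto
      also have "\<dots> = 32 * M * l\<^sup>2" using t0 by (simp add: l_def power_mult_distrib power_divide)
      also have "\<dots> \<le> A * l\<^sup>2" using AM by (intro mult_right_mono) auto
      finally show "2 * M * t0 * (1 + norm x) powr (min (2 * \<beta>) 2) \<le> A * l\<^sup>2" .
    next
      show "l * R powr - b \<le> sqrt t0" using R st by (simp add: l_def powr_minus_divide)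
    qed
  next
    case False
    define b where "b = - \<beta>"
    have b: "0 < b" using False by (simp add: b_def)
    define w where "w = R powr b"
    have w: "1 \<le> w" unfolding w_def using R b by (intro ge_one_powr_ge_zero) auto
    define l where "l = sqrt t0 / w"
    have l: "0 < l" using st w by (simp add: l_def)
    \<comment> \<open>Equivalently \<open>b * l \<le> exp 3\<close>: in the slowly varying region
      the natural radius is of at most the order 1 / b on which the weight changes by a bounded
      factor.\<close>
    have bw: "b * sqrt t0 \<le> exp 3 * w"
    proof (cases "b \<le> 1")
      case True
      have "b * sqrt t0 \<le> 1 * 1" using True st b by (intro mult_mono) auto
      also have "\<dots> \<le> exp 3 * w" using w mult_mono[of 1 "exp 3" 1 w] by simp
      finally show ?thesis .
    next
      case False
      then have "b * sqrt t0 \<le> exp (japanese_bracket \<beta> x0)" using sv by (auto simp: slowly_varying_def b_def)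
      moreover have "0 < b * sqrt t0" "b * sqrt t0 \<le> b"
        using mult_pos_pos[OF b st(1)] mult_left_mono[OF st(2), of b] b by auto
      ultimately show ?thesis unfolding w_def R_def using False
        by (intro exp_rho_le_power) (auto simp: japanese_bracket_def b_def)
    qed
    have bl: "b * norm (x - x0) \<le> exp 3" if "norm (x - x0) \<le> l" for x
    proof -
      have "b * norm (x - x0) \<le> b * l" using that b by (intro mult_left_mono) auto
      also have "\<dots> \<le> exp 3" using bw w by (simp add: l_def divide_le_eq)
      finally show ?thesis .
    qed
    show ?thesis
    proof (rule hb[OF l, of w])
      fix x assume x: "norm (x - x0) \<le> l"
      have "(1 + norm x) powr (- \<beta>) \<le> exp (b * norm (x - x0)) * w"
        using power_weight_lipschitz[of b x x0] b by (simp add: b_def w_def R_def)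
      also have "\<dots> \<le> exp (2 * exp 3) * w"
        using bl[OF x] w by (intro mult_right_mono) (auto intro: order_trans[of _ "exp 3"])
      also have "\<dots> \<le> A * w"
      proof (rule mult_right_mono)
        have "exp (2 * exp 3) \<le> 2 * M * exp (2 * exp 3 :: real)" using M by simp
        then show "exp (2 * exp 3) \<le> A" using AM(2) by (rule order_trans)
      qed (use w in simp)
      finally show "(1 + norm x) powr (- \<beta>) \<le> A * w" .
      define y where "y = (1 + norm x) powr b"
      have y: "0 < y" by (simp add: y_def add_pos_nonneg pos_add_strict less_imp_neq[symmetric])
      have "w \<le> exp (b * norm (x - x0)) * y"
        using power_weight_lipschitz[of b x0 x] b by (simp add: w_def R_def y_def norm_minus_commute)
      also have "\<dots> \<le> exp (exp 3) * y" using bl[OF x] y by (intro mult_right_mono) auto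
      finally have wy: "w\<^sup>2 \<le> (exp (exp 3) * y)\<^sup>2" using w by (intro power_mono) auto
      have "min (2 * \<beta>) 2 = - (b + b)" using False by (simp add: b_def)
      then have "(1 + norm x) powr (min (2 * \<beta>) 2) = 1 / y\<^sup>2"
        by (simp only: powr_minus_divide powr_add y_def power2_eq_square)
      also have "\<dots> \<le> exp (2 * exp 3) / w\<^sup>2"
        using wy y w by (simp add: field_simps power_mult_distrib flip: exp_double)
      finally have "2 * M * t0 * (1 + norm x) powr (min (2 * \<beta>) 2) \<le> 2 * M * t0 * (exp (2 * exp 3) / w\<^sup>2)"
        using M t0 by (intro mult_left_mono) auto
      also have "\<dots> = (2 * M * exp (2 * exp 3)) * l\<^sup>2" using t0 by (simp add: l_def power_divide)
      also have "\<dots> \<le> A * l\<^sup>2" using AM by (intro mult_right_mono) auto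
      finally show "2 * M * t0 * (1 + norm x) powr (min (2 * \<beta>) 2) \<le> A * l\<^sup>2" .
    qed (use w in \<open>auto simp: l_def\<close>)
  qed
qed

end

section \<open>Powers of the exponential of the Japanese bracket\<close>

definition outer_product :: "real^'n \<Rightarrow> real^'n^'n" where
  "outer_product x = (\<chi> i j. x $ i * x $ j)"

lemma outer_product_mult: "outer_product x *v v = (x \<bullet> v) *\<^sub>R x"
  by (simp add: outer_product_def vec_eq_iff matrix_vector_mult_def inner_vec_def sum_distrib_left
      sum_distrib_right mult_ac)

lemma outer_product_congruence: "transpose R ** outer_product n ** R = outer_product (transpose R *v n)"
proof -
  have "(transpose R ** outer_product n ** R) *v x = outer_product (transpose R *v n) *v x" for x
  proof -
    have "(transpose R *v n) \<bullet> x = n \<bullet> (R *v x)"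
      by (metis dot_lmul_matrix transpose_matrix_vector)
    then show ?thesis
      by (simp add: matrix_vector_mul_assoc[symmetric] outer_product_mult matrix_vector_mult_scaleR
          del: transpose_matrix_vector)
  qed
  then show ?thesis by (simp add: matrix_eq)
qed

text \<open>A rotation taking a multiple of a coordinate vector to \<open>n\<close> makes the matrix
  diagonal, with \<open>s\<close> occurring d - 1 times.\<close>

lemma det_scaled_identity_plus_outer_product:
  fixes n :: "real^'n"
  shows "det (s *\<^sub>R mat 1 + outer_product n) = s ^ (CARD('n) - 1) * (s + (norm n)\<^sup>2)"
proof -
  define k :: 'n where "k = undefined"
  have "norm (norm n *\<^sub>R axis k 1 :: real^'n) = norm n" by simp
  then obtain g where g: "orthogonal_transformation g" "g (norm n *\<^sub>R (axis k 1 :: real^'n)) = n"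
    by (rule orthogonal_transformation_exists)
  define R where "R = matrix g"
  have R: "orthogonal_matrix R" "R *v (norm n *\<^sub>R axis k 1) = n"
    using g(2) orthogonal_transformation_linear[OF g(1)]
      orthogonal_transformation_matrix[of g] g(1) by (simp_all add: R_def)
  have RR: "transpose R ** R = mat 1" using R(1) by (simp add: orthogonal_matrix_def)
  have Rn: "transpose R *v n = norm n *\<^sub>R axis k 1"
    using arg_cong[OF R(2), of "\<lambda>v. transpose R *v v"]
    by (simp add: matrix_vector_mul_assoc RR del: transpose_matrix_vector)
  let ?D = "s *\<^sub>R mat 1 + outer_product (norm n *\<^sub>R axis k 1) :: real^'n^'n"
  have "transpose R ** (s *\<^sub>R mat 1 + outer_product n) ** R = ?D"
  proof -
    have "(transpose R ** (s *\<^sub>R mat 1 + outer_product n) ** R) *v v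
        = s *\<^sub>R ((transpose R ** R) *v v) + (transpose R ** outer_product n ** R) *v v" for v
      by (simp only: matrix_vector_mul_assoc[symmetric] matrix_vector_mult_add_rdistrib
          matrix_vector_right_distrib matrix_vector_mult_scaleR scaleR_matrix_vector_assoc[symmetric] matrix_vector_mul_lid)
    then show ?thesis
      by (simp only: matrix_eq RR outer_product_congruence Rn matrix_vector_mult_add_rdistrib
          scaleR_matrix_vector_assoc[symmetric]) simp
  qed
  then have "det (transpose R) * det (s *\<^sub>R mat 1 + outer_product n) * det R = det ?D"
    by (metis det_mul)
  moreover have "det (transpose R) * det R = 1" by (metis RR det_mul det_I)
  ultimately have "det (s *\<^sub>R mat 1 + outer_product n) = det ?D" by (simp add: mult_ac) (metis mult.assoc mult.commute mult_1)
  also have "det ?D = (\<Prod>i\<in>UNIV. ?D $ i $ i)"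
    by (rule det_diagonal) (auto simp: mat_def outer_product_def axis_def)
  also have "\<dots> = (\<Prod>i\<in>UNIV. if i = k then s + (norm n)\<^sup>2 else s)"
    by (intro prod.cong refl) (auto simp: mat_def outer_product_def axis_def power2_eq_square)
  also have "\<dots> = (s + (norm n)\<^sup>2) * (\<Prod>i\<in>UNIV - {k}. s)"
    by (subst prod.remove[of UNIV k]) auto
  finally show ?thesis by (simp add: card_Diff_singleton mult.commute)
qed

lemma det_scaleR: "det (c *\<^sub>R A) = c ^ CARD('n) * det A" for A :: "real^'n^'n"
  by (simp add: det_def prod.distrib sum_distrib_left mult_ac)

section \<open>The Japanese bracket, its exponential and the comparison with the weight\<close>

lemma japanese_bracket_ge_1: "1 \<le> japanese_bracket b x"
  by (simp add: japanese_bracket_def)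

lemma japanese_bracket_sq: "(japanese_bracket b x)\<^sup>2 = 1 + (b * norm x)\<^sup>2"
  by (simp add: japanese_bracket_def add_nonneg_nonneg)

lemma japanese_bracket_derivative:
  fixes x :: "'a::real_inner"
  shows "(japanese_bracket b has_derivative (\<lambda>v. b\<^sup>2 / japanese_bracket b x * (x \<bullet> v))) (at x)"
proof -
  have eq: "japanese_bracket b = (\<lambda>x::'a. sqrt (1 + b\<^sup>2 * (x \<bullet> x)))"
    by (simp add: fun_eq_iff japanese_bracket_def power_mult_distrib power2_norm_eq_inner)
  have pos: "0 < 1 + b\<^sup>2 * (x \<bullet> x)" by (simp add: add_pos_nonneg)
  have "((\<lambda>x::'a. 1 + b\<^sup>2 * (x \<bullet> x)) has_derivative (\<lambda>v. b\<^sup>2 * (2 * (x \<bullet> v)))) (at x)"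
    by (auto intro!: derivative_eq_intros simp: inner_commute)
  from has_derivative_real_sqrt[OF pos this] show ?thesis
    unfolding eq by (rule has_derivative_eq_rhs) (simp add: fun_eq_iff field_simps)
qed

definition bracket_grad :: "real \<Rightarrow> real \<Rightarrow> real^'n \<Rightarrow> real^'n" where
  "bracket_grad \<sigma> b x = (\<sigma> * b\<^sup>2 * exp (\<sigma> * japanese_bracket b x) / japanese_bracket b x) *\<^sub>R x"

definition bracket_hess :: "real \<Rightarrow> real \<Rightarrow> real^'n \<Rightarrow> real^'n^'n" where
  "bracket_hess \<sigma> b x = (\<sigma> * b\<^sup>2 * exp (\<sigma> * japanese_bracket b x) / japanese_bracket b x) *\<^sub>R
     (mat 1 + (b\<^sup>2 / japanese_bracket b x * (\<sigma> - 1 / japanese_bracket b x)) *\<^sub>R outer_product x)"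

lemma bracket_grad:
  "((\<lambda>x. exp (\<sigma> * japanese_bracket b x)) has_derivative (\<lambda>v. bracket_grad \<sigma> b x \<bullet> v)) (at x)"
proof -
  show ?thesis
    by (rule has_derivative_eq_rhs[OF has_derivative_exp[OF has_derivative_mult_right[OF japanese_bracket_derivative]]])
       (simp add: fun_eq_iff bracket_grad_def mult_ac)
qed

lemma bracket_hess:
  "(bracket_grad \<sigma> b has_derivative (\<lambda>v. bracket_hess \<sigma> b x *v v)) (at x)"
proof -
  let ?r = "japanese_bracket b"
  have r: "?r x \<noteq> 0" using japanese_bracket_ge_1[of b x] by linarith
  have "((\<lambda>x. \<sigma> * b\<^sup>2 * exp (\<sigma> * ?r x) / ?r x) has_derivative
      (\<lambda>v. (- (\<sigma> * b\<^sup>2 * exp (\<sigma> * ?r x)) * (inverse (?r x) * (b\<^sup>2 / ?r x * (x \<bullet> v)) * inverse (?r x))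
        + \<sigma> * b\<^sup>2 * (bracket_grad \<sigma> b x \<bullet> v) / ?r x))) (at x)"
    by (rule has_derivative_divide[OF has_derivative_mult_right[OF bracket_grad] japanese_bracket_derivative r])
  from has_derivative_scaleR[OF this has_derivative_ident]
  show ?thesis unfolding bracket_grad_def[abs_def]
    by (rule has_derivative_eq_rhs)
       (simp add: fun_eq_iff bracket_hess_def bracket_grad_def matrix_vector_mult_add_rdistrib
         scaleR_matrix_vector_assoc[symmetric] outer_product_mult field_simps scaleR_add_left[symmetric]
         scaleR_left_diff_distrib r power2_eq_square)
qed

text \<open>Radially the square of the gradient of the bracket supplies a factor \<sigma>^2; across,
  its Hessian supplies \<sigma> / r. This convexity becomes the concavity of the background that a
  paraboloid may use up.\<close>

lemma bracket_hess_lower: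
  assumes \<sigma>: "0 < \<sigma>" "\<sigma> \<le> 1"
  shows "\<sigma>\<^sup>2 / 2 * b\<^sup>2 * exp (\<sigma> * japanese_bracket b x) *
      ((b * (x \<bullet> \<xi>) / japanese_bracket b x)\<^sup>2 + (norm \<xi>)\<^sup>2 / japanese_bracket b x)
    \<le> \<xi> \<bullet> (bracket_hess \<sigma> b x *v \<xi>)"
proof -
  define r where "r = japanese_bracket b x"
  have r: "1 \<le> r" by (simp add: r_def japanese_bracket_ge_1)
  define S where "S = (b * (x \<bullet> \<xi>) / r)\<^sup>2"
  define c where "c = \<sigma> * b\<^sup>2 * exp (\<sigma> * r)"
  have c: "0 \<le> c" using \<sigma> by (simp add: c_def)
  have S: "0 \<le> S" "S \<le> (norm \<xi>)\<^sup>2"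
  proof -
    have "(x \<bullet> \<xi>)\<^sup>2 \<le> (norm x)\<^sup>2 * (norm \<xi>)\<^sup>2"
      using Cauchy_Schwarz_ineq[of x \<xi>] by (simp add: power2_norm_eq_inner)
    then have "b\<^sup>2 * (x \<bullet> \<xi>)\<^sup>2 \<le> b\<^sup>2 * ((norm x)\<^sup>2 * (norm \<xi>)\<^sup>2)" by (rule mult_left_mono) simp
    also have "\<dots> = (r\<^sup>2 - 1) * (norm \<xi>)\<^sup>2" by (simp add: r_def japanese_bracket_sq power_mult_distrib)
    also have "\<dots> \<le> r\<^sup>2 * (norm \<xi>)\<^sup>2" by (intro mult_right_mono) auto
    finally show "S \<le> (norm \<xi>)\<^sup>2" using r by (simp add: S_def power_divide power_mult_distrib divide_le_eq mult_ac)
  qed (simp add: S_def)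
  have "\<xi> \<bullet> (bracket_hess \<sigma> b x *v \<xi>) = c / r * ((norm \<xi>)\<^sup>2 + b\<^sup>2 / r * (\<sigma> - 1 / r) * (x \<bullet> \<xi>)\<^sup>2)"
    unfolding bracket_hess_def r_def[symmetric] c_def[symmetric] scaleR_matrix_vector_assoc[symmetric]
      matrix_vector_mult_add_rdistrib outer_product_mult matrix_vector_mul_lid inner_scaleR_right inner_add_right
    by (simp add: dot_square_norm inner_commute power2_eq_square)
  also have "\<dots> = c * ((norm \<xi>)\<^sup>2 / r + (\<sigma> - 1 / r) * S)"
    using r by (simp add: S_def field_simps power2_eq_square)
  also have "\<dots> \<ge> c * (\<sigma> / 2 * (S + (norm \<xi>)\<^sup>2 / r))"
  proof (intro mult_left_mono c)
    define \<tau> where "\<tau> = (norm \<xi>)\<^sup>2 - S"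
    have \<tau>: "0 \<le> \<tau>" "(norm \<xi>)\<^sup>2 = S + \<tau>" using S by (auto simp: \<tau>_def)
    have "0 \<le> \<sigma> * S / 2 * (1 - 1 / r) + \<tau> / r * (1 - \<sigma> / 2)"
      using \<sigma> r S \<tau> by (intro add_nonneg_nonneg mult_nonneg_nonneg divide_nonneg_nonneg) auto
    also have "\<dots> = ((norm \<xi>)\<^sup>2 / r + (\<sigma> - 1 / r) * S) - \<sigma> / 2 * (S + (norm \<xi>)\<^sup>2 / r)"
      using r by (simp add: \<tau>(2) field_simps)
    finally show "\<sigma> / 2 * (S + (norm \<xi>)\<^sup>2 / r) \<le> (norm \<xi>)\<^sup>2 / r + (\<sigma> - 1 / r) * S" by simp
  qed
  finally show ?thesis by (simp add: c_def r_def S_def power2_eq_square mult_ac)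
qed

text \<open>The hypothesis confines |x| to the order 1 / sqrt b, where b times the quadratic error
  in ln (1 + |x|) stays bounded.\<close>

lemma exp_bracket_le_weight:
  assumes b: "1 \<le> b" and le: "japanese_bracket b x \<le> ln b + 3"
  shows "exp (japanese_bracket b x) \<le> exp 6 * (1 + norm x) powr b"
proof -
  let ?r = "norm x"
  have br: "b * ?r \<le> japanese_bracket b x" "japanese_bracket b x \<le> 1 + b * ?r"
    using b by (auto simp: japanese_bracket_def real_le_rsqrt intro: sqrt_one_plus_square_le)
  have lb: "ln b + 3 \<le> 3 * sqrt b"
    using ln_le_sqrt[OF b] b real_sqrt_ge_one[OF b] by linarith
  have "(b * ?r)\<^sup>2 \<le> (3 * sqrt b)\<^sup>2" using br le lb b by (intro power_mono) auto
  also have "\<dots> = b * 9" using b by (simp add: power_mult_distrib)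
  also have "(b * ?r)\<^sup>2 = b * (b * ?r\<^sup>2)" by (simp add: power2_eq_square)
  finally have "b * ?r\<^sup>2 \<le> 9" using b by (simp only: mult_le_cancel_left_pos)
  moreover have "b * (?r - ?r\<^sup>2 / 2) \<le> b * ln (1 + ?r)" using b by (intro mult_left_mono ln_one_plus_ge) auto
  ultimately have "japanese_bracket b x \<le> 6 + b * ln (1 + ?r)" using br(2) by (simp add: right_diff_distrib)
  then have "exp (japanese_bracket b x) \<le> exp (6 + b * ln (1 + ?r))" by simp
  also have "\<dots> = exp 6 * (1 + ?r) powr b"
    by (simp add: exp_add powr_def add_nonneg_eq_0_iff)
  finally show ?thesis .
qed

lemma weight_le_exp_bracket:
  assumes b: "0 \<le> b"
  shows "(1 + norm x) powr b \<le> exp (japanese_bracket b x)"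
proof -
  have "(1 + norm x) powr b = exp (b * ln (1 + norm x))"
    by (simp add: powr_def add_nonneg_eq_0_iff)
  also have "b * ln (1 + norm x) \<le> b * norm x"
    using b by (intro mult_left_mono ln_add_one_self_le_self) auto
  also have "b * norm x \<le> japanese_bracket b x"
    by (simp add: japanese_bracket_def real_le_rsqrt)
  finally show ?thesis by simp
qed

text \<open>The vector \<open>n\<close> is the gradient of the bracket at \<open>x0\<close> divided
  by \<open>b\<close>. The ellipsoid of \<open>P\<close> has half-width at most 1 / |b| along
  \<open>n\<close> and 1 / (|b| s) across. The lower bound on \<open>s\<close> keeps the bracket
  within 3 of its value at the centre, so that its exponential changes by a bounded factor
  only.\<close>

context
  fixes b s :: real and x0 n :: "real^'n" and r0 :: real and P :: "real^'n^'n"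
  defines "r0 \<equiv> japanese_bracket b x0"
    and "n \<equiv> (b / r0) *\<^sub>R x0"
    and "P \<equiv> b *\<^sub>R (s *\<^sub>R mat 1 + outer_product n)"
  assumes b: "b \<noteq> 0" and s: "0 < s" "1 / r0 \<le> s\<^sup>2"
begin

text \<open>Near the origin \<open>n\<close> degenerates, but there r0 is close to 1 and the bound
  on \<open>s\<close> takes over: s \<ge> 1 / r0 \<ge> 1 / r0^2 = 1 - |n|^2.\<close>

lemma section_direction: "(norm n)\<^sup>2 = 1 - 1 / r0\<^sup>2" "norm n \<le> 1" "1 \<le> s + (norm n)\<^sup>2"
proof -
  have r0: "1 \<le> r0" by (simp add: r0_def japanese_bracket_ge_1)
  have "(norm n)\<^sup>2 = (b * norm x0)\<^sup>2 / r0\<^sup>2"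
    by (simp add: n_def power_mult_distrib power_divide)
  also have "(b * norm x0)\<^sup>2 = r0\<^sup>2 - 1" by (simp add: r0_def japanese_bracket_sq)
  finally show n: "(norm n)\<^sup>2 = 1 - 1 / r0\<^sup>2" using r0 by (simp add: diff_divide_distrib)
  have "(norm n)\<^sup>2 \<le> 1\<^sup>2" using n by simp
  then show "norm n \<le> 1" by (rule power2_le_imp_le) simp
  have "1 / r0\<^sup>2 \<le> 1 / r0" using r0 by (simp add: field_simps power2_eq_square)
  then have "(1 / r0)\<^sup>2 \<le> s\<^sup>2" using s(2) by (simp add: power_divide)
  then have "1 / r0 \<le> s" by (rule power2_le_imp_le) (use s in simp)
  then show "1 \<le> s + (norm n)\<^sup>2" using n \<open>1 / r0\<^sup>2 \<le> 1 / r0\<close> by linarith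
qed

lemma section_mult: "P *v y = b *\<^sub>R (s *\<^sub>R y + (n \<bullet> y) *\<^sub>R n)"
  by (simp add: P_def scaleR_matrix_vector_assoc[symmetric] matrix_vector_mult_add_rdistrib outer_product_mult)

lemma section_norm_le: "(norm (P *v y))\<^sup>2 \<le> 2 * b\<^sup>2 * (s\<^sup>2 * (norm y)\<^sup>2 + (n \<bullet> y)\<^sup>2)"
proof -
  have "norm (s *\<^sub>R y + (n \<bullet> y) *\<^sub>R n) \<le> s * norm y + \<bar>n \<bullet> y\<bar> * norm n"
    using s by (intro norm_triangle_le) simp
  also have "\<dots> \<le> s * norm y + \<bar>n \<bullet> y\<bar> * 1" using section_direction by (intro add_left_mono mult_left_mono) auto
  finally have "(norm (s *\<^sub>R y + (n \<bullet> y) *\<^sub>R n))\<^sup>2 \<le> (s * norm y + \<bar>n \<bullet> y\<bar>)\<^sup>2" by (intro power_mono) auto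
  also have "\<dots> \<le> 2 * ((s * norm y)\<^sup>2 + \<bar>n \<bullet> y\<bar>\<^sup>2)"
    using sum_squares_bound[of "s * norm y" "\<bar>n \<bullet> y\<bar>"] by (simp add: power2_sum)
  finally have "b\<^sup>2 * (norm (s *\<^sub>R y + (n \<bullet> y) *\<^sub>R n))\<^sup>2 \<le> b\<^sup>2 * (2 * ((s * norm y)\<^sup>2 + \<bar>n \<bullet> y\<bar>\<^sup>2))"
    by (rule mult_left_mono) simp
  moreover have "(norm (P *v y))\<^sup>2 = b\<^sup>2 * (norm (s *\<^sub>R y + (n \<bullet> y) *\<^sub>R n))\<^sup>2"
    by (simp only: section_mult norm_scaleR power_mult_distrib power2_abs)
  ultimately show ?thesis by (simp add: power_mult_distrib distrib_left mult_ac)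
qed

lemma section_det: "\<bar>b\<bar> ^ CARD('n) * s ^ (CARD('n) - 1) \<le> \<bar>det P\<bar>"
proof -
  have "\<bar>det P\<bar> = \<bar>b\<bar> ^ CARD('n) * (s ^ (CARD('n) - 1) * (s + (norm n)\<^sup>2))"
    using s by (simp add: P_def det_scaleR det_scaled_identity_plus_outer_product abs_mult power_abs)
  moreover have "s ^ (CARD('n) - 1) * 1 \<le> s ^ (CARD('n) - 1) * (s + (norm n)\<^sup>2)"
    using s section_direction by (intro mult_left_mono) auto
  ultimately show ?thesis by (simp add: mult_left_mono)
qed

text \<open>The first bound uses that s I + n n^T maps \<open>n\<close> to its multiple by s + |n|^2
  \<ge> 1, the second that the form of this matrix is at least s |y|^2.\<close>

lemma section_size:
  assumes y: "norm (P *v y) \<le> 1"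
  shows "\<bar>n \<bullet> y\<bar> * \<bar>b\<bar> \<le> 1" "b\<^sup>2 * (norm y)\<^sup>2 \<le> r0"
proof -
  let ?q = "s *\<^sub>R y + (n \<bullet> y) *\<^sub>R n"
  have q: "\<bar>b\<bar> * norm ?q \<le> 1" using y by (simp add: section_mult)
  have "(s + (norm n)\<^sup>2) * \<bar>n \<bullet> y\<bar> = \<bar>n \<bullet> ?q\<bar>"
    using section_direction(3)
    by (simp add: inner_add_right power2_norm_eq_inner abs_mult[symmetric] algebra_simps
        abs_of_nonneg[symmetric] del: abs_of_nonneg) (metis (no_types) abs_mult abs_of_nonneg distrib_right mult.commute order_trans zero_le_one)
  also have "\<dots> \<le> norm n * norm ?q" by (rule Cauchy_Schwarz_ineq2)
  also have "\<dots> \<le> 1 * norm ?q" using section_direction by (intro mult_right_mono) auto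
  finally have "(s + (norm n)\<^sup>2) * \<bar>n \<bullet> y\<bar> \<le> norm ?q" by simp
  moreover have "1 * \<bar>n \<bullet> y\<bar> \<le> (s + (norm n)\<^sup>2) * \<bar>n \<bullet> y\<bar>"
    using section_direction by (intro mult_right_mono) auto
  ultimately have "\<bar>n \<bullet> y\<bar> \<le> norm ?q" by linarith
  then show "\<bar>n \<bullet> y\<bar> * \<bar>b\<bar> \<le> 1" using q mult_left_mono[of "\<bar>n \<bullet> y\<bar>" "norm ?q" "\<bar>b\<bar>"] by (simp add: mult.commute)
  have "s * (norm y)\<^sup>2 \<le> y \<bullet> ?q"
    by (simp add: inner_add_right power2_norm_eq_inner inner_commute)
  also have "\<dots> \<le> norm y * norm ?q" by (rule norm_cauchy_schwarz)
  finally have "s * norm y \<le> norm ?q"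
    by (cases "norm y = 0") (auto simp: power2_eq_square mult_ac)
  then have "\<bar>b\<bar> * (s * norm y) \<le> 1" using q mult_left_mono[of "s * norm y" "norm ?q" "\<bar>b\<bar>"] by simp
  then have "(\<bar>b\<bar> * (s * norm y))\<^sup>2 \<le> 1" using s by (intro power_le_one) auto
  then have "s\<^sup>2 * (b\<^sup>2 * (norm y)\<^sup>2) \<le> 1" by (simp add: power_mult_distrib mult_ac)
  moreover have "1 / r0 * (b\<^sup>2 * (norm y)\<^sup>2) \<le> s\<^sup>2 * (b\<^sup>2 * (norm y)\<^sup>2)"
    using s by (intro mult_right_mono) auto
  ultimately have "1 / r0 * (b\<^sup>2 * (norm y)\<^sup>2) \<le> 1" by linarith
  then show "b\<^sup>2 * (norm y)\<^sup>2 \<le> r0"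
    using japanese_bracket_ge_1[of b x0] by (simp add: r0_def[symmetric] divide_le_eq)
qed

text \<open>In the expansion of the squared bracket around \<open>x0\<close> the linear term is at
  most 2 r0 in absolute value and the quadratic one at most r0; after taking roots this is an
  additive constant.\<close>

lemma section_bracket:
  assumes y: "norm (P *v (x - x0)) \<le> 1"
  shows "japanese_bracket b x \<le> r0 + 3" "r0 \<le> japanese_bracket b x + 3"
proof -
  define r where "r = japanese_bracket b x"
  have r: "1 \<le> r" "1 \<le> r0" by (auto simp: r_def r0_def japanese_bracket_ge_1)
  note sz = section_size[OF y]
  have "r\<^sup>2 - r0\<^sup>2 = b\<^sup>2 * ((norm x)\<^sup>2 - (norm x0)\<^sup>2)"
    by (simp add: r_def r0_def japanese_bracket_sq power_mult_distrib algebra_simps)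
  also have "(norm x)\<^sup>2 - (norm x0)\<^sup>2 = 2 * (x0 \<bullet> (x - x0)) + (norm (x - x0))\<^sup>2"
    by (simp add: power2_norm_eq_inner inner_diff inner_commute)
  also have "b\<^sup>2 * (2 * (x0 \<bullet> (x - x0)) + (norm (x - x0))\<^sup>2)
      = 2 * r0 * (b * (n \<bullet> (x - x0))) + b\<^sup>2 * (norm (x - x0))\<^sup>2"
    using r by (simp add: n_def power2_eq_square algebra_simps)
  finally have eq: "r\<^sup>2 - r0\<^sup>2 = 2 * r0 * (b * (n \<bullet> (x - x0))) + b\<^sup>2 * (norm (x - x0))\<^sup>2" .
  have "\<bar>b * (n \<bullet> (x - x0))\<bar> \<le> 1" using sz(1) by (simp add: abs_mult mult.commute)
  then have "\<bar>2 * r0 * (b * (n \<bullet> (x - x0)))\<bar> \<le> 2 * r0 * 1"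
    using r by (simp add: abs_mult mult_left_mono)
  moreover have "0 \<le> b\<^sup>2 * (norm (x - x0))\<^sup>2" by simp
  ultimately have "r\<^sup>2 \<le> r0\<^sup>2 + 3 * r0" "r0\<^sup>2 - 2 * r0 \<le> r\<^sup>2" using eq sz(2) by linarith+
  then have "r\<^sup>2 \<le> (r0 + 3)\<^sup>2" "r0\<^sup>2 \<le> (r + 3)\<^sup>2"
  proof -
    show "r\<^sup>2 \<le> (r0 + 3)\<^sup>2" using \<open>r\<^sup>2 \<le> r0\<^sup>2 + 3 * r0\<close> r by (simp add: power2_sum)
    show "r0\<^sup>2 \<le> (r + 3)\<^sup>2"
    proof (rule ccontr)
      assume "\<not> ?thesis"
      then have "(r + 3)\<^sup>2 < r0\<^sup>2" by simp
      then have "r + 3 < r0" using r by (metis less_eq_real_def linorder_not_le power_mono add_nonneg_nonneg zero_le_numeral order_trans zero_le_one)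
      then have "(r0 - 2) * r0 \<ge> (r + 1) * (r + 3)" using r by (intro mult_mono) auto
      then show False using \<open>r0\<^sup>2 - 2 * r0 \<le> r\<^sup>2\<close> r by (simp add: power2_eq_square algebra_simps)
    qed
  qed
  then show "japanese_bracket b x \<le> r0 + 3" "r0 \<le> japanese_bracket b x + 3"
    using r by (auto simp: r_def[symmetric] intro: power2_le_imp_le)
qed

text \<open>Moves the form in \<open>bracket_hess_lower\<close> from \<open>x\<close> to the centre.
  The difference of the radial terms is controlled by |\<xi>|^2 / r0, and r \<le> r0 + 3 \<le> 4 r0
  accounts for the constant 32 = 2 * 4^2.\<close>

lemma section_form_le:
  assumes y: "norm (P *v (x - x0)) \<le> 1"
  shows "(n \<bullet> \<xi>)\<^sup>2 + (norm \<xi>)\<^sup>2 / r0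
    \<le> 32 * ((b * (x \<bullet> \<xi>) / japanese_bracket b x)\<^sup>2 + (norm \<xi>)\<^sup>2 / japanese_bracket b x)"
proof -
  define r where "r = japanese_bracket b x"
  have r: "1 \<le> r" "1 \<le> r0" by (auto simp: r_def r0_def japanese_bracket_ge_1)
  have r4: "r \<le> 4 * r0" using section_bracket(1)[OF y] r by (simp add: r_def)
  define X where "X = b * (x \<bullet> \<xi>)"
  define Y where "Y = b * ((x - x0) \<bullet> \<xi>)"
  have "n \<bullet> \<xi> = (X - Y) / r0" by (simp add: n_def X_def Y_def inner_diff_left algebra_simps)
  then have "(n \<bullet> \<xi>)\<^sup>2 = (X - Y)\<^sup>2 / r0\<^sup>2" by (simp add: power_divide)
  also have "\<dots> \<le> (2 * X\<^sup>2 + 2 * Y\<^sup>2) / r0\<^sup>2"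
  proof (rule divide_right_mono)
    have "0 \<le> (X + Y)\<^sup>2" by simp
    then show "(X - Y)\<^sup>2 \<le> 2 * X\<^sup>2 + 2 * Y\<^sup>2" by (simp add: power2_diff power2_sum)
  qed simp
  also have "\<dots> = 2 * (X / r0)\<^sup>2 + 2 * (Y\<^sup>2 / r0\<^sup>2)" by (simp add: power_divide add_divide_distrib)
  also have "Y\<^sup>2 / r0\<^sup>2 \<le> (norm \<xi>)\<^sup>2 / r0"
  proof -
    have "((x - x0) \<bullet> \<xi>)\<^sup>2 \<le> (norm (x - x0))\<^sup>2 * (norm \<xi>)\<^sup>2"
      using Cauchy_Schwarz_ineq[of "x - x0" \<xi>] by (simp add: power2_norm_eq_inner)
    then have "Y\<^sup>2 \<le> b\<^sup>2 * ((norm (x - x0))\<^sup>2 * (norm \<xi>)\<^sup>2)"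
      unfolding Y_def power_mult_distrib by (rule mult_left_mono) simp
    also have "\<dots> \<le> r0 * (norm \<xi>)\<^sup>2"
      using mult_right_mono[OF section_size(2)[OF y], of "(norm \<xi>)\<^sup>2"] by (simp add: mult_ac)
    finally have "Y\<^sup>2 / r0\<^sup>2 \<le> r0 * (norm \<xi>)\<^sup>2 / r0\<^sup>2" by (rule divide_right_mono) simp
    then show ?thesis using r by (simp add: power2_eq_square)
  qed
  finally have 1: "(n \<bullet> \<xi>)\<^sup>2 + (norm \<xi>)\<^sup>2 / r0 \<le> 2 * (X / r0)\<^sup>2 + 3 * ((norm \<xi>)\<^sup>2 / r0)" by simp
  have "(X / r0)\<^sup>2 \<le> 16 * (X / r)\<^sup>2"
  proof -
    have "r\<^sup>2 \<le> (4 * r0)\<^sup>2" using r4 r by (intro power_mono) auto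
    then have "X\<^sup>2 * r\<^sup>2 \<le> X\<^sup>2 * (16 * r0\<^sup>2)" by (intro mult_left_mono) (auto simp: power_mult_distrib)
    then show ?thesis using r by (simp add: power_divide field_simps)
  qed
  moreover have "(norm \<xi>)\<^sup>2 / r0 \<le> 4 * ((norm \<xi>)\<^sup>2 / r)"
  proof -
    have "(norm \<xi>)\<^sup>2 * r \<le> (norm \<xi>)\<^sup>2 * (4 * r0)" using r4 by (intro mult_left_mono) auto
    then show ?thesis using r by (simp add: field_simps)
  qed
  moreover have "0 \<le> (norm \<xi>)\<^sup>2 / r" using r by simp
  ultimately show ?thesis using 1 by (simp add: r_def[symmetric] X_def[symmetric])
qed

end

section \<open>Rapidly varying weights\<close>

lemma japanese_bracket_minus: "japanese_bracket (- b) x = japanese_bracket b x"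
  by (simp add: japanese_bracket_def)

text \<open>The 1/4 pays for the \<theta> / 4 that is taken off the background; the rest bounds the
  relative growth of m across the window per unit of \<theta>.\<close>

definition fast_M :: "nat \<Rightarrow> real \<Rightarrow> real" where
  "fast_M d p = 1 / 4 + real d / (2 * p) * exp (real d / (2 * p))"

definition fast_exponent :: "nat \<Rightarrow> real" where
  "fast_exponent d = 2 / (real d + 1)"

text \<open>Chosen so that the concavity of the background cancels exactly the part of the
  paraboloid's convexity that exceeds the natural size.\<close>

definition fast_eps :: "nat \<Rightarrow> real \<Rightarrow> real" where
  "fast_eps d p = exp (- 3) / 2 * (fast_exponent d)\<^sup>2 * exp (- 3) / (256 * fast_M d p)"

text \<open>The first summand serves the curvature condition of \<open>touching\<close>, the second
  the volume condition.\<close>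

definition fast_A :: "nat \<Rightarrow> real \<Rightarrow> real" where
  "fast_A d p = 4 * fast_M d p * exp 18 + fast_eps d p powr (- ((real d + 1) / 2))"

context degenerate_parabolic
begin

lemma m_window_le:
  assumes t: "0 < t0" "t0 - \<theta> * t0 / 2 \<le> t" "t \<le> t0" and \<theta>: "0 \<le> \<theta>" "\<theta> \<le> 1"
  shows "m t \<le> m t0 * (1 + real CARD('n) / (2 * p) * exp (real CARD('n) / (2 * p)) * \<theta>)"
proof -
  define e where "e = real CARD('n) / (2 * p)"
  have e: "0 \<le> e" using p by (simp add: e_def)
  define q where "q = t / t0"
  have q: "1 - \<theta> / 2 \<le> q" using t by (simp add: q_def field_simps)
  then have q2: "1 / 2 \<le> q" using \<theta> by linarith
  have "- ln q \<le> 1 / q - 1"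
    using ln_le_minus_one[of "1 / q"] q2 by (simp add: ln_div)
  also have "\<dots> = (1 - q) / q" using q2 by (simp add: field_simps)
  also have "\<dots> \<le> (\<theta> / 2) / (1 / 2)" using q q2 \<theta> by (intro frac_le) auto
  finally have lnq: "- ln q \<le> \<theta>" by simp
  have "q powr (- e) = exp (e * (- ln q))" using q2 by (simp add: powr_def)
  also have "\<dots> \<le> exp (e * \<theta>)" using mult_left_mono[OF lnq e] by (simp only: exp_le_cancel_iff)
  also have "\<dots> \<le> 1 + e * \<theta> * exp (e * \<theta>)"
  proof -
    have "(1 - e * \<theta>) * exp (e * \<theta>) \<le> exp (- (e * \<theta>)) * exp (e * \<theta>)"
      using exp_ge_add_one_self[of "- (e * \<theta>)"] by (intro mult_right_mono) auto
    also have "\<dots> = 1" by (simp flip: exp_add)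
    finally show ?thesis by (simp add: left_diff_distrib)
  qed
  also have "\<dots> \<le> 1 + e * \<theta> * exp e"
    using e \<theta> by (intro add_left_mono mult_left_mono) (auto simp: mult_left_le)
  finally have 1: "q powr (- e) \<le> 1 + e * exp e * \<theta>" by (simp add: mult_ac)
  have "m t = m t0 * q powr (- e)"
    using t q2 by (simp add: m_def q_def e_def powr_divide)
  also have "\<dots> \<le> m t0 * (1 + e * exp e * \<theta>)"
    using 1 m_pos[OF t(1)] by (intro mult_left_mono) auto
  finally show ?thesis by (simp add: e_def)
qed

definition profile :: "real \<Rightarrow> real^'n \<Rightarrow> real" where
  "profile t x = (exp (japanese_bracket \<beta> x) / (- \<beta> * sqrt t)) powr fast_exponent CARD('n)"

text \<open>The profile \<open>1 - c profile\<close> is concave in space; this compensates for the convexity of a paraboloid that is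
  too narrow in the radial direction, so that \<open>touching\<close> applies where the weights vary rapidly.\<close>

lemma rapidly_varying_touching:
  assumes t0: "0 < t0" "t0 \<le> 1" "t0 \<le> T"
    and big: "touching_const CARD('n) p (fast_M CARD('n) p) (fast_A CARD('n) p) < C1"
    and bound: "\<And>t x. 0 < t \<Longrightarrow> t \<le> t0 \<Longrightarrow> f t x \<le> m t"
    and slow: "\<And>t x. 0 < t \<Longrightarrow> t \<le> t0 \<Longrightarrow> slowly_varying t x \<Longrightarrow> f t x \<le> m t / 2"
    and fast: "\<And>t x. 0 < t \<Longrightarrow> t \<le> t0 \<Longrightarrow> \<not> slowly_varying t x \<Longrightarrow>
        f t x \<le> m t * (1 - exp (- 3) / 2 * profile t x)"
    and x0: "\<not> slowly_varying t0 x0"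
  shows "f t0 x0 < m t0 * (1 - exp (- 3) / 2 * profile t0 x0)"
proof -
  let ?d = "CARD('n)"
  let ?J = "japanese_bracket \<beta> :: real^'n \<Rightarrow> real"
  have \<beta>: "\<beta> < - 1" and nsv: "exp (?J x0) < - \<beta> * sqrt t0" using x0 by (auto simp: slowly_varying_def)
  define \<sigma> where "\<sigma> = fast_exponent ?d"
  have \<sigma>: "0 < \<sigma>" "\<sigma> \<le> 1" "\<sigma> * (real ?d + 1) = 2"
    by (auto simp: \<sigma>_def fast_exponent_def field_simps Suc_leI)
  define M where "M = fast_M ?d p"
  have M: "1 / 4 \<le> M" "0 < M" using p by (auto simp: M_def fast_M_def add_pos_nonneg)
  \<comment> \<open>The profile grows by at most a factor exp 3 over a section and is at most 1 at
    its centre, so \<open>c1 * G\<close> stays at most 1/2. Hence the bound m / 2 at slowly varying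
    points of the section implies the profile bound there.\<close>
  define c1 :: real where "c1 = exp (- 3) / 2"
  have c1: "0 < c1" "c1 \<le> 1 / 2" by (auto simp: c1_def)
  define \<epsilon> where "\<epsilon> = fast_eps ?d p"
  have \<epsilon>: "0 < \<epsilon>" "128 * M * \<epsilon> = c1 * \<sigma>\<^sup>2 * exp (- 3) / 2"
    using M c1 \<sigma> by (auto simp: \<epsilon>_def fast_eps_def M_def[symmetric] \<sigma>_def[symmetric] c1_def)
  have \<epsilon>1: "\<epsilon> \<le> 1"
  proof -
    have "c1 * \<sigma>\<^sup>2 * exp (- 3) \<le> 1 * 1 * 1" using c1 \<sigma> by (intro mult_mono power_le_one) auto
    then have "128 * M * \<epsilon> \<le> 1" using \<epsilon>(2) by simp
    moreover have "\<epsilon> \<le> 128 * M * \<epsilon>" using M \<epsilon>(1) by simp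
    ultimately show ?thesis by linarith
  qed
  define A where "A = fast_A ?d p"
  have A: "4 * M * exp 18 \<le> A" "\<epsilon> powr (- ((real ?d + 1) / 2)) \<le> A" "exp 3 \<le> A" "0 < A"
  proof -
    show 1: "4 * M * exp 18 \<le> A" "\<epsilon> powr (- ((real ?d + 1) / 2)) \<le> A"
      using M by (auto simp: A_def fast_A_def \<epsilon>_def M_def)
    have "1 * exp 18 \<le> 4 * M * exp (18::real)" using M by (intro mult_right_mono) auto
    moreover have "exp 3 \<le> exp (18::real)" by simp
    ultimately show "exp 3 \<le> A" using 1 by linarith
    then show "0 < A" using exp_gt_zero[of 3] by linarith
  qed
  define Z where "Z = - \<beta> * sqrt t0"
  have Z: "0 < Z" "Z \<le> - \<beta>" "Z\<^sup>2 = \<beta>\<^sup>2 * t0"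
    using \<beta> t0 by (auto simp: Z_def power_mult_distrib mult_neg_pos mult_le_cancel_left1)
  define r0 where "r0 = ?J x0"
  have r0: "1 \<le> r0" by (simp add: r0_def japanese_bracket_ge_1)
  define z0 where "z0 = exp r0 / Z"
  have "exp r0 < Z" using nsv by (simp add: r0_def Z_def)
  then have z0: "0 < z0" "z0 < 1" using Z(1) by (simp_all add: z0_def)
  have prof: "profile t x = exp (\<sigma> * ?J x) * (- \<beta> * sqrt t) powr (- \<sigma>)" if "0 < t" for t x
  proof -
    have "0 < - \<beta> * sqrt t" using \<beta> that by (simp add: mult_neg_pos)
    moreover have "(exp j / z) powr \<sigma> = exp (\<sigma> * j) * z powr (- \<sigma>)" if "0 < z" for j z
      using that by (simp add: powr_divide exp_powr_real powr_minus_divide mult.commute)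
    ultimately show ?thesis unfolding profile_def \<sigma>_def[symmetric] by blast
  qed
  define G where "G x = exp (\<sigma> * ?J x) * Z powr (- \<sigma>)" for x
  have G0: "profile t0 x = G x" for x using prof[OF t0(1)] by (simp add: G_def Z_def)
  have Gz: "G x0 = z0 powr \<sigma>" using G0[of x0] by (simp add: profile_def z0_def r0_def Z_def \<sigma>_def)
  have G01: "0 < G x0" "G x0 \<le> 1"
    unfolding Gz using z0 \<sigma> powr_mono2[of \<sigma> z0 1] by auto
  \<comment> \<open>Proportional to the profile at the centre, so that the concavity of the
    background, which has the same factor, can absorb the paraboloid.\<close>
  define \<theta> where "\<theta> = \<epsilon> * G x0"
  have \<theta>: "0 < \<theta>" "\<theta> \<le> 1" using \<epsilon> \<epsilon>1 G01 mult_mono[of \<epsilon> 1 "G x0" 1] by (auto simp: \<theta>_def)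
  \<comment> \<open>With this \<open>k\<close> the corresponding part of the convexity, 4 M
    \<beta>^2 \<theta> k, is 4 M exp (2 r0) / t0, the natural size. The other part of s^2, namely 1
    / r0, is left to the concavity.\<close>
  define k where "k = z0\<^sup>2 / \<theta>"
  have k: "0 < k" using z0 \<theta> by (simp add: k_def)
  define s where "s = sqrt (1 / r0 + k)"
  have s: "0 < s" "s\<^sup>2 = 1 / r0 + k" "1 / r0 \<le> s\<^sup>2"
    using r0 k by (auto simp: s_def add_pos_pos)
  define n where "n = (\<beta> / r0) *\<^sub>R x0"
  define P where "P = \<beta> *\<^sub>R (s *\<^sub>R mat 1 + outer_product n)"
  have \<beta>0: "\<beta> \<noteq> 0" using \<beta> by simp
  note sec = section_norm_le[OF \<beta>0 s(1) s(3)[unfolded r0_def], folded r0_def, folded n_def, folded P_def]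
    section_bracket[OF \<beta>0 s(1) s(3)[unfolded r0_def], folded r0_def, folded n_def, folded P_def]
    section_form_le[OF \<beta>0 s(1) s(3)[unfolded r0_def], folded r0_def, folded n_def, folded P_def]
    section_det[OF \<beta>0 s(1) s(3)[unfolded r0_def], folded r0_def, folded n_def, folded P_def]
  have G_near: "G x \<le> exp 3 * G x0" "exp (- 3) * G x0 \<le> G x" if "norm (P *v (x - x0)) \<le> 1" for x
  proof -
    have "\<sigma> * ?J x \<le> \<sigma> * (r0 + 3)" "\<sigma> * (r0 - 3) \<le> \<sigma> * ?J x"
      using sec(2,3)[OF that] \<sigma> by (auto intro!: mult_left_mono)
    then have "\<sigma> * ?J x \<le> 3 + \<sigma> * r0" "- 3 + \<sigma> * r0 \<le> \<sigma> * ?J x" using \<sigma> by (auto simp: algebra_simps)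
    then have "exp (\<sigma> * ?J x) \<le> exp 3 * exp (\<sigma> * r0)" "exp (- 3) * exp (\<sigma> * r0) \<le> exp (\<sigma> * ?J x)"
      by (simp_all only: exp_add[symmetric] exp_le_cancel_iff)
    then show "G x \<le> exp 3 * G x0" "exp (- 3) * G x0 \<le> G x"
      unfolding G_def r0_def[symmetric] mult.assoc[symmetric] by (auto intro!: mult_right_mono)
  qed
  have c1G: "c1 * G x \<le> 1 / 2" if "norm (P *v (x - x0)) \<le> 1" for x
  proof -
    have "c1 * G x \<le> c1 * (exp 3 * 1)"
      using G_near(1)[OF that] G01 c1 by (intro mult_left_mono) (auto intro: order_trans)
    also have "\<dots> = 1 / 2" by (simp add: c1_def exp_minus field_simps)
    finally show ?thesis .
  qed
  have Gpos: "0 \<le> G x" for x by (simp add: G_def)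
  \<comment> \<open>The background is lowered by \<theta> / 4 to offset the \<theta> / 4 in the
    conclusion of \<open>touching\<close>, so that the profile bound is recovered strictly and
    without loss.\<close>
  have "f t0 x0 < m t0 * ((1 - c1 * G x0 - \<theta> / 4) + \<theta> / 4)"
  proof (rule touching[OF t0 \<theta> less_imp_le[OF M(2)] A(4) exp_gt_zero[of r0], where P = P
      and V = "\<lambda>x. 1 - c1 * G x - \<theta> / 4" and DV = "\<lambda>x. - (c1 * Z powr (- \<sigma>)) *\<^sub>R bracket_grad \<sigma> \<beta> x"
      and HV = "\<lambda>x. - (c1 * Z powr (- \<sigma>)) *\<^sub>R bracket_hess \<sigma> \<beta> x"])
    show "touching_const CARD('n) p M A < C1" using big by (simp add: M_def A_def)
    show "\<And>t x. 0 < t \<Longrightarrow> t \<le> t0 \<Longrightarrow> f t x \<le> m t" by (rule bound)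
    show "f t x \<le> m t0 * (1 - c1 * G x - \<theta> / 4 + M * \<theta>)"
      if t: "t0 - \<theta> * t0 / 2 \<le> t" "t \<le> t0" and x: "norm (P *v (x - x0)) \<le> 1" for t x
    proof -
      have "\<theta> * t0 \<le> 1 * t0" using \<theta> t0 by (intro mult_right_mono) auto
      then have tp: "0 < t" using t(1) t0(1) by linarith
      define y where "y = 1 - c1 * G x"
      have y: "0 \<le> y" "y \<le> 1" "1 / 2 \<le> y" using c1G[OF x] Gpos[of x] c1 by (auto simp: y_def)
      have fy: "f t x \<le> m t * y"
      proof (cases "slowly_varying t x")
        case True
        then have "f t x \<le> m t * (1 / 2)" using slow[OF tp t(2)] by simp
        also have "\<dots> \<le> m t * y" using y m_pos[OF tp] by (intro mult_left_mono) auto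
        finally show ?thesis .
      next
        case False
        \<comment> \<open>Going back in time raises the profile, so the bound at time
          \<open>t\<close> implies the one with the profile frozen at \<open>t0\<close>.\<close>
        have "- \<beta> * sqrt t \<le> Z" unfolding Z_def using \<beta> t(2) by (intro mult_left_mono) auto
        moreover have "0 < - \<beta> * sqrt t" using \<beta> tp by (simp add: mult_neg_pos)
        ultimately have "Z powr (- \<sigma>) \<le> (- \<beta> * sqrt t) powr (- \<sigma>)" using \<sigma> by (intro powr_mono2') auto
        then have "G x \<le> profile t x" unfolding G_def prof[OF tp] by (intro mult_left_mono) auto
        then have "c1 * G x \<le> c1 * profile t x" using c1 by (intro mult_left_mono) auto
        then have "m t * (1 - c1 * profile t x) \<le> m t * y"
          using m_pos[OF tp] by (intro mult_left_mono) (auto simp: y_def)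
        then show ?thesis using fast[OF tp t(2) False] by (simp add: c1_def)
      qed
      define M' where "M' = real CARD('n) / (2 * p) * exp (real CARD('n) / (2 * p))"
      have M': "0 \<le> M'" "M = 1 / 4 + M'" using p by (auto simp: M'_def M_def fast_M_def)
      have "m t * y \<le> m t0 * (1 + M' * \<theta>) * y"
        unfolding M'_def using t \<theta> t0 y by (intro mult_right_mono m_window_le) auto
      also have "\<dots> = m t0 * (y + M' * \<theta> * y)" by (simp add: algebra_simps)
      also have "\<dots> \<le> m t0 * (y + M' * \<theta> * 1)"
        using m_pos[OF t0(1)] M' \<theta> y by (intro mult_left_mono add_left_mono) auto
      also have "\<dots> = m t0 * (1 - c1 * G x - \<theta> / 4 + M * \<theta>)"
        by (simp add: M'(2) y_def algebra_simps)
      finally show ?thesis using fy by simp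
    qed
    show "1 / 4 \<le> 1 - c1 * G x - \<theta> / 4" if "norm (P *v (x - x0)) \<le> 1" for x
      using c1G[OF that] \<theta> by linarith
    show "((\<lambda>x. 1 - c1 * G x - \<theta> / 4) has_derivative (\<lambda>v. (- (c1 * Z powr (- \<sigma>)) *\<^sub>R bracket_grad \<sigma> \<beta> x) \<bullet> v)) (at x)" for x
    proof -
      have "((\<lambda>x. 1 - c1 * G x - \<theta> / 4) has_derivative
          (\<lambda>v. 0 - c1 * ((bracket_grad \<sigma> \<beta> x \<bullet> v) * Z powr (- \<sigma>)) - 0)) (at x)"
        unfolding G_def
        by (intro has_derivative_diff has_derivative_const has_derivative_mult_right has_derivative_mult_left bracket_grad)
      then show ?thesis by (rule has_derivative_eq_rhs) (simp add: fun_eq_iff mult_ac)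
    qed
    show "((\<lambda>x. - (c1 * Z powr (- \<sigma>)) *\<^sub>R bracket_grad \<sigma> \<beta> x) has_derivative
        (\<lambda>v. (- (c1 * Z powr (- \<sigma>)) *\<^sub>R bracket_hess \<sigma> \<beta> x) *v v)) (at x)" for x
      using has_derivative_scaleR_right[OF bracket_hess, of "- (c1 * Z powr (- \<sigma>))"]
      by (rule has_derivative_eq_rhs) (simp only: scaleR_matrix_vector_assoc)
    show "(1 + norm x) powr (- \<beta>) \<le> A * exp r0" if "norm (P *v (x - x0)) \<le> 1" for x
    proof -
      have "(1 + norm x) powr (- \<beta>) \<le> exp (japanese_bracket (- \<beta>) x)"
        using \<beta> by (intro weight_le_exp_bracket) auto
      also have "\<dots> \<le> exp (3 + r0)" using sec(2)[OF that] by (simp add: japanese_bracket_minus)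
      also have "\<dots> \<le> A * exp r0" using A(3) by (simp add: exp_add)
      finally show ?thesis .
    qed
    show "(exp r0 / sqrt t0) ^ ?d \<le> A * \<theta> ^ ?d * \<bar>det P\<bar>"
    proof -
      define w where "w = \<bar>\<beta>\<bar> * z0"
      have w: "0 < w" "exp r0 / sqrt t0 = w" using \<beta> z0 t0 by (auto simp: w_def z0_def Z_def)
      have sk: "z0 / sqrt \<theta> \<le> s"
      proof -
        have "(z0 / sqrt \<theta>)\<^sup>2 \<le> s\<^sup>2" using \<theta> r0 by (simp add: s(2) k_def power_divide)
        then show ?thesis by (rule power2_le_imp_le) (use s in simp)
      qed
      have "\<theta> = \<epsilon> * z0 powr \<sigma>" by (simp add: \<theta>_def Gz)
      \<comment> \<open>The choice \<sigma> = 2 / (d + 1) makes the power of \<theta> in the volume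
        condition exactly linear in \<open>z0\<close>.\<close>
      then have "\<theta> powr ((real ?d + 1) / 2) = \<epsilon> powr ((real ?d + 1) / 2) * z0 powr (\<sigma> * ((real ?d + 1) / 2))"
        using \<epsilon> z0 by (simp add: powr_mult powr_powr)
      also have "\<sigma> * ((real ?d + 1) / 2) = 1" using \<sigma>(3) by simp
      finally have \<theta>p: "\<theta> powr ((real ?d + 1) / 2) = \<epsilon> powr ((real ?d + 1) / 2) * z0" using z0 by simp
      have exps: "\<theta> ^ ?d * (1 / sqrt \<theta>) ^ (?d - 1) = \<theta> powr ((real ?d + 1) / 2)"
      proof -
        have "1 / sqrt \<theta> = \<theta> powr (- (1 / 2))"
          using \<theta> by (simp only: powr_minus_divide powr_half_sqrt less_imp_le)
        then have "(1 / sqrt \<theta>) ^ (?d - 1) = (\<theta> powr (- (1 / 2))) powr real (?d - 1)"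
          using \<theta> by (simp only:) (rule powr_realpow[symmetric], simp)
        also have "\<dots> = \<theta> powr (- (1 / 2) * real (?d - 1))" by (rule powr_powr)
        finally have "\<theta> ^ ?d * (1 / sqrt \<theta>) ^ (?d - 1) = \<theta> powr real ?d * \<theta> powr (- (1 / 2) * real (?d - 1))"
          using powr_realpow[OF \<theta>(1), of ?d] by (simp only:)
        also have "\<dots> = \<theta> powr (real ?d + - (1 / 2) * real (?d - 1))" by (rule powr_add[symmetric])
        also have "real ?d + - (1 / 2) * real (?d - 1) = (real ?d + 1) / 2"
          by (simp add: of_nat_diff Suc_leI field_simps)
        finally show ?thesis .
      qed
      have zd: "z0 * z0 ^ (?d - 1) = z0 ^ ?d" by (rule power_minus_mult[THEN trans[OF mult.commute]]) simp
      have "w ^ ?d = \<epsilon> powr (- ((real ?d + 1) / 2)) * (\<epsilon> powr ((real ?d + 1) / 2) * w ^ ?d)"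
        using \<epsilon> by (simp add: powr_minus)
      also have "\<dots> \<le> A * (\<epsilon> powr ((real ?d + 1) / 2) * w ^ ?d)"
        using A(2) w by (intro mult_right_mono) auto
      also have "\<epsilon> powr ((real ?d + 1) / 2) * w ^ ?d
          = \<bar>\<beta>\<bar> ^ ?d * (\<theta> powr ((real ?d + 1) / 2) * z0 ^ (?d - 1))"
        unfolding \<theta>p w_def power_mult_distrib using zd by (simp add: mult_ac)
      also have "\<dots> = \<theta> ^ ?d * (\<bar>\<beta>\<bar> ^ ?d * (z0 / sqrt \<theta>) ^ (?d - 1))"
        unfolding exps[symmetric] by (simp add: power_divide)
      also have "A * \<dots> \<le> A * (\<theta> ^ ?d * (\<bar>\<beta>\<bar> ^ ?d * s ^ (?d - 1)))"
        using sk A z0 \<theta> by (intro mult_left_mono power_mono) auto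
      also have "\<dots> \<le> A * (\<theta> ^ ?d * \<bar>det P\<bar>)"
        using sec(5) A \<theta> by (intro mult_left_mono) auto
      finally show ?thesis using w(2) by (simp add: mult.assoc)
    qed
    show "\<exists>c\<ge>0. (\<forall>\<xi>. \<xi> \<bullet> ((- (c1 * Z powr (- \<sigma>)) *\<^sub>R bracket_hess \<sigma> \<beta> x) *v \<xi>)
          + 2 * M * \<theta> * (norm (P *v \<xi>))\<^sup>2 \<le> c * (norm \<xi>)\<^sup>2)
        \<and> c * (1 + norm x) powr (min (2 * \<beta>) 2) \<le> A / t0"
      if x: "norm (P *v (x - x0)) \<le> 1" for x
    proof (intro exI[of _ "4 * M * exp (2 * r0) / t0"] conjI allI)
      show "0 \<le> 4 * M * exp (2 * r0) / t0" using M t0 by simp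
      define y where "y = (1 + norm x) powr (- \<beta>)"
      have y: "0 < y" by (simp add: y_def add_nonneg_eq_0_iff)
      \<comment> \<open>Rapid variation at the centre puts the bracket below ln (-\<beta>) there,
        hence below ln (-\<beta>) + 3 on the section, where its exponential is comparable to the
        weight.\<close>
      have "exp r0 < - \<beta>" using nsv Z(2) by (simp add: r0_def Z_def)
      then have "r0 \<le> ln (- \<beta>)" using ln_mono[of "exp r0" "- \<beta>"] \<beta> by simp
      then have "exp (?J x) \<le> exp 6 * y"
        unfolding y_def using exp_bracket_le_weight[of "- \<beta>" x] \<beta> sec(2)[OF x]
        by (simp add: japanese_bracket_minus)
      then have e6: "exp 3 * exp (?J x) \<le> exp 3 * (exp 6 * y)" by (rule mult_left_mono) simp
      have "exp r0 \<le> exp (3 + ?J x)" using sec(3)[OF x] by simp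
      also have "\<dots> = exp 3 * exp (?J x)" by (rule exp_add)
      also note e6
      also have "exp 3 * (exp 6 * y) = exp 9 * y" by (simp add: mult.assoc[symmetric] exp_add[symmetric])
      finally have "exp r0 \<le> exp 9 * y" .
      then have "(exp r0)\<^sup>2 \<le> (exp 9 * y)\<^sup>2" by (intro power_mono) auto
      also have "\<dots> = exp 18 * y\<^sup>2" by (simp add: power_mult_distrib exp_double[symmetric])
      finally have e18: "exp (2 * r0) / y\<^sup>2 \<le> exp 18" using y by (simp add: exp_double divide_le_eq)
      have "min (2 * \<beta>) 2 = - (- \<beta> + - \<beta>)" using \<beta> by simp
      then have "(1 + norm x) powr (min (2 * \<beta>) 2) = 1 / y\<^sup>2"
        by (simp only: powr_minus_divide powr_add y_def power2_eq_square)
      then have "4 * M * exp (2 * r0) / t0 * (1 + norm x) powr (min (2 * \<beta>) 2)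
          = 4 * M * (exp (2 * r0) / y\<^sup>2) / t0" by simp
      also have "\<dots> \<le> 4 * M * exp 18 / t0"
        using e18 M t0 by (intro divide_right_mono mult_left_mono) auto
      also have "\<dots> \<le> A / t0" using A t0 by (intro divide_right_mono) auto
      finally show "4 * M * exp (2 * r0) / t0 * (1 + norm x) powr (min (2 * \<beta>) 2) \<le> A / t0" .
      fix \<xi> :: "real^'n"
      define Q where "Q = (\<beta> * (x \<bullet> \<xi>) / ?J x)\<^sup>2 + (norm \<xi>)\<^sup>2 / ?J x"
      have Q: "0 \<le> Q" using japanese_bracket_ge_1[of \<beta> x] by (auto simp: Q_def)
      define w where "w = c1 * \<sigma>\<^sup>2 / 2 * \<beta>\<^sup>2 * Q"
      have w: "0 \<le> w" using c1 Q by (simp add: w_def)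
      have "G x * w = c1 * Z powr (- \<sigma>) * (\<sigma>\<^sup>2 / 2 * \<beta>\<^sup>2 * exp (\<sigma> * ?J x) * Q)"
        by (simp add: G_def w_def)
      also have "\<dots> \<le> c1 * Z powr (- \<sigma>) * (\<xi> \<bullet> (bracket_hess \<sigma> \<beta> x *v \<xi>))"
        unfolding Q_def using c1 \<sigma> by (intro mult_left_mono bracket_hess_lower) auto
      finally have "\<xi> \<bullet> ((- (c1 * Z powr (- \<sigma>)) *\<^sub>R bracket_hess \<sigma> \<beta> x) *v \<xi>) \<le> - (G x * w)"
        by (simp only: scaleR_matrix_vector_assoc[symmetric] inner_scaleR_right minus_mult_left[symmetric] neg_le_iff_le)
      moreover have "exp (- 3) * G x0 * w \<le> G x * w" using G_near(2)[OF x] w by (intro mult_right_mono)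
      moreover have "2 * M * \<theta> * (norm (P *v \<xi>))\<^sup>2 \<le> exp (- 3) * G x0 * w + 4 * M * exp (2 * r0) / t0 * (norm \<xi>)\<^sup>2"
      proof -
        have "(norm (P *v \<xi>))\<^sup>2 \<le> 2 * \<beta>\<^sup>2 * (s\<^sup>2 * (norm \<xi>)\<^sup>2 + (n \<bullet> \<xi>)\<^sup>2)" by (rule sec(1))
        also have "s\<^sup>2 * (norm \<xi>)\<^sup>2 + (n \<bullet> \<xi>)\<^sup>2 = ((n \<bullet> \<xi>)\<^sup>2 + (norm \<xi>)\<^sup>2 / r0) + k * (norm \<xi>)\<^sup>2"
          by (simp add: s(2) distrib_right)
        also have "2 * \<beta>\<^sup>2 * (((n \<bullet> \<xi>)\<^sup>2 + (norm \<xi>)\<^sup>2 / r0) + k * (norm \<xi>)\<^sup>2)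
            \<le> 2 * \<beta>\<^sup>2 * (32 * Q + k * (norm \<xi>)\<^sup>2)"
          using sec(4)[OF x, of \<xi>] by (intro mult_left_mono add_right_mono) (auto simp: Q_def)
        finally have "2 * M * \<theta> * (norm (P *v \<xi>))\<^sup>2 \<le> 2 * M * \<theta> * (2 * \<beta>\<^sup>2 * (32 * Q + k * (norm \<xi>)\<^sup>2))"
          using M \<theta> by (intro mult_left_mono) auto
        also have "\<dots> = (128 * M * \<epsilon>) * G x0 * \<beta>\<^sup>2 * Q + 4 * M * (\<beta>\<^sup>2 * (\<theta> * k)) * (norm \<xi>)\<^sup>2"
          by (simp add: \<theta>_def algebra_simps)
        also have "(128 * M * \<epsilon>) * G x0 * \<beta>\<^sup>2 * Q = exp (- 3) * G x0 * w"
          unfolding \<epsilon>(2) w_def by simp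
        also have "\<beta>\<^sup>2 * (\<theta> * k) = exp (2 * r0) / t0"
          using \<theta> \<beta> t0 by (simp add: k_def z0_def power_divide Z(3) exp_double)
        finally show ?thesis by simp
      qed
      ultimately show "\<xi> \<bullet> ((- (c1 * Z powr (- \<sigma>)) *\<^sub>R bracket_hess \<sigma> \<beta> x) *v \<xi>)
          + 2 * M * \<theta> * (norm (P *v \<xi>))\<^sup>2 \<le> 4 * M * exp (2 * r0) / t0 * (norm \<xi>)\<^sup>2" by linarith
    qed
  qed
  then show ?thesis by (simp add: G0 c1_def)
qed

end

section \<open>Continuation in time\<close>

lemma le_at_right_end:
  fixes g h :: "real \<Rightarrow> real"
  assumes "a < b" "continuous_on {a..b} g" "continuous_on {a..b} h" "\<And>t. a \<le> t \<Longrightarrow> t < b \<Longrightarrow> g t \<le> h t"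
  shows "g b \<le> h b"
proof -
  have cl: "closure {a..<b} = {a..b}" using assms(1) by simp
  show ?thesis
    using continuous_le_on_closure[of "{a..<b}" "\<lambda>t. g t - h t" b 0] assms
    by (simp add: cl continuous_on_diff)
qed

text \<open>The Hessian of ln (1 + |x|^2).\<close>

definition log_hess :: "real^'n \<Rightarrow> real^'n^'n" where
  "log_hess x = (2 / (1 + x \<bullet> x)) *\<^sub>R mat 1 - (4 / (1 + x \<bullet> x)\<^sup>2) *\<^sub>R outer_product x"

lemma log_grad:
  fixes x :: "real^'n"
  shows "((\<lambda>x. ln (1 + x \<bullet> x)) has_derivative (\<lambda>v. ((2 / (1 + x \<bullet> x)) *\<^sub>R x) \<bullet> v)) (at x)"
proof -
  have pos: "0 < 1 + x \<bullet> x" by (simp add: add_pos_nonneg)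
  have "((\<lambda>x::real^'n. 1 + x \<bullet> x) has_derivative (\<lambda>v. 2 * (x \<bullet> v))) (at x)"
    by (auto intro!: derivative_eq_intros simp: inner_commute)
  from has_derivative_ln[OF pos this] show ?thesis
    by (rule has_derivative_eq_rhs) (simp add: fun_eq_iff field_simps)
qed

lemma log_hess:
  fixes x :: "real^'n"
  shows "((\<lambda>x. (2 / (1 + x \<bullet> x)) *\<^sub>R x) has_derivative (\<lambda>v. log_hess x *v v)) (at x)"
proof -
  have nz: "1 + x \<bullet> x \<noteq> 0" by (simp add: add_nonneg_eq_0_iff)
  have "((\<lambda>x::real^'n. 1 + x \<bullet> x) has_derivative (\<lambda>v. 2 * (x \<bullet> v))) (at x)"
    by (auto intro!: derivative_eq_intros simp: inner_commute)
  from has_derivative_scaleR[OF has_derivative_divide[OF has_derivative_const this nz, of 2] has_derivative_ident]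
  show ?thesis
    by (rule has_derivative_eq_rhs)
       (simp add: fun_eq_iff log_hess_def matrix_vector_mult_diff_rdistrib scaleR_matrix_vector_assoc[symmetric]
          outer_product_mult field_simps power2_eq_square)
qed

lemma log_hess_le: "\<xi> \<bullet> (log_hess x *v \<xi>) \<le> 2 / (1 + x \<bullet> x) * (norm \<xi>)\<^sup>2"
proof -
  have "\<xi> \<bullet> (log_hess x *v \<xi>) = 2 / (1 + x \<bullet> x) * (norm \<xi>)\<^sup>2 - 4 / (1 + x \<bullet> x)\<^sup>2 * (x \<bullet> \<xi>)\<^sup>2"
    by (simp add: log_hess_def matrix_vector_mult_diff_rdistrib scaleR_matrix_vector_assoc[symmetric]
        outer_product_mult inner_diff_right dot_square_norm inner_commute power2_eq_square)
  then show ?thesis by simp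
qed

context degenerate_parabolic
begin

lemma f_time_continuous: "continuous_on {0..1} (\<lambda>t. f t x)"
proof -
  have 1: "continuous_on {0..1} (\<lambda>t. (t, x))" by (intro continuous_intros)
  have 2: "(\<lambda>t. (t, x)) ` {0..1::real} \<subseteq> {0..1} \<times> UNIV" by auto
  show ?thesis using continuous_on_compose2[OF f_cont 1 2] by simp
qed

lemma m_continuous: "0 < t1 \<Longrightarrow> continuous_on {t1..t2} m"
  unfolding m_def[abs_def] by (intro continuous_intros) auto

text \<open>A comparison with \<open>L + \<epsilon> ln (1 + |x|^2)\<close>, \<open>\<epsilon> \<rightarrow> 0\<close>, as \<open>f\<close> need not attain its supremum.\<close>

lemma sup_growth:
  assumes \<tau>: "0 \<le> \<tau>" and L: "0 \<le> L" "\<And>x. f \<tau> x \<le> L"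
  shows "\<exists>S\<ge>0. \<forall>t\<in>{\<tau>..1}. \<forall>x. f t x \<le> L + S * (t - \<tau>)"
proof -
  obtain B where B: "0 < B" "\<And>t x. t \<in> {0..1} \<Longrightarrow> \<bar>f t x\<bar> \<le> B"
    using f_bounded unfolding bounded_pos by force
  define c where "c = 4 * (real CARD('n) * \<Lambda>)"
  define S where "S = C * B powr (1 + \<alpha>) + c"
  have c: "0 \<le> c" using \<Lambda> by (simp add: c_def)
  have S: "0 \<le> S" using C c by (simp add: S_def)
  have main: "f t x \<le> L + e * ln (1 + x \<bullet> x) + S * (t - \<tau>)"
    if t: "t \<in> {\<tau>..1}" and e: "0 < e" "e \<le> 1" for t x e
  proof -
    \<comment> \<open>Beyond this radius the logarithmic term exceeds the bound \<open>B\<close> of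
      f, so positive maxima of \<open>u\<close> lie in the interior of the ball.\<close>
    define R where "R = max (norm x) (exp (B / e))"
    define u where "u s y = f s y - L - e * ln (1 + y \<bullet> y)" for s y
    have far: "u s y < 0" if "s \<in> {0..1}" "R \<le> norm y" for s y
    proof -
      have "exp (B / e) \<le> norm y" using that by (simp add: R_def)
      moreover have "1 \<le> exp (B / e)" using B e by simp
      then have "1 \<le> norm y" using \<open>exp (B / e) \<le> norm y\<close> by (rule order_trans)
      ultimately have "exp (B / e) * 1 \<le> norm y * norm y" by (intro mult_mono) auto
      then have "exp (B / e) < 1 + y \<bullet> y" by (simp add: dot_square_norm power2_eq_square)
      then have "B / e < ln (1 + y \<bullet> y)" by (metis exp_gt_zero exp_less_cancel_iff exp_ln less_trans)
      then have "B < e * ln (1 + y \<bullet> y)" using e by (simp add: divide_less_eq mult.commute)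
      then show ?thesis using B(2)[OF that(1), of y] L(1) by (simp add: u_def)
    qed
    have "u t x \<le> 0 + S * (t - \<tau>)"
    proof (rule parabolic_sup_growth[where K = "cball 0 R" and u = u])
      show "compact (cball (0::real^'n) R)" "\<tau> \<le> t" "0 \<le> S" "(0::real) \<le> 0" "x \<in> cball 0 R"
        using t S by (auto simp: R_def)
      have "continuous_on ({\<tau>..t} \<times> cball 0 R) (\<lambda>q. f (fst q) (snd q))"
        using f_cont t \<tau> by (auto simp: case_prod_unfold elim!: continuous_on_subset)
      moreover have "1 + y \<bullet> y \<noteq> 0" for y :: "real^'n" by (simp add: add_nonneg_eq_0_iff)
      ultimately show "continuous_on ({\<tau>..t} \<times> cball 0 R) (\<lambda>(t, x). u t x)"
        unfolding u_def case_prod_unfold by (intro continuous_intros) auto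
      show "u \<tau> y \<le> 0" for y
      proof -
        have "0 \<le> e * ln (1 + y \<bullet> y)" using e by simp
        then show ?thesis using L(2)[of y] by (simp add: u_def)
      qed
      fix s y assume s: "\<tau> < s" "s \<le> t" and y: "y \<in> cball 0 R" "0 < u s y" "\<forall>z\<in>cball 0 R. u s z \<le> u s y"
      have s1: "s \<in> {0..1}" using s t \<tau> by auto
      have yin: "y \<in> ball 0 R" using far[OF s1, of y] y(2) by (auto simp: not_less[symmetric])
      have "0 \<le> e * ln (1 + y \<bullet> y)" using e by simp
      then have fpos: "0 < f s y" using y(2) L(1) by (simp add: u_def)
      have tw: "twice_differentiable_at (f s) y" using pde s1 fpos by blast
      define Df where "Df z = (\<chi> i. partial_deriv i (f s) z)" for z
      define Hf where "Hf = ((\<chi> j i. partial_deriv i (partial_deriv j (f s)) y) :: real^'n^'n)"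
      note gr = twice_differentiable_at_gradient[OF tw, folded Df_def[abs_def] Hf_def]
      have D: "\<forall>\<^sub>F z in nhds y. (u s has_derivative (\<lambda>v. (Df z - e *\<^sub>R ((2 / (1 + z \<bullet> z)) *\<^sub>R z)) \<bullet> v)) (at z)"
        using gr(1)
      proof eventually_elim
        case (elim z)
        have "(u s has_derivative (\<lambda>v. Df z \<bullet> v - 0 - e * (((2 / (1 + z \<bullet> z)) *\<^sub>R z) \<bullet> v))) (at z)"
          unfolding u_def[abs_def]
          by (intro has_derivative_diff has_derivative_const has_derivative_mult_right log_grad)
             (use elim in \<open>simp add: Df_def\<close>)
        then show ?case by (rule has_derivative_eq_rhs) (simp add: fun_eq_iff inner_diff_left)
      qed
      have H: "((\<lambda>z. Df z - e *\<^sub>R ((2 / (1 + z \<bullet> z)) *\<^sub>R z)) has_derivative (\<lambda>v. (Hf - e *\<^sub>R log_hess y) *v v)) (at y)"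
        using has_derivative_diff[OF gr(2) has_derivative_scaleR_right[OF log_hess, of e]]
        by (rule has_derivative_eq_rhs)
           (simp add: fun_eq_iff matrix_vector_mult_diff_rdistrib scaleR_matrix_vector_assoc[symmetric])
      have "\<forall>\<^sub>F z in nhds y. u s z \<le> u s y"
        using eventually_nhds_in_open[OF open_ball yin] by eventually_elim (use y(3) in auto)
      from second_order_local_max(2)[OF D H this]
      have "trace (a s y ** (Hf - e *\<^sub>R log_hess y)) \<le> 0 * (real CARD('n) * (\<Lambda> * (1 + norm y) powr (min (2 * \<beta>) 2)))"
        by (intro trace_a_mult_le[OF s1]) auto
      moreover have "trace (a s y ** (Hf - e *\<^sub>R log_hess y)) = trace (a s y ** Hf) - e * trace (a s y ** log_hess y)"
        by (simp add: trace_def matrix_matrix_mult_def right_diff_distrib sum_subtractf sum_distrib_left mult_ac)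
      moreover have "e * trace (a s y ** log_hess y) \<le> c"
      proof -
        have n0: "0 < 1 + y \<bullet> y" by (simp add: add_pos_nonneg)
        have "trace (a s y ** log_hess y)
            \<le> 2 / (1 + y \<bullet> y) * (real CARD('n) * (\<Lambda> * (1 + norm y) powr (min (2 * \<beta>) 2)))"
          using n0 by (intro trace_a_mult_le[OF s1 log_hess_le]) auto
        \<comment> \<open>The cap 2 on the exponent in the upper bound for \<open>a\<close> is
          exactly the growth that the second derivatives of the logarithm compensate.\<close>
        also have "\<dots> \<le> 2 / (1 + y \<bullet> y) * (real CARD('n) * (\<Lambda> * (2 * (1 + y \<bullet> y))))"
        proof (intro mult_left_mono)
          have "(1 + norm y) powr (min (2 * \<beta>) 2) \<le> (1 + norm y) powr 2" by (intro powr_mono) auto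
          also have "\<dots> = (1 + norm y)\<^sup>2" by simp
          also have "\<dots> \<le> 2 * (1 + y \<bullet> y)"
            using sum_squares_bound[of 1 "norm y"] by (simp add: power2_sum dot_square_norm)
          finally show "(1 + norm y) powr (min (2 * \<beta>) 2) \<le> 2 * (1 + y \<bullet> y)" .
        qed (use \<Lambda> n0 in auto)
        also have "\<dots> = c" using n0 by (simp add: c_def field_simps)
        finally have "trace (a s y ** log_hess y) \<le> c" .
        then have "e * trace (a s y ** log_hess y) \<le> e * c" using e by (intro mult_left_mono) auto
        also have "\<dots> \<le> 1 * c" using e c by (intro mult_right_mono) auto
        finally show ?thesis by simp
      qed
      moreover obtain w where w: "w \<le> trace (a s y ** Hf) + C * B powr (1 + \<alpha>)"
        "((\<lambda>s. f s y) has_real_derivative w) (at s within {0..1})"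
        using f_time_derivative[OF s1 fpos, of B] B(2)[OF s1] B(1)
        unfolding Hf_def by (auto simp: abs_le_iff)
      ultimately have "w \<le> S" unfolding S_def by linarith
      moreover have "((\<lambda>s. u s y) has_real_derivative w) (at s within {\<tau>..s})"
        unfolding u_def using DERIV_subset[OF w(2), of "{\<tau>..s}"] s1 \<tau> by (auto intro!: derivative_eq_intros)
      ultimately show "\<exists>w\<le>S. ((\<lambda>s. u s y) has_real_derivative w) (at s within {\<tau>..s})" by blast
    qed
    then show ?thesis by (simp add: u_def)
  qed
  have "f t x \<le> L + S * (t - \<tau>)" if t: "t \<in> {\<tau>..1}" for t x
  proof (rule field_le_epsilon)
    fix e :: real assume e: "0 < e"
    define l where "l = ln (1 + x \<bullet> x)"
    have l: "0 \<le> l" by (simp add: l_def)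
    define e' where "e' = min 1 (e / (l + 1))"
    have e': "0 < e'" "e' \<le> 1" "e' \<le> e / (l + 1)" using e l by (auto simp: e'_def)
    have "e' * l \<le> e / (l + 1) * (l + 1)" using e' l e by (intro mult_mono) auto
    also have "\<dots> = e" using l by simp
    finally show "f t x \<le> L + S * (t - \<tau>) + e" using main[OF t e'(1,2), of x] by (simp add: l_def)
  qed
  then show ?thesis using S by blast
qed

text \<open>\<open>rapidly_varying_touching\<close> presupposes the weak profile bound up to and
  including the present time, so it is applied at the earliest time of a violation. Points that are
  not rapidly varying are covered by \<open>half_bound_slowly_varying\<close>.\<close>

lemma rapidly_varying_bound:
  assumes t0: "0 < t0" "t0 \<le> 1" "t0 \<le> T"
    and big1: "touching_const CARD('n) p (2 powr (real CARD('n) / (2 * p))) (half_const CARD('n) p) < C1"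
    and big2: "touching_const CARD('n) p (fast_M CARD('n) p) (fast_A CARD('n) p) < C1"
    and bound: "\<And>t x. 0 < t \<Longrightarrow> t \<le> t0 \<Longrightarrow> f t x \<le> m t"
    and nsv: "\<not> slowly_varying t0 x0"
  shows "f t0 x0 < m t0 * (1 - exp (- 3) / 2 * profile t0 x0)"
proof (rule ccontr)
  let ?J = "japanese_bracket \<beta> :: real^'n \<Rightarrow> real"
  let ?h = "\<lambda>t x. m t * (1 - exp (- 3) / 2 * profile t x)"
  assume viol: "\<not> f t0 x0 < ?h t0 x0"
  have \<beta>: "\<beta> < - 1" using nsv by (simp add: slowly_varying_def)
  have half: "f t x < m t / 2" if "0 < t" "t \<le> t0" "slowly_varying t x" for t x
    using that t0 bound by (intro half_bound_slowly_varying[OF _ _ _ big1]) auto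
  define t1 where "t1 = 1 / \<beta>\<^sup>2"
  have t1: "0 < t1" using \<beta> by (simp add: t1_def)
  have Jc: "continuous_on A ?J" for A
    using japanese_bracket_derivative by (meson continuous_at_imp_continuous_on has_derivative_continuous)
  \<comment> \<open>Rapid variation forces t \<ge> 1 / \<beta>^2 and |x| \<le> 1, so all candidates
    for a violation lie in a compact set away from t = 0.\<close>
  have late: "t1 \<le> t \<and> norm x \<le> 1" if "0 < t" "t \<le> 1" "exp (?J x) \<le> - \<beta> * sqrt t" for t x
  proof -
    have J1: "1 \<le> ?J x" by (rule japanese_bracket_ge_1)
    have "1 + ?J x \<le> - \<beta> * sqrt t" using exp_ge_add_one_self[of "?J x"] that(3) by linarith
    moreover have "- \<beta> * sqrt t \<le> - \<beta> * 1" using \<beta> that by (intro mult_left_mono) auto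
    ultimately have 1: "1 \<le> - \<beta> * sqrt t" "?J x \<le> - \<beta>" using J1 by linarith+
    have "1\<^sup>2 \<le> (- \<beta> * sqrt t)\<^sup>2" using 1(1) by (intro power_mono) auto
    then have "1 \<le> \<beta>\<^sup>2 * t" using that by (simp add: power_mult_distrib)
    then have "t1 \<le> t" using \<beta> by (simp add: t1_def divide_le_eq mult.commute)
    moreover have "(- \<beta> * norm x) \<le> ?J x" unfolding japanese_bracket_def by (intro real_le_rsqrt) simp
    then have "- \<beta> * norm x \<le> - \<beta> * 1" using 1 by linarith
    then have "norm x \<le> 1" using \<beta> by (simp only: mult_le_cancel_left_pos)
    ultimately show ?thesis by simp
  qed
  define Q where "Q = {t1..t0} \<times> cball (0::real^'n) 1"
  have Q: "compact Q" unfolding Q_def by (intro compact_Times compact_Icc compact_cball)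
  \<comment> \<open>The boundary of the rapidly varying region is included to make \<open>E\<close>
    closed. A point of \<open>E\<close> on it is ruled out afterwards: the profile equals 1 there,
    and f < m / 2.\<close>
  define E where "E = {q \<in> {q \<in> Q. exp (?J (snd q)) \<le> - \<beta> * sqrt (fst q)}. ?h (fst q) (snd q) \<le> f (fst q) (snd q)}"
  have cJ: "continuous_on Q (\<lambda>q. ?J (snd q))"
    by (rule continuous_on_compose2[OF Jc[of UNIV]]) (auto intro!: continuous_intros)
  have cf: "continuous_on Q (\<lambda>q. f (fst q) (snd q))"
    using f_cont t0 t1 by (auto simp: case_prod_unfold Q_def elim!: continuous_on_subset)
  have ch: "continuous_on Q (\<lambda>q. ?h (fst q) (snd q))"
  proof -
    have nz: "\<forall>q\<in>Q. - \<beta> * sqrt (fst q) \<noteq> 0" using t1 \<beta> by (auto simp: Q_def)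
    have 1: "continuous_on Q (\<lambda>q. - \<beta> * sqrt (fst q))" by (intro continuous_intros)
    note 2 = continuous_on_divide[OF continuous_on_exp[OF cJ] 1 nz]
    have "continuous_on Q (\<lambda>q. profile (fst q) (snd q))"
      unfolding profile_def
    proof (rule continuous_on_powr[OF 2 continuous_on_const], rule ballI)
      fix q assume "q \<in> Q"
      then show "exp (?J (snd q)) / (- \<beta> * sqrt (fst q)) \<noteq> 0" using nz by (simp only: divide_eq_0_iff exp_not_eq_zero) blast
    qed
    moreover have "continuous_on Q (\<lambda>q. m (fst q))"
      by (rule continuous_on_compose2[OF m_continuous[OF t1, of t0] continuous_on_fst[OF continuous_on_id]])
         (auto simp: Q_def)
    ultimately show ?thesis
      by (rule continuous_on_mult[OF _ continuous_on_diff[OF continuous_on_const continuous_on_mult_left], rotated])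
  qed
  have clQ: "closed Q" using Q by (rule compact_imp_closed)
  have cl1: "closed {q \<in> Q. exp (?J (snd q)) \<le> - \<beta> * sqrt (fst q)}"
    by (rule continuous_on_closed_Collect_le[OF _ _ clQ]) (intro continuous_intros cJ)+
  have "closed E" unfolding E_def
    by (rule continuous_on_closed_Collect_le[OF continuous_on_subset[OF ch] continuous_on_subset[OF cf] cl1]) auto
  then have "compact E" using Q
    by (metis (no_types, lifting) E_def compact_Int_closed inf.absorb_iff2 mem_Collect_eq subsetI)
  moreover have "(t0, x0) \<in> E"
    using viol nsv late[of t0 x0] t0 by (auto simp: E_def Q_def slowly_varying_def)
  ultimately have "\<exists>q\<in>E. \<forall>q'\<in>E. fst q \<le> fst q'"
    by (intro continuous_attains_inf continuous_on_fst continuous_on_id) auto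
  then obtain q where q: "q \<in> E" "\<And>q'. q' \<in> E \<Longrightarrow> fst q \<le> fst q'" by blast
  obtain t x where tx: "q = (t, x)" by (cases q)
  have t: "0 < t" "t \<le> t0" "t \<le> 1" "t \<le> T" and hx: "?h t x \<le> f t x" and Jx: "exp (?J x) \<le> - \<beta> * sqrt t"
    using q(1) t0 t1 by (auto simp: tx E_def Q_def)
  have before: "f s y < ?h s y" if "0 < s" "s < t" "\<not> slowly_varying s y" for s y
  proof (rule ccontr)
    assume "\<not> f s y < ?h s y"
    then have "(s, y) \<in> E"
      using that t late[of s y] by (auto simp: E_def Q_def slowly_varying_def)
    then show False using q(2)[of "(s, y)"] that by (simp add: tx)
  qed
  have "\<not> slowly_varying t x"
  proof
    assume sv: "slowly_varying t x"
    then have "exp (?J x) = - \<beta> * sqrt t" using Jx \<beta> by (auto simp: slowly_varying_def)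
    then have "profile t x = 1" using \<beta> t by (simp add: profile_def)
    moreover have "exp (- 3) / 2 \<le> (1 / 2 :: real)" by simp
    ultimately have "m t * (1 / 2) \<le> ?h t x" using m_pos[OF t(1)] by (intro mult_left_mono) auto
    then show False using half[OF t(1,2) sv] hx by simp
  qed
  then have "f t x < ?h t x"
  proof (rule rapidly_varying_touching[OF t(1,3,4) big2, rotated -1])
    show "f s y \<le> m s" if "0 < s" "s \<le> t" for s y using bound that t by auto
    show "f s y \<le> m s / 2" if "0 < s" "s \<le> t" "slowly_varying s y" for s y
      using half[of s y] that t by auto
    show "f s y \<le> ?h s y" if s: "0 < s" "s \<le> t" "\<not> slowly_varying s y" for s y
    proof (cases "s = t")
      case False
      then show ?thesis using before[of s y] s by auto
    next
      case True
      \<comment> \<open>At the time \<open>t\<close> itself the weak bound follows from the left: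
        rapid variation is an open condition, so it holds at \<open>y\<close> slightly earlier,
        where there is no violation yet.\<close>
      have "\<forall>\<^sub>F r in at_left t. exp (?J y) < - \<beta> * sqrt r \<and> 0 < r"
      proof (intro eventually_conj)
        have "((\<lambda>r. - \<beta> * sqrt r) \<longlongrightarrow> - \<beta> * sqrt t) (at_left t)" by (intro tendsto_intros)
        moreover have "exp (?J y) < - \<beta> * sqrt t" using s(3) True by (simp add: slowly_varying_def)
        ultimately show "\<forall>\<^sub>F r in at_left t. exp (?J y) < - \<beta> * sqrt r" by (rule order_tendstoD)
        show "\<forall>\<^sub>F r in at_left t. 0 < r" using t(1) by (rule eventually_at_leftI[rotated]) auto
      qed
      then obtain b where b: "b < t" "\<And>r. b < r \<Longrightarrow> r < t \<Longrightarrow> exp (?J y) < - \<beta> * sqrt r \<and> 0 < r"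
        unfolding eventually_at_left_field by blast
      define a where "a = (b + t) / 2"
      have a: "b < a" "a < t" "0 < a" using b b(2)[of "(b + t) / 2"] by (auto simp: a_def)
      have "f t y \<le> ?h t y"
      proof (rule le_at_right_end[OF a(2), where g = "\<lambda>s. f s y" and h = "\<lambda>s. ?h s y"])
        show "continuous_on {a..t} (\<lambda>s. f s y)"
          by (rule continuous_on_subset[OF f_time_continuous]) (use a t in auto)
        have nz: "\<forall>r\<in>{a..t}. - \<beta> * sqrt r \<noteq> 0" using \<beta> a(3) by auto
        have 1: "continuous_on {a..t} (\<lambda>r. - \<beta> * sqrt r)" by (intro continuous_intros)
        have "continuous_on {a..t} (\<lambda>r. profile r y)"
          unfolding profile_def
          by (rule continuous_on_powr[OF continuous_on_divide[OF continuous_on_const 1 nz] continuous_on_const])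
             (use nz in auto)
        with m_continuous[OF a(3)] show "continuous_on {a..t} (\<lambda>s. ?h s y)"
          by (rule continuous_on_mult[OF _ continuous_on_diff[OF continuous_on_const continuous_on_mult_left]])
        fix r assume "a \<le> r" "r < t"
        then show "f r y \<le> ?h r y"
          using b(2)[of r] a \<beta> before[of r y] by (auto simp: slowly_varying_def)
      qed
      then show ?thesis using True by simp
    qed
  qed
  then show False using hx by simp
qed

text \<open>Pointwise strictness would not allow continuation, as x ranges over the whole space. In
  the slowly varying region the gap is m / 2; in the other one the profile is bounded below because
  the exponential of the bracket is at least 1.\<close>

lemma uniform_gap:
  assumes t0: "0 < t0" "t0 \<le> 1" "t0 \<le> T"
    and big1: "touching_const CARD('n) p (2 powr (real CARD('n) / (2 * p))) (half_const CARD('n) p) < C1"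
    and big2: "touching_const CARD('n) p (fast_M CARD('n) p) (fast_A CARD('n) p) < C1"
    and bound: "\<And>t x. 0 < t \<Longrightarrow> t \<le> t0 \<Longrightarrow> f t x \<le> m t"
  shows "\<exists>\<eta>>0. \<eta> \<le> m t0 \<and> (\<forall>x. f t0 x \<le> m t0 - \<eta>)"
proof -
  define c where "c = (if \<beta> < 0 then exp (- 3) / 2 * (1 / (- \<beta> * sqrt t0)) powr fast_exponent CARD('n) else 1)"
  have c: "0 < c" using t0 by (auto simp: c_def mult_less_0_iff)
  define \<eta> where "\<eta> = m t0 * min (1 / 2) c"
  have mp: "0 < m t0" by (rule m_pos[OF t0(1)])
  have "f t0 x \<le> m t0 - \<eta>" for x
  proof (cases "slowly_varying t0 x")
    case True
    have "f t0 x < m t0 / 2" by (rule half_bound_slowly_varying[OF t0 big1 bound True])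
    also have "m t0 / 2 \<le> m t0 * (1 - min (1 / 2) c)"
      using mult_left_mono[of "1 / 2" "1 - min (1 / 2) c" "m t0"] mp by simp
    finally show ?thesis by (simp add: \<eta>_def right_diff_distrib)
  next
    case False
    then have \<beta>: "\<beta> < 0" by (auto simp: slowly_varying_def)
    then have Z: "0 < - \<beta> * sqrt t0" using t0 by (simp add: mult_neg_pos)
    have "1 / (- \<beta> * sqrt t0) \<le> exp (japanese_bracket \<beta> x) / (- \<beta> * sqrt t0)"
      using Z japanese_bracket_ge_1[of \<beta> x] by (intro divide_right_mono) auto
    then have "c \<le> exp (- 3) / 2 * profile t0 x"
      using \<beta> Z unfolding c_def profile_def
      by (auto intro!: mult_left_mono powr_mono2 simp: fast_exponent_def)
    then have "m t0 * (1 - exp (- 3) / 2 * profile t0 x) \<le> m t0 * (1 - min (1 / 2) c)"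
      using mp by (intro mult_left_mono) auto
    moreover have "f t0 x < m t0 * (1 - exp (- 3) / 2 * profile t0 x)"
      by (rule rapidly_varying_bound[OF t0 big1 big2 bound False])
    ultimately show ?thesis by (simp add: \<eta>_def right_diff_distrib)
  qed
  moreover have "0 < \<eta>" "\<eta> \<le> m t0"
    using mp c mult_left_mono[of "min (1 / 2) c" 1 "m t0"] by (auto simp: \<eta>_def)
  ultimately show ?thesis by blast
qed

lemma strict_bound:
  assumes big1: "touching_const CARD('n) p (2 powr (real CARD('n) / (2 * p))) (half_const CARD('n) p) < C1"
    and big2: "touching_const CARD('n) p (fast_M CARD('n) p) (fast_A CARD('n) p) < C1"
    and t: "0 < t" "t \<le> 1" "t \<le> T"
  shows "f t x < m t"
proof -
  define good where "good r \<longleftrightarrow> (\<forall>s y. 0 < s \<longrightarrow> s \<le> r \<longrightarrow> f s y \<le> m s)" for r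
  define e where "e = real CARD('n) / (2 * p)"
  have e: "0 < e" using p by (simp add: e_def)
  obtain B where B: "0 < B" "\<And>t x. t \<in> {0..1} \<Longrightarrow> \<bar>f t x\<bar> \<le> B"
    using f_bounded unfolding bounded_pos by force
  \<comment> \<open>Up to the time at which m equals \<open>B\<close>, the bound of f by
    \<open>B\<close> is enough.\<close>
  define ts where "ts = min t ((K / B) powr (1 / e))"
  have ts: "0 < ts" "ts \<le> t" using t K B by (auto simp: ts_def)
  have "good ts"
    unfolding good_def
  proof (intro allI impI)
    fix s y assume s: "0 < s" "s \<le> ts"
    have "((K / B) powr (1 / e)) powr (- e) \<le> s powr (- e)"
      using s e by (intro powr_mono2') (auto simp: ts_def)
    also have "((K / B) powr (1 / e)) powr (- e) = B / K"
      using e K B by (simp add: powr_powr powr_minus_divide)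
    finally have "B \<le> m s" using K by (simp add: m_def e_def divide_le_eq mult.commute)
    moreover have "f s y \<le> B" using B(2)[of s y] s ts t by (auto simp: abs_le_iff)
    ultimately show "f s y \<le> m s" by simp
  qed
  define A where "A = {r \<in> {0<..t}. good r}"
  have A: "ts \<in> A" "bdd_above A" using \<open>good ts\<close> ts by (auto simp: A_def intro!: bdd_aboveI[of _ t])
  define \<tau> where "\<tau> = Sup A"
  have \<tau>: "ts \<le> \<tau>" "\<tau> \<le> t" unfolding \<tau>_def
    using A by (auto intro!: cSup_upper cSup_least simp: A_def)
  have below: "f s y \<le> m s" if s: "0 < s" "s < \<tau>" for s y
  proof -
    obtain r where "r \<in> A" "s < r" using s(2) A less_cSup_iff[of A s] by (auto simp: \<tau>_def)
    then show ?thesis using s by (auto simp: A_def good_def)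
  qed
  have good\<tau>: "f s y \<le> m s" if s: "0 < s" "s \<le> \<tau>" for s y
  proof (cases "s = \<tau>")
    case True
    have "f \<tau> y \<le> m \<tau>"
    proof (rule le_at_right_end[of "\<tau> / 2" \<tau> "\<lambda>s. f s y" m])
      show "continuous_on {\<tau> / 2..\<tau>} (\<lambda>s. f s y)"
        by (rule continuous_on_subset[OF f_time_continuous]) (use \<tau> ts t in auto)
    qed (use \<tau> ts below in \<open>auto intro: m_continuous\<close>)
    then show ?thesis using True by simp
  qed (use below s in auto)
  have \<tau>p: "0 < \<tau>" "\<tau> \<le> 1" "\<tau> \<le> T" using \<tau> ts t by auto
  have "\<tau> = t"
  proof (rule ccontr)
    assume "\<tau> \<noteq> t"
    then have "\<tau> < t" using \<tau> by simp
    obtain \<eta> where \<eta>: "0 < \<eta>" "\<eta> \<le> m \<tau>" "\<And>x. f \<tau> x \<le> m \<tau> - \<eta>"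
      using uniform_gap[OF \<tau>p big1 big2 good\<tau>] by blast
    obtain S where S: "0 \<le> S" "\<And>r x. r \<in> {\<tau>..1} \<Longrightarrow> f r x \<le> (m \<tau> - \<eta>) + S * (r - \<tau>)"
      using sup_growth[of \<tau> "m \<tau> - \<eta>"] \<tau>p \<eta> by auto
    have "continuous_on {\<tau>..t} m" by (rule m_continuous[OF \<tau>p(1)])
    then obtain d where d: "0 < d" "\<And>r. r \<in> {\<tau>..t} \<Longrightarrow> dist r \<tau> < d \<Longrightarrow> dist (m r) (m \<tau>) < \<eta> / 2"
      using \<tau> \<eta>(1) unfolding continuous_on_iff by (metis atLeastAtMost_iff half_gt_zero order_refl)
    \<comment> \<open>Within this time \<open>sup_growth\<close> spends at most half of the gap, and
      m decreases by less than the other half.\<close>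
    define h where "h = min (d / 2) (min (t - \<tau>) (\<eta> / (2 * (S + 1))))"
    have h: "0 < h" "h < d" "h \<le> t - \<tau>" "h \<le> \<eta> / (2 * (S + 1))"
      using d \<open>\<tau> < t\<close> \<eta>(1) S(1) by (auto simp: h_def)
    have "good (\<tau> + h)" unfolding good_def
    proof (intro allI impI)
      fix s y assume s: "0 < s" "s \<le> \<tau> + h"
      show "f s y \<le> m s"
      proof (cases "s \<le> \<tau>")
        case True
        then show ?thesis using good\<tau> s by simp
      next
        case False
        have "S * (s - \<tau>) \<le> (S + 1) * (\<eta> / (2 * (S + 1)))"
          using False s h S(1) by (intro mult_mono) auto
        also have "\<dots> = \<eta> / 2"
        proof -
          have "S + 1 \<noteq> 0" using S(1) by linarith
          then show ?thesis by (simp add: field_simps)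
        qed
        finally have "f s y \<le> m \<tau> - \<eta> / 2" using S(2)[of s y] False s h t by auto
        moreover have "dist (m s) (m \<tau>) < \<eta> / 2" using False s h by (intro d(2)) (auto simp: dist_real_def)
        then have "m \<tau> - \<eta> / 2 < m s" unfolding dist_real_def by linarith
        ultimately show ?thesis by linarith
      qed
    qed
    then have "\<tau> + h \<in> A" using h \<tau>p by (simp add: A_def)
    then have "\<tau> + h \<le> \<tau>" unfolding \<tau>_def using A(2) by (rule cSup_upper)
    then show False using h by simp
  qed
  \<comment> \<open>At the final time itself the gap yields the strict inequality.\<close>
  then obtain \<eta> where "0 < \<eta>" "f t x \<le> m t - \<eta>"
    using uniform_gap[OF t big1 big2] good\<tau> by auto
  then show ?thesis by simp
qed

end

theorem theorem2p1:
  fixes p :: real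
  assumes "1 \<le> p"
  shows "\<exists>C1>0. \<forall>(f :: real \<Rightarrow> real^'n \<Rightarrow> real) (a :: real \<Rightarrow> real^'n \<Rightarrow> real^'n^'n)
      (\<alpha>::real) (C::real) (\<delta>::real) (\<Lambda>::real) (N::real) (\<kappa>::real) (\<beta>::real) (K::real) (T::real).
    bounded ((\<lambda>(t, x). f t x) ` ({0..1} \<times> UNIV)) \<longrightarrow>
    continuous_on ({0..1} \<times> UNIV) (\<lambda>(t, x). f t x) \<longrightarrow>
    0 \<le> \<alpha> \<longrightarrow> \<alpha> < 2 * p / real CARD('n) \<longrightarrow>
    0 < C \<longrightarrow> 0 < \<delta> \<longrightarrow> 0 < \<Lambda> \<longrightarrow> - \<kappa> / real CARD('n) \<le> \<beta> \<longrightarrow>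
    locally_uniformly_elliptic_on ({0..1} \<times> UNIV) a \<longrightarrow>
    (\<forall>t\<in>{0..1}. \<forall>x. 0 < f t x \<longrightarrow>
       twice_differentiable_at (f t) x \<and>
       (\<lambda>s. f s x) differentiable (at t within {0..1}) \<and>
       vector_derivative (\<lambda>s. f s x) (at t within {0..1})
         \<le> (\<Sum>i\<in>UNIV. \<Sum>j\<in>UNIV. a t x $ i $ j * partial_deriv i (partial_deriv j (f t)) x)
           + C * Linf_norm (pos_part (f t)) powr (1 + \<alpha>)) \<longrightarrow>
    (\<forall>t\<in>{0..1}. \<forall>x. \<delta> * (1 + norm x) powr (\<beta> * real CARD('n) - \<kappa>) \<le> det (a t x)) \<longrightarrow>
    (\<forall>t\<in>{0..1}. \<forall>x. mat_le (a t x) ((\<Lambda> * (1 + norm x) powr (min (2 * \<beta>) 2)) *\<^sub>R mat 1)) \<longrightarrow>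
    (\<forall>t\<in>{0..1}.
       (\<integral>\<^sup>+x. ennreal ((1 + norm x) powr \<kappa> * pos_part (f t) x powr p) \<partial>lborel) \<le> ennreal N) \<longrightarrow>
    0 < K \<longrightarrow> K powr p = C1 * ((1 + \<Lambda>) ^ (CARD('n) + 1) * N / \<delta>) \<longrightarrow>
    T = ((1 + \<Lambda>) / (C * K powr \<alpha>)) powr (1 / (1 - \<alpha> * real CARD('n) / (2 * p))) \<longrightarrow>
    (\<forall>t\<in>{0..1}. t \<le> T \<longrightarrow> (\<forall>x.
       ereal (f t x) < (if t = 0 then \<infinity> else ereal (K * t powr (- real CARD('n) / (2 * p))))))"
proof -
  let ?c1 = "touching_const CARD('n) p (2 powr (real CARD('n) / (2 * p))) (half_const CARD('n) p)"
  let ?c2 = "touching_const CARD('n) p (fast_M CARD('n) p) (fast_A CARD('n) p)"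
  \<comment> \<open>Strictly above both constants, as \<open>touching\<close> asks for a strict
    inequality; the \<open>max 1\<close> secures positivity.\<close>
  define C1 where "C1 = max 1 (max ?c1 ?c2 + 1)"
  have C1_gt: "0 < C1" "?c1 < C1" "?c2 < C1" by (auto simp: C1_def)
  show ?thesis
  proof (intro exI[of _ C1] conjI allI impI ballI C1_gt(1), goal_cases)
    case (1 f a \<alpha> C \<delta> \<Lambda> N \<kappa> \<beta> K T t x)
    interpret degenerate_parabolic f a p C1 \<alpha> C \<delta> \<Lambda> N \<kappa> \<beta> K T
      by unfold_locales (fact assms 1 C1_gt)+
    show ?case
    proof (cases "t = 0")
      case False
      then have "0 < t" "t \<le> 1" "t \<le> T" using 1 by auto
      from strict_bound[OF C1_gt(2,3) this, of x] show ?thesis using False by (simp add: m_def)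
    qed simp
  qed
qed

end
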